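(* Consider the mixed random environment model with drift parameter $\delta \in (-1,1)$ and $\rho = \log\left(\frac{1-\delta}{1+\delta}\right)$ described in the context. Suppose that the distribution of $\zeta_0$ is symmetric about $0$, i.e. $\mathbb{P}[\zeta_0 \le -x] = \mathbb{P}[\zeta_0 \ge x]$ for all $x \ge 0$, and that for some $\alpha \in (1,2)$ and some $c' \in (0,\infty)$, $\mathbb{P}[\zeta_0 > r] \sim c' r^{-\alpha}$ as $r \to \infty$. Suppose that $\phi(n) = n^{-\beta}$ for all $n \ge 1$ (with $\phi(0) \in [0,1]$ arbitrary), where $\beta \in (0,1)$. (i) Suppose that $\beta < 1 - \frac{1}{\alpha}$ and $\delta < 0$. Then for $\mathbb{P}$-a.e. $\omega$, $P_\omega$-a.s., $$\limsup_{t \to \infty} \frac{X_t}{(\log t)^{\frac{1}{1-\beta}}} = \left(\frac{1-\beta}{\rho}\right)^{\frac{1}{1-\beta}}.$$ (ii) Suppose that $\beta > 1 - \frac{1}{\alpha}$. Then for any $\varepsilon > 0$, for $\mathbb{P}$-a.e. $\omega$, $P_\omega$-a.s., for all but finitely many $t \in \mathbb{Z}_+$, $$X_t \le (\log t)^\alpha (\log\log t)^{2+\varepsilon}.$$ On the other hand, there is a constant $c \in (0,\infty)$, depending only on the law of the environment, such that for $\mathbb{P}$-a.e. $\omega$, $P_\omega$-a.s., for infinitely many $t \in \mathbb{Z}_+$, $$X_t \ge c (\log t)^\alpha \log\log\log t.$$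
   Context: Random environment. Let $\mathbb{Z}_+ = \{0,1,2,\ldots\}$. Fix $\delta \in (-1,1)$ and a function $\phi : \mathbb{Z}_+ \to [0,1]$. On a probability space $(\Omega,\mathcal{F},\mathbb{P})$ (with expectation $\mathbb{E}$), let $\chi_0,\chi_1,\ldots$ be independent $\{0,1\}$-valued random variables with $\mathbb{P}[\chi_n = 1] = \phi(n)$, and let $\xi_0,\xi_1,\ldots$ be i.i.d. $(0,1)$-valued random variables, independent of the $\chi_i$. Set $p_n = \frac{1-\delta}{2}\chi_n + \xi_n(1-\chi_n)$, $q_n = 1-p_n$, $\rho = \log\left(\frac{1-\delta}{1+\delta}\right)$ and $\zeta_n = \log\left(\frac{\xi_n}{1-\xi_n}\right)$. The environment is $\omega = (p_0,p_1,p_2,\ldots)$. Random walk. For fixed $\omega$, under the quenched law $P_\omega$, $X = (X_t)_{t \in \mathbb{Z}_+}$ is the Markov chain on $\mathbb{Z}_+$ with $X_0 = 0$ and, for $n \ge 1$, $P_\omega[X_{t+1} = n-1 \mid X_t = n] = p_n$ and $P_\omega[X_{t+1} = n+1 \mid X_t = n] = q_n$; and $P_\omega[X_{t+1} = 0 \mid X_t = 0] = p_0$, $P_\omega[X_{t+1} = 1 \mid X_t = 0] = q_0$. The notation $\sim$ means that the ratio of the two sides tends to $1$. *)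

theory Defs
  imports "HOL-Probability.Probability" "HOL-Library.Landau_Symbols"
begin

section \<open>The random environment\<close>

locale mixed_environment = prob_space M for M :: "'a measure" +
  fixes \<delta> :: real and \<phi> :: "nat \<Rightarrow> real" and chi xi :: "nat \<Rightarrow> 'a \<Rightarrow> real"
  assumes delta_range: "- 1 < \<delta>" "\<delta> < 1"
    and phi_range: "\<And>n. 0 \<le> \<phi> n \<and> \<phi> n \<le> 1"
    and chi_indep: "indep_vars (\<lambda>_. borel) chi UNIV"
    and chi_range: "\<And>n w. w \<in> space M \<Longrightarrow> chi n w \<in> {0, 1}"
    and chi_prob: "\<And>n. prob {w \<in> space M. chi n w = 1} = \<phi> n"
    and xi_indep: "indep_vars (\<lambda>_. borel) xi UNIV"
    and xi_range: "\<And>n w. w \<in> space M \<Longrightarrow> xi n w \<in> {0<..<1}"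
    and xi_ident: "\<And>n. distr M borel (xi n) = distr M borel (xi 0)"
    and chi_xi_indep:
      "indep_var (\<Pi>\<^sub>M n\<in>UNIV. borel) (\<lambda>w n. chi n w) (\<Pi>\<^sub>M n\<in>UNIV. borel) (\<lambda>w n. xi n w)"

definition env_prob ::
    "real \<Rightarrow> (nat \<Rightarrow> 'a \<Rightarrow> real) \<Rightarrow> (nat \<Rightarrow> 'a \<Rightarrow> real) \<Rightarrow> nat \<Rightarrow> 'a \<Rightarrow> real" where
  "env_prob \<delta> chi xi n w = (1 - \<delta>) / 2 * chi n w + xi n w * (1 - chi n w)"

definition log_odds :: "(nat \<Rightarrow> 'a \<Rightarrow> real) \<Rightarrow> nat \<Rightarrow> 'a \<Rightarrow> real" where
  "log_odds xi n w = ln (xi n w / (1 - xi n w))"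

definition drift_rho :: "real \<Rightarrow> real" where
  "drift_rho \<delta> = ln ((1 - \<delta>) / (1 + \<delta>))"

text \<open>The law of the environment \<open>\<omega> = (p\<^sub>0, p\<^sub>1, \<dots>)\<close> on sequence space. Stating
  ``for almost every \<open>\<omega>\<close>'' with respect to this law, rather than with respect to the
  underlying probability space, makes it visible that a constant chosen outside such a
  quantifier depends on the law of the environment only. It implies the corresponding statement
  on the underlying space (lemma \<open>AE_environment_lawD\<close> below).\<close>

definition environment_law ::
    "'a measure \<Rightarrow> real \<Rightarrow> (nat \<Rightarrow> 'a \<Rightarrow> real) \<Rightarrow> (nat \<Rightarrow> 'a \<Rightarrow> real) \<Rightarrow> (nat \<Rightarrow> real) measure" where
  "environment_law M \<delta> chi xi =
     distr M (\<Pi>\<^sub>M n\<in>UNIV. borel) (\<lambda>w n. env_prob \<delta> chi xi n w)"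

context mixed_environment
begin

lemma measurable_chi [measurable]: "chi n \<in> borel_measurable M"
  using chi_indep by (auto simp: indep_vars_def)

lemma measurable_xi [measurable]: "xi n \<in> borel_measurable M"
  using xi_indep by (auto simp: indep_vars_def)

lemma measurable_environment [measurable]:
  "(\<lambda>w n. env_prob \<delta> chi xi n w) \<in> measurable M (\<Pi>\<^sub>M n\<in>UNIV. borel)"
  unfolding env_prob_def by (rule measurable_PiM_single') auto

lemma prob_space_environment_law: "prob_space (environment_law M \<delta> chi xi)"
  unfolding environment_law_def by (rule prob_space_distr) measurable

lemma AE_environment_lawD:
  assumes "AE \<omega> in environment_law M \<delta> chi xi. Q \<omega>"
  shows "AE w in M. Q (\<lambda>n. env_prob \<delta> chi xi n w)"
  using assms unfolding environment_law_def by (rule AE_distrD[rotated]) measurable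

lemma env_prob_range:
  assumes "w \<in> space M" shows "env_prob \<delta> chi xi n w \<in> {0<..<1}"
  using chi_range[OF assms, of n] xi_range[OF assms, of n] delta_range
  by (auto simp: env_prob_def field_simps)

end


section \<open>The quenched walk\<close>

text \<open>One step from \<open>n\<close>: to the left with probability \<open>\<omega> n\<close>, to the right with probability
  \<open>1 - \<omega> n\<close>. By truncated subtraction a left step from \<open>0\<close> stays at \<open>0\<close>, as
  required by the boundary behaviour of the model.\<close>

definition walk_step :: "(nat \<Rightarrow> real) \<Rightarrow> nat \<Rightarrow> nat pmf" where
  "walk_step \<omega> n = map_pmf (\<lambda>left. if left then n - 1 else n + 1) (bernoulli_pmf (\<omega> n))"

text \<open>The conditional law of \<open>X\<^sub>t\<close> given the history \<open>h = (X\<^sub>0, \<dots>, X\<^sub>t\<^sub>-\<^sub>1)\<close>.\<close>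

primrec walk_kernel :: "(nat \<Rightarrow> real) \<Rightarrow> nat \<Rightarrow> (nat \<Rightarrow> nat) \<Rightarrow> nat measure" where
  "walk_kernel \<omega> 0 h = measure_pmf (return_pmf 0)"
| "walk_kernel \<omega> (Suc t) h = measure_pmf (walk_step \<omega> (h t))"

text \<open>The law of the whole trajectory \<open>X = (X\<^sub>0, X\<^sub>1, \<dots>)\<close>, by the theorem of Ionescu-Tulcea;
  it is determined by its values on cylinder sets, see \<open>quenched_law_cylinder\<close>.\<close>

definition quenched_law :: "(nat \<Rightarrow> real) \<Rightarrow> (nat \<Rightarrow> nat) measure" where
  "quenched_law \<omega> =
     projective_family.lim UNIV
       (Ionescu_Tulcea.CI (walk_kernel \<omega>) (\<lambda>_. count_space UNIV)) (\<lambda>_. count_space UNIV)"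

lemma pmf_walk_step:
  assumes "0 \<le> \<omega> n" "\<omega> n \<le> 1"
  shows "pmf (walk_step \<omega> n) (n + 1) = 1 - \<omega> n"
    and "n \<ge> 1 \<Longrightarrow> pmf (walk_step \<omega> n) (n - 1) = \<omega> n"
    and "n = 0 \<Longrightarrow> pmf (walk_step \<omega> n) 0 = \<omega> n"
proof -
  let ?f = "\<lambda>left. if left then n - 1 else n + 1"
  have inj: "inj ?f" by (auto simp: inj_def)
  show "pmf (walk_step \<omega> n) (n + 1) = 1 - \<omega> n"
    using pmf_map_inj'[OF inj, of "bernoulli_pmf (\<omega> n)" False] assms by (simp add: walk_step_def)
  have left: "pmf (walk_step \<omega> n) (n - 1) = \<omega> n"
    using pmf_map_inj'[OF inj, of "bernoulli_pmf (\<omega> n)" True] assms by (simp add: walk_step_def)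
  show "n \<ge> 1 \<Longrightarrow> pmf (walk_step \<omega> n) (n - 1) = \<omega> n" by (rule left)
  show "n = 0 \<Longrightarrow> pmf (walk_step \<omega> n) 0 = \<omega> n" using left by simp
qed

lemma Ionescu_Tulcea_walk: "Ionescu_Tulcea (walk_kernel \<omega>) (\<lambda>_. count_space UNIV)"
proof (rule Ionescu_Tulcea.intro)
  fix i
  show "walk_kernel \<omega> i \<in> measurable (PiM {0..<i} (\<lambda>_. count_space UNIV))
          (subprob_algebra (count_space UNIV))"
  proof (cases i)
    case 0
    then have "walk_kernel \<omega> i = (\<lambda>_. measure_pmf (return_pmf 0))"
      by (simp add: fun_eq_iff)
    then show ?thesis
      by (auto simp: space_subprob_algebra measure_pmf.subprob_space_axioms)
  next
    case (Suc t)
    have "(\<lambda>x. measure_pmf (walk_step \<omega> x)) \<in>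
            measurable (count_space UNIV) (subprob_algebra (count_space UNIV))"
      by (auto simp: space_subprob_algebra measure_pmf.subprob_space_axioms)
    moreover have "(\<lambda>h. h t) \<in>
        measurable (PiM {0..<i} (\<lambda>_. count_space UNIV :: nat measure)) (count_space UNIV)"
      using Suc by (intro measurable_component_singleton) auto
    ultimately have "(\<lambda>h. measure_pmf (walk_step \<omega> (h t))) \<in>
        measurable (PiM {0..<i} (\<lambda>_. count_space UNIV)) (subprob_algebra (count_space UNIV))"
      by (rule measurable_compose[rotated])
    moreover have "walk_kernel \<omega> i = (\<lambda>h. measure_pmf (walk_step \<omega> (h t)))"
      using Suc by (simp add: fun_eq_iff)
    ultimately show ?thesis by simp
  qed
next
  fix i x show "prob_space (walk_kernel \<omega> i x)"
    by (cases i) (simp_all add: measure_pmf.prob_space_axioms)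
qed

lemma sets_quenched_law [measurable_cong]:
  "sets (quenched_law \<omega>) = sets (\<Pi>\<^sub>M t\<in>UNIV. count_space UNIV)"
proof -
  interpret Ionescu_Tulcea "walk_kernel \<omega>" "\<lambda>_. count_space UNIV"
    by (rule Ionescu_Tulcea_walk)
  show ?thesis unfolding quenched_law_def by (rule PF.sets_lim)
qed

lemma quenched_law_cylinder:
  "measure (quenched_law \<omega>) {X. \<forall>i\<le>t. X i = x i} =
     (if x 0 = 0 then \<Prod>i<t. pmf (walk_step \<omega> (x i)) (x (Suc i)) else 0)"
proof -
  interpret Ionescu_Tulcea "walk_kernel \<omega>" "\<lambda>_. count_space UNIV"
    by (rule Ionescu_Tulcea_walk)
  let ?M = "\<lambda>_::nat. count_space (UNIV :: nat set)"
  let ?u = "\<lambda>_::nat. undefined :: nat"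
  define A where "A n = PiE {0..<n} (\<lambda>i. {x i})" for n
  have A_sets[measurable]: "A n \<in> sets (PiM {0..<n} ?M)" for n
    unfolding A_def by (rule sets_PiM_I_finite) auto
  have u: "?u \<in> space (PiM {0..<0} ?M)" by (simp add: space_PiM)
  have step: "emeasure (C 0 (Suc n) ?u) (A (Suc n)) =
      emeasure (C 0 n ?u) (A n) * emeasure (walk_kernel \<omega> n x) {x n}" for n
  proof -
    have ker: "walk_kernel \<omega> n h = walk_kernel \<omega> n x" if "h \<in> A n" for h
      using that by (cases n) (auto simp: A_def PiE_iff)
    have "emeasure (C 0 (Suc n) ?u) (A (Suc n)) =
        (\<integral>\<^sup>+h. emeasure (eP n h) (A (Suc n)) \<partial>C 0 n ?u)"
      using u by (simp, subst emeasure_bind[where N="PiM {0..<Suc n} ?M"])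
        (auto simp: space_C[OF u] sets_C[OF u] measurable_cong_sets[OF sets_C[OF u] refl])
    also have "\<dots> = (\<integral>\<^sup>+h. emeasure (walk_kernel \<omega> n x) {x n} * indicator (A n) h \<partial>C 0 n ?u)"
    proof (rule nn_integral_cong)
      fix h assume "h \<in> space (C 0 n ?u)"
      then have h: "h \<in> space (PiM {0..<n} ?M)" by (simp add: space_C[OF u])
      then have ext: "h \<in> extensional {0..<n}" by (auto simp: space_PiM PiE_iff)
      have vim: "(\<lambda>y. h(n := y)) -` A (Suc n) = (if h \<in> A n then {x n} else {})"
        using ext by (force simp: A_def PiE_iff extensional_def less_Suc_eq split: if_splits)
      show "emeasure (eP n h) (A (Suc n)) = emeasure (walk_kernel \<omega> n x) {x n} * indicator (A n) h"
        using ker[of h] by (simp add: emeasure_eP[OF h A_sets] vim)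
    qed
    also have "\<dots> = emeasure (C 0 n ?u) (A n) * emeasure (walk_kernel \<omega> n x) {x n}"
      by (subst nn_integral_cmult_indicator) (auto simp: sets_C[OF u] mult.commute)
    finally show ?thesis .
  qed
  have C: "emeasure (C 0 (Suc n) ?u) (A (Suc n)) =
      ennreal (if x 0 = 0 then \<Prod>i<n. pmf (walk_step \<omega> (x i)) (x (Suc i)) else 0)" for n
  proof (induction n)
    case 0
    have "emeasure (C 0 0 ?u) (A 0) = 1"
      using u A_sets[of 0] by (simp add: A_def)
    then show ?case
      unfolding step[of 0] by (simp add: emeasure_pmf_single indicator_def)
  next
    case (Suc n)
    then show ?case
      unfolding step[of "Suc n"] by (simp add: emeasure_pmf_single ennreal_mult prod_nonneg)
  qed
  have "{X. \<forall>i\<le>t. X i = x i} = PF.emb UNIV {0..<Suc t} (A (Suc t))"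
    by (auto simp: prod_emb_def A_def PiE_iff less_Suc_eq_le)
  then have "emeasure (quenched_law \<omega>) {X. \<forall>i\<le>t. X i = x i} = emeasure (CI {0..<Suc t}) (A (Suc t))"
    unfolding quenched_law_def by (simp only: lim[OF finite_atLeastLessThan A_sets])
  also have "\<dots> = emeasure (C 0 (Suc t) ?u) (PF.emb {0..<Suc t} {0..<Suc t} (A (Suc t)))"
    by (rule emeasure_CI) auto
  also have "PF.emb {0..<Suc t} {0..<Suc t} (A (Suc t)) = A (Suc t)"
    by (rule prod_emb_id) (auto simp: A_def PiE_iff)
  finally show ?thesis
    unfolding C measure_def by (simp add: prod_nonneg)
qed

lemma prob_space_quenched_law: "prob_space (quenched_law \<omega>)"
proof -
  interpret Ionescu_Tulcea "walk_kernel \<omega>" "\<lambda>_. count_space UNIV"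
    by (rule Ionescu_Tulcea_walk)
  let ?S = "space (PiM {} (\<lambda>_::nat. count_space (UNIV :: nat set)))"
  interpret CI: prob_space "CI {}" by (rule PF.prob_space_P) auto
  have "emeasure (quenched_law \<omega>) (PF.emb UNIV {} ?S) = 1"
    unfolding quenched_law_def using CI.emeasure_space_1
    by (subst lim) (auto simp: CI_def)
  moreover have "PF.emb UNIV {} ?S = space (quenched_law \<omega>)"
    by (simp add: sets_eq_imp_space_eq[OF sets_quenched_law] prod_emb_def space_PiM restrict_def
        vimage_def)
  ultimately show ?thesis by (intro prob_spaceI) simp
qed

end

theory Submission
  imports Defs "HOL-Real_Asymp.Real_Asymp"
begin

text \<open>The potential \<open>V(n) = (\<Sum>k=1..n. ln (p\<^sub>k / q\<^sub>k))\<close> governs the walk. The function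
  \<open>(\<Sum>j<n. exp (V j))\<close> is harmonic away from \<open>0\<close>, so the walk needs time about \<open>exp (max V)\<close> to reach \<open>n\<close>;
  conversely the mean reaching time is at most a polynomial times the exponential of the largest
  rise of \<open>V\<close>. Borel--Cantelli then turns almost sure bounds on \<open>V\<close> into bounds on \<open>X\<close>.

  In part (i) the drift \<open>\<rho> \<Sum> \<phi>\<close> dominates: after truncation, Kolmogorov's maximal inequality gives
  \<open>V(n) \<sim> \<rho> n powr (1 - \<beta>) / (1 - \<beta>)\<close>. In part (ii) \<open>V\<close> is a negligible perturbation of the
  symmetric walk \<open>S\<close> with steps \<open>\<zeta>\<close>. The upper bound needs \<open>P(max S \<le> x) \<le> C sqrt (x powr \<alpha> / n)\<close>:
  splitting at the first maximum bounds the probability of staying nonpositive by \<open>C / sqrt n\<close>, and one way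
  to stay nonpositive is to make a jump below \<open>- x\<close> within the first \<open>x powr \<alpha>\<close> steps and not to rise by more
  than \<open>x\<close> afterwards. The lower bound rests on \<open>P(max \<bar>S\<bar> \<le> x) \<ge> exp (- C n / x powr \<alpha>)\<close> and the
  second Borel--Cantelli lemma along \<open>n = 2 ^ (j ^ 2)\<close>.\<close>

section \<open>Paths of the quenched walk\<close>

text \<open>The quantifier over the environment law shapes the division of labour. A property passes
  from \<open>M\<close> to the image law only as a measurable predicate of \<open>\<omega>\<close>,
  so almost sure statements about the environment are phrased through \<open>potential\<close>
  alone, and everything about the walk is proved for one fixed \<open>\<omega>\<close> with entries
  strictly between 0 and 1.

  The two logarithmic corrections come from the two Borel-Cantelli lemmas. In sqrt (x powr \<alpha>
  / n) with n = 2 ^ k, summability is obtained by taking x powr \<alpha> / n of order k powr -(2 +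
  \<eta>); the walk leaves level n at times t with k of the order of ln ln t, hence the exponent 2 +
  \<epsilon>. In exp (- C n / x powr \<alpha>) with n = 2 ^ (j ^ 2), divergence permits n / x powr
  \<alpha> of order ln j, which is the order of ln ln ln t. The square in the exponent separates the
  scales so far that the path before a block is negligible on the scale of that block, which yields
  the independence needed for the second lemma.\<close>

abbreviation scaled_limsup :: "real \<Rightarrow> (nat \<Rightarrow> nat) \<Rightarrow> ereal" where
  "scaled_limsup \<gamma> X \<equiv> limsup (\<lambda>t. ereal (real (X t) / ln (real t) powr (1 / \<gamma>)))"

text \<open>A.s. lower bound for the maximum of the potential up to time \<open>2 ^ k\<close>, for all large \<open>k\<close>.\<close>

abbreviation climb :: "real \<Rightarrow> real \<Rightarrow> nat \<Rightarrow> real" where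
  "climb \<alpha> \<eta> k \<equiv> (2 ^ k / real k powr (2 + \<eta>)) powr (1 / \<alpha>)"

text \<open>Up to a constant, a.s. bound for the absolute value of the potential up to time \<open>2 ^ j\<^sup>2\<close>, for
  infinitely many \<open>j\<close>.\<close>

abbreviation confinement :: "real \<Rightarrow> nat \<Rightarrow> real" where
  "confinement \<alpha> j \<equiv> (2 ^ (j\<^sup>2) / ln (real j)) powr (1 / \<alpha>)"

text \<open>The majorants it is applied to decay faster than every power, so comparing them with the
  inverse square is enough and leaves a growth comparison that \<open>real_asymp\<close>
  decides.\<close>

lemma summable_bigo_inverse_square:
  fixes f :: "nat \<Rightarrow> real"
  assumes "f \<in> O(\<lambda>k. real k powr - 2)"
  shows "summable f"
  by (rule summable_comparison_test_bigo[OF _ assms]) (simp add: summable_real_powr_iff)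

text \<open>The first Borel-Cantelli lemma, shaped for quantitative use: the bad event
  \<open>P n\<close> needs a summable majorant for large \<open>n\<close> only.\<close>

lemma (in prob_space) AE_eventually_not:
  assumes P: "\<And>n. {w \<in> space M. P n w} \<in> events"
    and le: "\<forall>\<^sub>F n in sequentially. prob {w \<in> space M. P n w} \<le> g n" and g: "summable g"
  shows "AE w in M. \<forall>\<^sub>F n in sequentially. \<not> P n w"
proof -
  have "summable (\<lambda>n. prob {w \<in> space M. P n w})"
    by (rule summable_comparison_test_ev[OF _ g]) (use le in simp)
  then have "AE w in M. \<forall>\<^sub>F n in sequentially. w \<in> space M - {w \<in> space M. P n w}"
    by (intro borel_cantelli_AE1 P) (simp_all add: emeasure_eq_measure)
  then show ?thesis by (rule AE_mp) (auto intro!: AE_I2 elim: eventually_mono)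
qed

section \<open>The potential, and finite paths as a discrete law\<close>

definition potential :: "(nat \<Rightarrow> real) \<Rightarrow> nat \<Rightarrow> real" where
  "potential \<omega> n = (\<Sum>k<n. ln (\<omega> (Suc k) / (1 - \<omega> (Suc k))))"

lemma potential_0 [simp]: "potential \<omega> 0 = 0"
  by (simp add: potential_def)

lemma exp_potential_Suc:
  assumes "0 < \<omega> (Suc k)" "\<omega> (Suc k) < 1"
  shows "exp (potential \<omega> (Suc k)) = \<omega> (Suc k) / (1 - \<omega> (Suc k)) * exp (potential \<omega> k)"
  using assms by (simp add: potential_def exp_add)

text \<open>Paths are kept newest position first: a step of the walk is a \<open>Cons\<close> and
  the current state is \<open>hd\<close>. On this discrete law, drift estimates are inductions on
  \<open>t\<close>.\<close>

primrec walk_path :: "(nat \<Rightarrow> real) \<Rightarrow> nat \<Rightarrow> nat list pmf" where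
  "walk_path \<omega> 0 = return_pmf [0]"
| "walk_path \<omega> (Suc t) =
     bind_pmf (walk_path \<omega> t) (\<lambda>xs. map_pmf (\<lambda>y. y # xs) (walk_step \<omega> (hd xs)))"

definition history :: "nat \<Rightarrow> (nat \<Rightarrow> nat) \<Rightarrow> nat list" where
  "history t X = rev (map X [0..<Suc t])"

lemma history_0: "history 0 X = [X 0]"
  by (simp add: history_def)

lemma history_Suc: "history (Suc t) X = X (Suc t) # history t X"
  by (simp add: history_def)

lemma hd_history: "hd (history t X) = X t"
  by (cases t) (simp_all add: history_0 history_Suc)

lemma history_eq_iff: "history t X = history t Y \<longleftrightarrow> (\<forall>i\<le>t. X i = Y i)"
  by (induction t) (auto simp: history_0 history_Suc le_Suc_eq)

lemma set_history: "set (history t X) = X ` {..t}"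
  unfolding history_def by (simp add: atLeast0LessThan lessThan_Suc_atMost del: upt_Suc)

lemma length_walk_path: "xs \<in> set_pmf (walk_path \<omega> t) \<Longrightarrow> length xs = Suc t"
  by (induction t arbitrary: xs) auto

text \<open>The product is the one in \<open>quenched_law_cylinder\<close>; this agreement
  identifies the law of \<open>history t\<close> in \<open>distr_history\<close>.\<close>

lemma pmf_walk_path:
  "pmf (walk_path \<omega> t) (history t x) =
     (if x 0 = 0 then \<Prod>i<t. pmf (walk_step \<omega> (x i)) (x (Suc i)) else 0)"
proof (induction t)
  case 0
  then show ?case by (simp add: history_0 indicator_def)
next
  case (Suc t)
  have "pmf (map_pmf (\<lambda>y. y # xs) (walk_step \<omega> (hd xs))) (x (Suc t) # history t x) =
      indicator {history t x} xs * pmf (walk_step \<omega> (x t)) (x (Suc t))" for xs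
  proof (cases "xs = history t x")
    case True
    then show ?thesis
      using pmf_map_inj'[of "\<lambda>y. y # xs" "walk_step \<omega> (hd xs)" "x (Suc t)"]
      by (simp add: inj_def hd_history)
  next
    case False
    then have "x (Suc t) # history t x \<notin> set_pmf (map_pmf (\<lambda>y. y # xs) (walk_step \<omega> (hd xs)))"
      by auto
    then show ?thesis using False by (simp add: pmf_eq_0_set_pmf)
  qed
  then have "pmf (walk_path \<omega> (Suc t)) (history (Suc t) x) =
      pmf (walk_path \<omega> t) (history t x) * pmf (walk_step \<omega> (x t)) (x (Suc t))"
    by (simp add: history_Suc pmf_bind measure_pmf_single)
  then show ?case by (simp add: Suc.IH)
qed

lemma measurable_history [measurable]:
  "history t \<in> measurable (\<Pi>\<^sub>M t\<in>UNIV. count_space UNIV) (count_space UNIV)"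
proof (induction t)
  case 0
  have "(\<lambda>X. [X 0 :: nat]) \<in> measurable (\<Pi>\<^sub>M t\<in>UNIV. count_space UNIV) (count_space UNIV)"
    by measurable
  then show ?case by (simp add: history_0[abs_def])
next
  case (Suc t)
  have "(\<lambda>X. X (Suc t) # history t X) \<in>
      measurable (\<Pi>\<^sub>M t\<in>UNIV. count_space (UNIV :: nat set)) (count_space UNIV)"
    using Suc by measurable
  then show ?case by (simp add: history_Suc[abs_def])
qed

text \<open>Lists form a countable type, so point masses decide. A list of length
  \<open>Suc t\<close> is the history of some sequence and its preimage under
  \<open>history t\<close> is a cylinder; any other list has empty preimage and no mass under
  \<open>walk_path\<close>.\<close>

lemma distr_history: "distr (quenched_law \<omega>) (count_space UNIV) (history t) = measure_pmf (walk_path \<omega> t)"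
proof -
  interpret prob_space "quenched_law \<omega>" by (rule prob_space_quenched_law)
  have sp: "space (quenched_law \<omega>) = UNIV"
    using sets_eq_imp_space_eq[OF sets_quenched_law] by (simp add: space_PiM)
  have h [measurable]: "history t \<in> measurable (quenched_law \<omega>) (count_space UNIV)"
    by measurable
  show ?thesis
  proof (rule measure_eqI_countable[where A = UNIV])
    fix ys :: "nat list"
    have "measure (distr (quenched_law \<omega>) (count_space UNIV) (history t)) {ys} =
        pmf (walk_path \<omega> t) ys"
    proof (cases "length ys = Suc t")
      case True
      define x where "x i = rev ys ! i" for i
      have ys: "ys = history t x"
      proof -
        have "rev ys = map x [0..<Suc t]"
          by (rule nth_equalityI) (use True in \<open>auto simp: x_def simp del: upt_Suc\<close>)
        then show ?thesis by (simp add: history_def rev_swap del: upt_Suc)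
      qed
      have "measure (distr (quenched_law \<omega>) (count_space UNIV) (history t)) {ys} =
          measure (quenched_law \<omega>) {X. \<forall>i\<le>t. X i = x i}"
        by (subst measure_distr) (auto simp: sp ys history_eq_iff vimage_def)
      then show ?thesis
        by (simp add: quenched_law_cylinder ys pmf_walk_path)
    next
      case False
      then have "ys \<notin> set_pmf (walk_path \<omega> t)" using length_walk_path by blast
      moreover have "history t -` {ys} = {}" using False by (auto simp: history_def)
      ultimately show ?thesis
        by (simp add: measure_distr set_pmf_iff)
    qed
    then show "emeasure (distr (quenched_law \<omega>) (count_space UNIV) (history t)) {ys} =
        emeasure (measure_pmf (walk_path \<omega> t)) {ys}"
      by (metis emeasure_eq_measure emeasure_pmf_single finite_measure.emeasure_eq_measure
          finite_measure_distr h)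
  qed auto
qed

text \<open>The walk frozen at its first entry into \<open>{n..}\<close>; in a newest-first list the
  tail is the past. The value 0 at the empty list is a dummy, since a path contains at least its
  starting point.\<close>

primrec stopped :: "nat \<Rightarrow> nat list \<Rightarrow> nat" where
  "stopped n [] = 0"
| "stopped n (y # xs) = (if n \<le> stopped n xs then stopped n xs else y)"

lemma stopped_ge_iff: "xs \<noteq> [] \<Longrightarrow> n \<le> stopped n xs \<longleftrightarrow> (\<exists>x\<in>set xs. n \<le> x)"
proof (induction xs)
  case (Cons y xs)
  then show ?case by (cases xs) auto
qed simp

lemma stopped_eq_hd: "\<not> n \<le> stopped n xs \<Longrightarrow> xs \<noteq> [] \<Longrightarrow> stopped n xs = hd xs"
  by (cases xs) (auto split: if_splits)

lemma nn_integral_walk_step: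
  assumes "0 \<le> \<omega> k" "\<omega> k \<le> 1" "\<And>x. 0 \<le> f x"
  shows "(\<integral>\<^sup>+y. ennreal (f y) \<partial>walk_step \<omega> k) =
    ennreal (\<omega> k * f (k - 1) + (1 - \<omega> k) * f (k + 1))"
  using assms by (simp add: walk_step_def nn_integral_bernoulli_pmf ennreal_mult'[symmetric] 
     ennreal_plus[symmetric] mult.commute del: ennreal_plus)

text \<open>A one-step drift bound, iterated; it replaces optional stopping at the level \<open>n\<close>.\<close>

lemma nn_integral_stopped_le:
  fixes F :: "nat \<Rightarrow> nat \<Rightarrow> real"
  assumes \<omega>: "\<And>k. 0 \<le> \<omega> k \<and> \<omega> k \<le> 1" and F: "\<And>t k. 0 \<le> F t k" and a: "0 \<le> a"
    and inside: "\<And>t k. k < n \<Longrightarrow> \<omega> k * F (Suc t) (k - 1) + (1 - \<omega> k) * F (Suc t) (k + 1) \<le> F t k + a"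
    and outside: "\<And>t k. n \<le> k \<Longrightarrow> F (Suc t) k \<le> F t k + a"
  shows "(\<integral>\<^sup>+xs. ennreal (F t (stopped n xs)) \<partial>walk_path \<omega> t) \<le> ennreal (F 0 0 + a * real t)"
proof (induction t)
  case 0
  then show ?case by simp
next
  case (Suc t)
  have "(\<integral>\<^sup>+xs. ennreal (F (Suc t) (stopped n xs)) \<partial>walk_path \<omega> (Suc t)) =
      (\<integral>\<^sup>+xs. (\<integral>\<^sup>+y. ennreal (F (Suc t) (stopped n (y # xs))) \<partial>walk_step \<omega> (hd xs)) \<partial>walk_path \<omega> t)"
    by (simp del: stopped.simps)
  also have "\<dots> \<le> (\<integral>\<^sup>+xs. ennreal (F t (stopped n xs)) + ennreal a \<partial>walk_path \<omega> t)"
  proof (rule nn_integral_mono_AE, unfold AE_measure_pmf_iff, rule ballI)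
    fix xs assume "xs \<in> set_pmf (walk_path \<omega> t)"
    then have "xs \<noteq> []" using length_walk_path by fastforce
    show "(\<integral>\<^sup>+y. ennreal (F (Suc t) (stopped n (y # xs))) \<partial>walk_step \<omega> (hd xs)) \<le>
        ennreal (F t (stopped n xs)) + ennreal a"
    proof (cases "n \<le> stopped n xs")
      case True
      then show ?thesis
        using outside[OF True, of t] F a by (simp add: ennreal_plus[symmetric] ennreal_leI del: ennreal_plus)
    next
      case False
      then have eq: "stopped n xs = hd xs" using \<open>xs \<noteq> []\<close> by (rule stopped_eq_hd)
      have "(\<integral>\<^sup>+y. ennreal (F (Suc t) (stopped n (y # xs))) \<partial>walk_step \<omega> (hd xs)) =
          (\<integral>\<^sup>+y. ennreal (F (Suc t) y) \<partial>walk_step \<omega> (hd xs))"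
        using False by simp
      also have "\<dots> = ennreal (\<omega> (hd xs) * F (Suc t) (hd xs - 1) + (1 - \<omega> (hd xs)) * F (Suc t) (hd xs + 1))"
        using \<omega> F by (intro nn_integral_walk_step) auto
      also have "\<dots> \<le> ennreal (F t (hd xs) + a)"
        using False eq by (intro ennreal_leI inside) auto
      finally show ?thesis using F a eq by simp
    qed
  qed
  also have "\<dots> = (\<integral>\<^sup>+xs. ennreal (F t (stopped n xs)) \<partial>walk_path \<omega> t) + ennreal a"
    by (simp add: nn_integral_add)
  also have "\<dots> \<le> ennreal (F 0 0 + a * real t) + ennreal a"
    using Suc.IH by (intro add_right_mono)
  also have "\<dots> = ennreal (F 0 0 + a * real (Suc t))"
    using F a by (simp add: ennreal_plus[symmetric] algebra_simps del: ennreal_plus)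
  finally show ?case .
qed

text \<open>Markov's inequality for the stopped walk.\<close>

lemma measure_stopped_le:
  fixes f :: "nat \<Rightarrow> real"
  assumes "(\<integral>\<^sup>+xs. ennreal (f (stopped n xs)) \<partial>walk_path \<omega> t) \<le> ennreal B"
    and "\<And>k. P k \<Longrightarrow> c \<le> f k" "0 < c" "0 \<le> B"
  shows "measure (walk_path \<omega> t) {xs. P (stopped n xs)} \<le> B / c"
proof -
  have "ennreal c * emeasure (walk_path \<omega> t) {xs. P (stopped n xs)} =
      (\<integral>\<^sup>+xs. ennreal c * indicator {xs. P (stopped n xs)} xs \<partial>walk_path \<omega> t)"
    by (simp add: nn_integral_cmult)
  also have "\<dots> \<le> (\<integral>\<^sup>+xs. ennreal (f (stopped n xs)) \<partial>walk_path \<omega> t)"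
    using assms by (intro nn_integral_mono) (auto simp: indicator_def ennreal_leI)
  also note assms(1)
  finally have "ennreal (c * measure (walk_path \<omega> t) {xs. P (stopped n xs)}) \<le> ennreal B"
    using assms by (simp add: measure_pmf.emeasure_eq_measure ennreal_mult)
  then show ?thesis using assms by (simp add: field_simps)
qed

lemma space_quenched_law [simp]: "space (quenched_law \<omega>) = UNIV"
  using sets_eq_imp_space_eq[OF sets_quenched_law] by (simp add: space_PiM)

lemma measure_history:
  "measure (quenched_law \<omega>) {X. P (history t X)} = measure (walk_path \<omega> t) {xs. P xs}"
proof -
  have "measure (walk_path \<omega> t) {xs. P xs} =
      measure (distr (quenched_law \<omega>) (count_space UNIV) (history t)) {xs. P xs}"
    by (simp add: distr_history)
  also have "\<dots> = measure (quenched_law \<omega>) {X. P (history t X)}"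
    by (subst measure_distr) (auto simp: vimage_def)
  finally show ?thesis by simp
qed

text \<open>Freezing turns an event about the whole path up to time \<open>t\<close> into one about
  the value of the stopped walk at time \<open>t\<close>, where Markov's inequality applies.\<close>

lemma measure_reach:
  "measure (quenched_law \<omega>) {X. \<exists>s\<le>t. n \<le> X s} = measure (walk_path \<omega> t) {xs. n \<le> stopped n xs}"
proof -
  have "history t X \<noteq> []" for X by (simp add: history_def)
  then have "{X. \<exists>s\<le>t. n \<le> X s} = {X. n \<le> stopped n (history t X)}"
    by (auto simp: stopped_ge_iff set_history)
  then show ?thesis using measure_history[of \<omega> "\<lambda>xs. n \<le> stopped n xs" t] by simp
qed

lemma measure_not_reach:
  "measure (quenched_law \<omega>) {X. \<forall>s\<le>t. X s < n} = measure (walk_path \<omega> t) {xs. stopped n xs < n}"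
proof -
  have "history t X \<noteq> []" for X by (simp add: history_def)
  then have "{X. \<forall>s\<le>t. X s < n} = {X. stopped n (history t X) < n}"
    by (subst not_le[symmetric], subst stopped_ge_iff) (auto simp: set_history not_le)
  then show ?thesis using measure_history[of \<omega> "\<lambda>xs. stopped n xs < n" t] by simp
qed

section \<open>Hitting probabilities and mean crossing times\<close>

definition scale :: "(nat \<Rightarrow> real) \<Rightarrow> nat \<Rightarrow> real" where
  "scale \<omega> n = (\<Sum>j<n. exp (potential \<omega> j))"

lemma scale_nonneg: "0 \<le> scale \<omega> n"
  by (simp add: scale_def sum_nonneg)

lemma scale_mono: "m \<le> n \<Longrightarrow> scale \<omega> m \<le> scale \<omega> n"
  unfolding scale_def by (rule sum_mono2) auto

lemma exp_potential_le_scale: "j < n \<Longrightarrow> exp (potential \<omega> j) \<le> scale \<omega> n"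
  unfolding scale_def by (rule member_le_sum) auto

text \<open>\<open>scale\<close> is harmonic for the walk away from \<open>0\<close> and gains less than \<open>1\<close> per visit to \<open>0\<close>.\<close>

lemma prob_reach_le:
  assumes \<omega>: "\<And>k. 0 < \<omega> k \<and> \<omega> k < 1" and n: "0 < n"
  shows "measure (quenched_law \<omega>) {X. \<exists>s\<le>t. n \<le> X s} \<le> real t / scale \<omega> n"
proof -
  have step: "\<omega> k * scale \<omega> (k - 1) + (1 - \<omega> k) * scale \<omega> (k + 1) \<le> scale \<omega> k + 1" for k
  proof (cases k)
    case 0
    then show ?thesis using \<omega>[of 0] by (simp add: scale_def)
  next
    case (Suc j)
    \<comment> \<open>Reversibility: the gain of \<open>scale\<close> on a step up from
      \<open>k\<close>, weighted by its probability, equals the weighted loss on a step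
      down.\<close>
    have "(1 - \<omega> k) * exp (potential \<omega> k) = \<omega> k * exp (potential \<omega> j)"
      using exp_potential_Suc[of \<omega> j] \<omega>[of k] by (simp add: Suc)
    then have "(1 - \<omega> k) * scale \<omega> (k + 1) = (1 - \<omega> k) * scale \<omega> k + \<omega> k * exp (potential \<omega> j)"
      by (simp add: scale_def algebra_simps)
    then show ?thesis by (simp add: Suc scale_def algebra_simps)
  qed
  \<comment> \<open>Each step adds at most 1 to the mean of \<open>scale\<close>, hence at most
    \<open>t\<close> in total; Markov's inequality then divides by the value at level
    \<open>n\<close>.\<close>
  have "(\<integral>\<^sup>+xs. ennreal (scale \<omega> (stopped n xs)) \<partial>walk_path \<omega> t) \<le> ennreal (scale \<omega> 0 + 1 * real t)"
    using step \<omega> by (intro nn_integral_stopped_le[where F = "\<lambda>_. scale \<omega>"])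
      (auto simp: scale_nonneg less_imp_le)
  moreover have "0 < scale \<omega> n"
    using exp_potential_le_scale[of 0 n \<omega>] n by simp
  ultimately have "measure (walk_path \<omega> t) {xs. n \<le> stopped n xs} \<le> (scale \<omega> 0 + 1 * real t) / scale \<omega> n"
    by (intro measure_stopped_le[where f = "scale \<omega>"]) (auto simp: scale_mono scale_nonneg)
  then show ?thesis by (simp add: measure_reach scale_def)
qed

text \<open>The mean time to pass from j to j + 1. The first-step equation d j = 1 + \<omega> j * (d
  (j - 1) + d j), solved for d j, serves as the definition, so no expectation has to be
  evaluated.\<close>

primrec crossing_time :: "(nat \<Rightarrow> real) \<Rightarrow> nat \<Rightarrow> real" where
  "crossing_time \<omega> 0 = 1 / (1 - \<omega> 0)"
| "crossing_time \<omega> (Suc j) = (1 + \<omega> (Suc j) * crossing_time \<omega> j) / (1 - \<omega> (Suc j))"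

text \<open>After division by \<open>exp (potential \<omega> j)\<close> the recursion telescopes
  with increment exp (- V j) / p, where p = \<open>\<omega> (Suc j)\<close>. Writing 1 / p = 1 + (1
  - p) / p turns the increment into two exponentials of the potential, so no lower bound on the
  entries of \<open>\<omega>\<close> has to be assumed.\<close>

lemma crossing_time_eq:
  assumes \<omega>: "\<And>k. 0 < \<omega> k \<and> \<omega> k < 1"
  shows "crossing_time \<omega> j = exp (potential \<omega> j) *
    (1 / (1 - \<omega> 0) + (\<Sum>i<j. exp (- potential \<omega> (Suc i)) + exp (- potential \<omega> i)))"
proof (induction j)
  case 0
  then show ?case by simp
next
  case (Suc j)
  define p where "p = \<omega> (Suc j)"
  define E where "E = exp (potential \<omega> j)"
  have p: "0 < p" "p < 1" using \<omega> by (auto simp: p_def)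
  have E: "E > 0" by (simp add: E_def)
  have e: "exp (potential \<omega> (Suc j)) = p / (1 - p) * E"
    using exp_potential_Suc[of \<omega> j] \<omega> by (simp add: p_def E_def)
  show ?case
    using p E by (simp add: Suc.IH e exp_minus p_def[symmetric] E_def[symmetric]) (simp add: field_simps)
qed

text \<open>The mean time to reach \<open>n\<close> from 0 is the sum of the crossing times below
  \<open>n\<close>. By \<open>crossing_time_eq\<close> each of these is a sum of exponentials of
  rises of the potential, the term for site 0 being weighted by \<open>1 / (1 - \<omega> 0)\<close>;
  the largest rise \<open>R\<close> bounds them all.\<close>

lemma prob_not_reach_le:
  assumes \<omega>: "\<And>k. 0 < \<omega> k \<and> \<omega> k < 1" and t: "0 < t"
    and R: "\<And>i j. i \<le> j \<Longrightarrow> j < n \<Longrightarrow> potential \<omega> j - potential \<omega> i \<le> R"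
  shows "measure (quenched_law \<omega>) {X. \<forall>s\<le>t. X s < n} \<le>
    real n * (1 / (1 - \<omega> 0) + 2 * real n) * exp R / real t"
proof -
  define d where "d = crossing_time \<omega>"
  define g where "g k = (\<Sum>j\<in>{k..<n}. d j)" for k
  have d: "0 \<le> d j" for j
    unfolding d_def
  proof (induction j)
    case (Suc j)
    then show ?case using \<omega>[of "Suc j"] by simp
  qed (use \<omega>[of 0] in simp)
  have g: "0 \<le> g k" for k by (simp add: g_def sum_nonneg d)
  have g_less: "g k = d k + g (Suc k)" if "k < n" for k
    using that by (simp add: g_def sum.atLeast_Suc_lessThan)
  have step: "\<omega> k * g (k - 1) + (1 - \<omega> k) * g (k + 1) + 1 = g k" if "k < n" for k
  proof (cases k)
    case 0
    have "(1 - \<omega> 0) * d 0 = 1" using \<omega>[of 0] by (simp add: d_def)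
    then show ?thesis using g_less[OF that] 0 by (simp add: algebra_simps)
  next
    case (Suc j)
    have "(1 - \<omega> k) * d k = 1 + \<omega> k * d j"
      using \<omega>[of k] by (simp add: d_def Suc)
    moreover have "g j = d j + g k" "g k = d k + g (Suc k)"
      using that Suc g_less[of j] g_less[of k] by auto
    ultimately show ?thesis using Suc by (simp add: algebra_simps)
  qed
  \<comment> \<open>Remaining mean time plus elapsed time, with the clock dropped once level
    \<open>n\<close> is reached. This does not increase in mean, and it is at least \<open>t\<close>
    if the level has not been reached by time \<open>t\<close>.\<close>
  define F where "F s k = g k + (if k < n then real s else 0)" for s k
  have "(\<integral>\<^sup>+xs. ennreal (F t (stopped n xs)) \<partial>walk_path \<omega> t) \<le> ennreal (F 0 0 + 0 * real t)"
  proof (intro nn_integral_stopped_le)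
    fix s k assume k: "k < n"
    have "\<omega> k * F (Suc s) (k - 1) + (1 - \<omega> k) * F (Suc s) (k + 1) \<le>
        \<omega> k * (g (k - 1) + (real s + 1)) + (1 - \<omega> k) * (g (k + 1) + (real s + 1))"
      using \<omega>[of k] by (intro add_mono mult_left_mono) (auto simp: F_def)
    also have "\<dots> = g k + real s"
      using step[OF k] by (simp add: algebra_simps)
    finally show "\<omega> k * F (Suc s) (k - 1) + (1 - \<omega> k) * F (Suc s) (k + 1) \<le> F s k + 0"
      using k by (simp add: F_def)
  qed (use \<omega> g in \<open>auto simp: F_def less_imp_le\<close>)
  moreover have "F 0 0 = g 0" by (simp add: F_def)
  ultimately have "(\<integral>\<^sup>+xs. ennreal (F t (stopped n xs)) \<partial>walk_path \<omega> t) \<le> ennreal (g 0)"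
    by simp
  then have "measure (walk_path \<omega> t) {xs. stopped n xs < n} \<le> g 0 / real t"
    using t g by (intro measure_stopped_le[where f = "F t"]) (auto simp: F_def)
  also have "g 0 \<le> (\<Sum>j\<in>{0..<n}. (1 / (1 - \<omega> 0) + 2 * real n) * exp R)"
    unfolding g_def
  proof (rule sum_mono)
    fix j assume "j \<in> {0..<n}"
    then have j: "j < n" by simp
    have 1: "exp (potential \<omega> j) * exp (- potential \<omega> i) \<le> exp R" if "i \<le> j" for i
      using R[OF that j] by (simp add: exp_add[symmetric])
    have "d j = exp (potential \<omega> j) * exp (- potential \<omega> 0) / (1 - \<omega> 0) +
       (\<Sum>i<j. exp (potential \<omega> j) * exp (- potential \<omega> (Suc i)) + exp (potential \<omega> j) * exp (- potential \<omega> i))"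
      unfolding d_def crossing_time_eq[OF \<omega>] by (simp add: distrib_left sum_distrib_left)
    also have "\<dots> \<le> exp R / (1 - \<omega> 0) + (\<Sum>i<j. exp R + exp R)"
      using \<omega>[of 0] by (intro add_mono sum_mono divide_right_mono 1) auto
    also have "\<dots> \<le> exp R / (1 - \<omega> 0) + 2 * real n * exp R"
      using j by (simp add: mult_right_mono)
    finally show "d j \<le> (1 / (1 - \<omega> 0) + 2 * real n) * exp R"
      by (simp add: algebra_simps)
  qed
  finally show ?thesis
    using t by (simp add: measure_not_reach divide_right_mono mult.assoc)
qed

section \<open>Reaching times and the potential\<close>

lemma sets_Collect_quenched:
  assumes "Measurable.pred (\<Pi>\<^sub>M t\<in>UNIV. count_space UNIV) P"
  shows "{X. P X} \<in> sets (quenched_law \<omega>)"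
  using assms by (simp add: sets_quenched_law pred_def space_PiM)

lemma sets_reach: "{X. \<exists>s\<le>t. n \<le> X s} \<in> sets (quenched_law \<omega>)"
  by (rule sets_Collect_quenched) measurable

lemma sets_not_reach: "{X. \<forall>s\<le>t. X s < n} \<in> sets (quenched_law \<omega>)"
  by (rule sets_Collect_quenched) measurable

text \<open>One site below \<open>n k\<close> with potential at least \<open>a k\<close> already
  makes \<open>scale\<close> at least exp (a k), so reaching \<open>n k\<close> by time exp (b k)
  has probability at most exp (b k - a k).\<close>

lemma AE_eventually_below:
  fixes n :: "nat \<Rightarrow> nat" and a b :: "nat \<Rightarrow> real"
  assumes \<omega>: "\<And>k. 0 < \<omega> k \<and> \<omega> k < 1"
    and ev: "\<forall>\<^sub>F k in sequentially. \<exists>j<n k. a k \<le> potential \<omega> j"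
    and sum: "summable (\<lambda>k. exp (b k - a k))"
  shows "AE X in quenched_law \<omega>. \<forall>\<^sub>F k in sequentially. \<forall>s. real s \<le> exp (b k) \<longrightarrow> X s < n k"
proof -
  define t where "t k = nat \<lfloor>exp (b k)\<rfloor>" for k
  have t: "real (t k) \<le> exp (b k)" for k by (simp add: t_def)
  interpret prob_space "quenched_law \<omega>" by (rule prob_space_quenched_law)
  have "AE X in quenched_law \<omega>. \<forall>\<^sub>F k in sequentially. \<not> (\<exists>s\<le>t k. n k \<le> X s)"
  proof (rule AE_eventually_not[OF _ _ sum])
    show "\<forall>\<^sub>F k in sequentially. prob {X \<in> space (quenched_law \<omega>). \<exists>s\<le>t k. n k \<le> X s} \<le> exp (b k - a k)"
        using ev
      proof eventually_elim
        case (elim k)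
        then obtain j where j: "j < n k" "a k \<le> potential \<omega> j" by blast
        have "measure (quenched_law \<omega>) {X. \<exists>s\<le>t k. n k \<le> X s} \<le> real (t k) / scale \<omega> (n k)"
          using j by (intro prob_reach_le \<omega>) auto
        also have "\<dots> \<le> exp (b k) / exp (a k)"
        proof (rule frac_le)
          have "exp (a k) \<le> exp (potential \<omega> j)" using j by simp
          also have "\<dots> \<le> scale \<omega> (n k)" by (rule exp_potential_le_scale[OF j(1)])
          finally show "exp (a k) \<le> scale \<omega> (n k)" .
        qed (use t in auto)
        finally show ?case by (simp add: exp_diff)
      qed
  qed (simp add: sets_reach)
  then show ?thesis
  proof (rule AE_mp, intro AE_I2 impI)
    fix X assume "\<forall>\<^sub>F k in sequentially. \<not> (\<exists>s\<le>t k. n k \<le> X s)"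
    then show "\<forall>\<^sub>F k in sequentially. \<forall>s. real s \<le> exp (b k) \<longrightarrow> X s < n k"
    proof eventually_elim
      case (elim k)
      show ?case
      proof (intro allI impI)
        fix s :: nat assume "real s \<le> exp (b k)"
        then have "s \<le> t k" unfolding t_def by (simp add: le_nat_floor)
        moreover have "\<not> (\<exists>s\<le>t k. n k \<le> X s)" using elim by simp
        ultimately show "X s < n k" by (meson not_le)
      qed
    qed
  qed
qed

text \<open>The rise bound stands as a premise inside the almost sure statement: in
  \<open>walk_lower\<close> it holds for infinitely many k only. Where it fails, the bad event is
  empty.\<close>

lemma AE_eventually_above:
  fixes n :: "nat \<Rightarrow> nat" and R b :: "nat \<Rightarrow> real"
  assumes \<omega>: "\<And>k. 0 < \<omega> k \<and> \<omega> k < 1"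
    and b: "\<And>k. 0 \<le> b k"
    and sum: "summable (\<lambda>k. real (n k) * (1 / (1 - \<omega> 0) + 2 * real (n k)) * exp (R k - b k))"
  shows "AE X in quenched_law \<omega>. \<forall>\<^sub>F k in sequentially.
    (\<forall>i j. i \<le> j \<longrightarrow> j < n k \<longrightarrow> potential \<omega> j - potential \<omega> i \<le> R k) \<longrightarrow>
    (\<exists>s. real s \<le> exp (b k) \<and> n k \<le> X s)"
proof -
  define G where "G k \<longleftrightarrow> (\<forall>i j. i \<le> j \<longrightarrow> j < n k \<longrightarrow> potential \<omega> j - potential \<omega> i \<le> R k)" for k
  define t where "t k = nat \<lfloor>exp (b k)\<rfloor>" for k
  \<comment> \<open>As \<open>b k\<close> is nonnegative, the horizon is at least 1 and rounding
    down costs at most a factor 2, which reappears in the summable majorant.\<close>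
  have t: "exp (b k) / 2 \<le> real (t k)" "0 < t k" for k
  proof -
    have "1 \<le> exp (b k)" using b by simp
    then show "0 < t k" by (simp add: t_def)
    have "1 \<le> real (t k)" using \<open>0 < t k\<close> by simp
    moreover have "exp (b k) < real (t k) + 1" using \<open>1 \<le> exp (b k)\<close> unfolding t_def by linarith
    ultimately show "exp (b k) / 2 \<le> real (t k)" by linarith
  qed
  have c: "0 \<le> 1 / (1 - \<omega> 0)" using \<omega>[of 0] by simp
  interpret prob_space "quenched_law \<omega>" by (rule prob_space_quenched_law)
  have "AE X in quenched_law \<omega>. \<forall>\<^sub>F k in sequentially. \<not> (G k \<and> (\<forall>s\<le>t k. X s < n k))"
  proof (rule AE_eventually_not[OF _ always_eventually summable_mult[OF sum]], safe)
    fix k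
    show "{X \<in> space (quenched_law \<omega>). G k \<and> (\<forall>s\<le>t k. X s < n k)} \<in> events"
      by (cases "G k") (simp_all add: sets_not_reach)
    define P where "P = real (n k) * (1 / (1 - \<omega> 0) + 2 * real (n k))"
    have P: "0 \<le> P" using c by (simp add: P_def)
    show "prob {X \<in> space (quenched_law \<omega>). G k \<and> (\<forall>s\<le>t k. X s < n k)} \<le>
        2 * (real (n k) * (1 / (1 - \<omega> 0) + 2 * real (n k)) * exp (R k - b k))"
    proof (cases "G k")
      case True
      then have "prob {X. \<forall>s\<le>t k. X s < n k} \<le> P * exp (R k) / real (t k)"
        unfolding P_def using t \<omega> by (intro prob_not_reach_le) (auto simp: G_def)
      also have "\<dots> \<le> P * exp (R k) / (exp (b k) / 2)"
        using t[of k] P by (intro divide_left_mono) auto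
      finally show ?thesis using True by (simp add: P_def exp_diff mult_ac)
    qed (use P in \<open>simp add: P_def\<close>)
  qed
  then show ?thesis
  proof (rule AE_mp, intro AE_I2 impI)
    fix X assume "\<forall>\<^sub>F k in sequentially. \<not> (G k \<and> (\<forall>s\<le>t k. X s < n k))"
    then show "\<forall>\<^sub>F k in sequentially.
      (\<forall>i j. i \<le> j \<longrightarrow> j < n k \<longrightarrow> potential \<omega> j - potential \<omega> i \<le> R k) \<longrightarrow>
      (\<exists>s. real s \<le> exp (b k) \<and> n k \<le> X s)"
    proof eventually_elim
      case (elim k)
      show ?case
      proof
        assume "\<forall>i j. i \<le> j \<longrightarrow> j < n k \<longrightarrow> potential \<omega> j - potential \<omega> i \<le> R k"
        then have "G k" unfolding G_def .
        then obtain s where "s \<le> t k" "n k \<le> X s" using elim by (auto simp: not_less)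
        moreover have "real (t k) \<le> exp (b k)" by (simp add: t_def)
        ultimately show "\<exists>s. real s \<le> exp (b k) \<and> n k \<le> X s"
          by (intro exI[of _ s]) auto
      qed
    qed
  qed
qed

text \<open>A trajectory is bounded on bounded time intervals, so reaching the levels \<open>n k\<close> takes unbounded times.\<close>

lemma INFM_reached:
  fixes X n :: "nat \<Rightarrow> nat" and T :: "nat \<Rightarrow> real"
  assumes n: "filterlim n at_top sequentially"
    and inf: "\<exists>\<^sub>F k in sequentially. \<exists>s. real s \<le> T k \<and> n k \<le> X s"
    and P: "\<And>k s. k \<ge> k0 \<Longrightarrow> s \<ge> s0 \<Longrightarrow> real s \<le> T k \<Longrightarrow> n k \<le> X s \<Longrightarrow> P s"
  shows "\<exists>\<^sub>\<infinity>s. P s"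
  unfolding INFM_nat_le
proof
  fix m
  define B where "B = Max (X ` {..max m s0})"
  have B: "X s \<le> B" if "s \<le> max m s0" for s unfolding B_def using that by (intro Max_ge) auto
  have "\<forall>\<^sub>F k in sequentially. B < n k \<and> k0 \<le> k"
    by (intro eventually_conj eventually_compose_filterlim[OF eventually_gt_at_top n] eventually_ge_at_top)
  from frequently_ex[OF frequently_eventually_conj[OF inf this]]
  obtain k s where ks: "B < n k" "k0 \<le> k" "real s \<le> T k" "n k \<le> X s" by blast
  then have "max m s0 < s" using B[of s] by (meson leD le_less_trans less_le_trans not_le)
  then show "\<exists>s\<ge>m. P s" using P[of k s] ks by (intro exI[of _ s]) auto
qed

section \<open>From growth of the potential to growth of the walk\<close>

lemma tendsto_upper_bound_ratio:
  fixes V :: "nat \<Rightarrow> real"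
  assumes lim: "(\<lambda>n. V n / real n powr \<gamma>) \<longlonglongrightarrow> L" and c: "L < c"
  shows "\<forall>\<^sub>F n in sequentially. V n \<le> c * real n powr \<gamma>"
  using order_tendstoD(2)[OF lim c] eventually_gt_at_top[of 0]
proof eventually_elim
  case (elim n)
  then show ?case by (simp add: field_simps)
qed

lemma tendsto_lower_bound_ratio:
  fixes V :: "nat \<Rightarrow> real"
  assumes lim: "(\<lambda>n. V n / real n powr \<gamma>) \<longlonglongrightarrow> L" and c: "c < L"
  shows "\<forall>\<^sub>F n in sequentially. c * real n powr \<gamma> \<le> V n"
  using order_tendstoD(1)[OF lim c] eventually_gt_at_top[of 0]
proof eventually_elim
  case (elim n)
  then show ?case by (simp add: field_simps)
qed

text \<open>Between c and L lies d: the potential at k eventually exceeds d * k powr \<gamma>, while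
  times up to exp (c * k powr \<gamma>) are considered. The gap d - c makes the error probabilities
  summable.\<close>

lemma walk_limsup_le:
  assumes \<omega>: "\<And>k. 0 < \<omega> k \<and> \<omega> k < 1" and \<gamma>: "0 < \<gamma>"
    and lim: "(\<lambda>n. potential \<omega> n / real n powr \<gamma>) \<longlonglongrightarrow> L"
    and c: "0 < c" "c < L"
  shows "AE X in quenched_law \<omega>.
    scaled_limsup \<gamma> X \<le> ereal ((1 / c) powr (1 / \<gamma>))"
proof -
  define d where "d = (c + L) / 2"
  have d: "c < d" "d < L" using c by (simp_all add: d_def)
  have "summable (\<lambda>k. exp (c * real k powr \<gamma> - d * real k powr \<gamma>))"
  proof (rule summable_bigo_inverse_square)
    have "(\<lambda>k. exp (- ((d - c) * real k powr \<gamma>))) \<in> O(\<lambda>k. real k powr - 2)"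
      using d \<gamma> by real_asymp
    then show "(\<lambda>k. exp (c * real k powr \<gamma> - d * real k powr \<gamma>)) \<in> O(\<lambda>k. real k powr - 2)"
      by (simp add: algebra_simps)
  qed
  moreover have "\<forall>\<^sub>F k in sequentially. \<exists>j<Suc k. d * real k powr \<gamma> \<le> potential \<omega> j"
    using tendsto_lower_bound_ratio[OF lim d(2)] by eventually_elim auto
  ultimately have "AE X in quenched_law \<omega>. \<forall>\<^sub>F k in sequentially.
      \<forall>s. real s \<le> exp (c * real k powr \<gamma>) \<longrightarrow> X s < Suc k"
    by (intro AE_eventually_below[OF \<omega>])
  then show ?thesis
  proof (rule AE_mp, intro AE_I2 impI)
    fix X assume "\<forall>\<^sub>F k in sequentially. \<forall>s. real s \<le> exp (c * real k powr \<gamma>) \<longrightarrow> X s < Suc k"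
    then obtain k0 where k0: "\<And>k s. k0 \<le> k \<Longrightarrow> real s \<le> exp (c * real k powr \<gamma>) \<Longrightarrow> X s < Suc k"
      by (auto simp: eventually_sequentially)
    \<comment> \<open>The inverse of the time scale exp (c * k powr \<gamma>). Rounding
      \<open>g t\<close> up gives the first level whose horizon covers t, and the overshoot of at
      most 1 vanishes in the ratio.\<close>
    define g where "g t = (ln (real t) / c) powr (1 / \<gamma>)" for t :: nat
    have "filterlim g at_top sequentially" unfolding g_def using c \<gamma> by real_asymp
    then have ev: "\<forall>\<^sub>F t in sequentially. real k0 \<le> g t" by (simp add: filterlim_at_top)
    have bound: "\<forall>\<^sub>F t in sequentially. real (X t) / ln (real t) powr (1 / \<gamma>) \<le>
        (g t + 1) / ln (real t) powr (1 / \<gamma>)"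
      using ev eventually_gt_at_top[of 1]
    proof eventually_elim
      case (elim t)
      define k where "k = nat \<lceil>g t\<rceil>"
      have g0: "0 \<le> g t" by (simp add: g_def)
      have k: "g t \<le> real k" "real k \<le> g t + 1" using g0 unfolding k_def by linarith+
      have ln: "0 < ln (real t)" using elim by simp
      have "g t powr \<gamma> = ln (real t) / c"
        using ln c \<gamma> by (simp add: g_def powr_powr)
      moreover have "g t powr \<gamma> \<le> real k powr \<gamma>" using k g0 \<gamma> by (intro powr_mono2) auto
      ultimately have "c * (ln (real t) / c) \<le> c * real k powr \<gamma>"
        using c by (intro mult_left_mono) auto
      then have "exp (ln (real t)) \<le> exp (c * real k powr \<gamma>)" using c by simp
      then have "real t \<le> exp (c * real k powr \<gamma>)" using elim by simp
      moreover have "k0 \<le> k" using elim k by linarith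
      ultimately have "X t < Suc k" by (intro k0)
      then have "real (X t) \<le> g t + 1" using k by linarith
      then show ?case using ln by (intro divide_right_mono) auto
    qed
    have "scaled_limsup \<gamma> X \<le>
        limsup (\<lambda>t. ereal ((g t + 1) / ln (real t) powr (1 / \<gamma>)))"
      using bound by (intro Limsup_mono) (auto elim: eventually_mono)
    also have "(\<lambda>t. ereal ((g t + 1) / ln (real t) powr (1 / \<gamma>))) \<longlonglongrightarrow> ereal ((1 / c) powr (1 / \<gamma>))"
    proof (rule tendsto_ereal)
      show "(\<lambda>t. (g t + 1) / ln (real t) powr (1 / \<gamma>)) \<longlonglongrightarrow> (1 / c) powr (1 / \<gamma>)"
        unfolding g_def inverse_eq_divide[symmetric] using c \<gamma> by real_asymp
    qed
    then have "limsup (\<lambda>t. ereal ((g t + 1) / ln (real t) powr (1 / \<gamma>))) = ereal ((1 / c) powr (1 / \<gamma>))"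
      by (intro lim_imp_Limsup) auto
    finally show "scaled_limsup \<gamma> X \<le> ereal ((1 / c) powr (1 / \<gamma>))" .
  qed
qed

lemma INFM_le_limsup:
  fixes f :: "nat \<Rightarrow> ereal"
  assumes "\<exists>\<^sub>\<infinity>n. c \<le> f n"
  shows "c \<le> limsup f"
proof (rule ccontr)
  assume "\<not> c \<le> limsup f"
  then have "\<forall>\<^sub>F n in sequentially. f n < c" by (intro Limsup_lessD) (simp add: not_le)
  then have "\<forall>\<^sub>F n in sequentially. \<not> c \<le> f n" by eventually_elim (simp add: not_le)
  with assms show False unfolding cofinite_eq_sequentially frequently_def by blast
qed

text \<open>Since the potential is eventually positive, its largest rise before k is its maximum up
  to a constant, hence at most d * k powr \<gamma> plus a constant for any d > L.\<close>

lemma walk_limsup_ge: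
  assumes \<omega>: "\<And>k. 0 < \<omega> k \<and> \<omega> k < 1" and \<gamma>: "0 < \<gamma>"
    and lim: "(\<lambda>n. potential \<omega> n / real n powr \<gamma>) \<longlonglongrightarrow> L"
    and c: "0 < L" "L < c"
  shows "AE X in quenched_law \<omega>.
    ereal ((1 / c) powr (1 / \<gamma>)) \<le> scaled_limsup \<gamma> X"
proof -
  define d where "d = (c + L) / 2"
  have d: "L < d" "d < c" "0 < d" using c by (simp_all add: d_def)
  have "\<forall>\<^sub>F n in sequentially. 0 \<le> potential \<omega> n \<and> potential \<omega> n \<le> d * real n powr \<gamma>"
    using tendsto_upper_bound_ratio[OF lim d(1)] tendsto_lower_bound_ratio[OF lim c(1)]
    by eventually_elim simp
  then obtain N where N: "\<And>n. N \<le> n \<Longrightarrow> 0 \<le> potential \<omega> n \<and> potential \<omega> n \<le> d * real n powr \<gamma>"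
    by (auto simp: eventually_sequentially)
  \<comment> \<open>Controls the finitely many sites before the asymptotics set in. It bounds the
    potential from below and corrects its upper bound, so a rise exceeds d * k powr \<gamma> by at
    most 2 * B.\<close>
  define B where "B = (\<Sum>j<N. \<bar>potential \<omega> j\<bar>)"
  have B0: "0 \<le> B" by (simp add: B_def sum_nonneg)
  have B: "- B \<le> potential \<omega> j" "potential \<omega> j \<le> d * real j powr \<gamma> + B" for j
  proof -
    have "\<bar>potential \<omega> j\<bar> \<le> B" if "j < N" unfolding B_def using that by (intro member_le_sum) auto
    moreover have "0 \<le> d * real j powr \<gamma>" using d by simp
    ultimately show "- B \<le> potential \<omega> j" "potential \<omega> j \<le> d * real j powr \<gamma> + B"
      using N[of j] B0 by (cases "j < N"; force)+
  qed
  define q where "q = 1 / (1 - \<omega> 0)"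
  have "summable (\<lambda>k. real k * (q + 2 * real k) * exp ((d * real k powr \<gamma> + 2 * B) - c * real k powr \<gamma>))"
  proof (rule summable_bigo_inverse_square)
    have "(\<lambda>k. real k * (q + 2 * real k) * exp (2 * B - (c - d) * real k powr \<gamma>)) \<in> O(\<lambda>k. real k powr - 2)"
      using d \<gamma> by real_asymp
    then show "(\<lambda>k. real k * (q + 2 * real k) * exp ((d * real k powr \<gamma> + 2 * B) - c * real k powr \<gamma>)) \<in> O(\<lambda>k. real k powr - 2)"
      by (simp add: algebra_simps)
  qed
  then have "AE X in quenched_law \<omega>. \<forall>\<^sub>F k in sequentially.
      (\<forall>i j. i \<le> j \<longrightarrow> j < k \<longrightarrow> potential \<omega> j - potential \<omega> i \<le> d * real k powr \<gamma> + 2 * B) \<longrightarrow>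
      (\<exists>s. real s \<le> exp (c * real k powr \<gamma>) \<and> k \<le> X s)"
    using c unfolding q_def by (intro AE_eventually_above[OF \<omega>]) auto
  then show ?thesis
  proof (rule AE_mp, intro AE_I2 impI)
    fix X assume *: "\<forall>\<^sub>F k in sequentially.
      (\<forall>i j. i \<le> j \<longrightarrow> j < k \<longrightarrow> potential \<omega> j - potential \<omega> i \<le> d * real k powr \<gamma> + 2 * B) \<longrightarrow>
      (\<exists>s. real s \<le> exp (c * real k powr \<gamma>) \<and> k \<le> X s)"
    have rise: "potential \<omega> j - potential \<omega> i \<le> d * real k powr \<gamma> + 2 * B" if "j < k" for i j k
    proof -
      have "d * real j powr \<gamma> \<le> d * real k powr \<gamma>"
        using that d \<gamma> by (intro mult_left_mono powr_mono2) auto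
      then show ?thesis using B(1)[of i] B(2)[of j] by linarith
    qed
    from * have "\<forall>\<^sub>F k in sequentially. \<exists>s. real s \<le> exp (c * real k powr \<gamma>) \<and> k \<le> X s"
      by eventually_elim (use rise in blast)
    then have "\<exists>\<^sub>F k in sequentially. \<exists>s. real s \<le> exp (c * real k powr \<gamma>) \<and> k \<le> X s"
      by (intro eventually_frequently) auto
    then have "\<exists>\<^sub>\<infinity>s. ereal ((1 / c) powr (1 / \<gamma>)) \<le> ereal (real (X s) / ln (real s) powr (1 / \<gamma>))"
    \<comment> \<open>Times below 2 are excluded so that \<open>ln (real s)\<close> is
      positive.\<close>
    proof (rule INFM_reached[OF filterlim_ident, where ?k0.0 = 0 and ?s0.0 = 2])
      fix k s :: nat assume s: "2 \<le> s" "real s \<le> exp (c * real k powr \<gamma>)" "k \<le> X s"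
      have ln: "0 < ln (real s)" using s by simp
      have "ln (real s) \<le> ln (exp (c * real k powr \<gamma>))"
        using s by (subst ln_le_cancel_iff) auto
      then have "ln (real s) \<le> c * real k powr \<gamma>" by simp
      then have "ln (real s) / c \<le> real k powr \<gamma>" using c by (simp add: field_simps)
      then have "(ln (real s) / c) powr (1 / \<gamma>) \<le> (real k powr \<gamma>) powr (1 / \<gamma>)"
        using ln c \<gamma> by (intro powr_mono2) auto
      also have "\<dots> \<le> real (X s)" using \<gamma> s by (simp add: powr_powr)
      finally have "(1 / c) powr (1 / \<gamma>) * ln (real s) powr (1 / \<gamma>) \<le> real (X s)"
        using ln c by (simp add: powr_divide)
      then show "ereal ((1 / c) powr (1 / \<gamma>)) \<le> ereal (real (X s) / ln (real s) powr (1 / \<gamma>))"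
        using ln by (simp add: pos_le_divide_eq)
    qed
    then show "ereal ((1 / c) powr (1 / \<gamma>)) \<le> scaled_limsup \<gamma> X"
      by (rule INFM_le_limsup)
  qed
qed

text \<open>Countably many constants \<open>a m\<close> below and \<open>b m\<close> above L give a
  single null set, outside which both one-sided bounds pass to the limit. The offset 2 keeps
  \<open>a m\<close> positive for every m.\<close>

lemma walk_limsup:
  assumes \<omega>: "\<And>k. 0 < \<omega> k \<and> \<omega> k < 1" and \<gamma>: "0 < \<gamma>"
    and lim: "(\<lambda>n. potential \<omega> n / real n powr \<gamma>) \<longlonglongrightarrow> L" and L: "0 < L"
  shows "AE X in quenched_law \<omega>.
    scaled_limsup \<gamma> X = ereal ((1 / L) powr (1 / \<gamma>))"
proof -
  define a where "a m = L * (1 - 1 / (real m + 2))" for m :: nat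
  define b where "b m = L * (1 + 1 / (real m + 2))" for m :: nat
  have a: "0 < a m" "a m < L" and b: "L < b m" for m
  proof -
    have e: "0 < 1 / (real m + 2)" "1 / (real m + 2) < 1" by simp_all
    show "0 < a m" using L e by (simp add: a_def)
    have "0 < L * (1 / (real m + 2))" using L e by (intro mult_pos_pos)
    then show "a m < L" "L < b m" by (simp_all add: a_def b_def distrib_left right_diff_distrib)
  qed
  have "AE X in quenched_law \<omega>. \<forall>m.
      scaled_limsup \<gamma> X \<le> ereal ((1 / a m) powr (1 / \<gamma>))"
    unfolding AE_all_countable by (intro allI walk_limsup_le[OF \<omega> \<gamma> lim] a)
  moreover have "AE X in quenched_law \<omega>. \<forall>m.
      ereal ((1 / b m) powr (1 / \<gamma>)) \<le> scaled_limsup \<gamma> X"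
    unfolding AE_all_countable by (intro allI walk_limsup_ge[OF \<omega> \<gamma> lim] b L)
  ultimately show ?thesis
  proof eventually_elim
    case (elim X)
    have la: "(\<lambda>m. (1 / a m) powr (1 / \<gamma>)) \<longlonglongrightarrow> (1 / L) powr (1 / \<gamma>)"
      unfolding a_def inverse_eq_divide[symmetric] using L \<gamma> by real_asymp
    have lb: "(\<lambda>m. (1 / b m) powr (1 / \<gamma>)) \<longlonglongrightarrow> (1 / L) powr (1 / \<gamma>)"
      unfolding b_def inverse_eq_divide[symmetric] using L \<gamma> by real_asymp
    show ?case
    proof (rule antisym)
      show "scaled_limsup \<gamma> X \<le> ereal ((1 / L) powr (1 / \<gamma>))"
        by (rule LIMSEQ_le_const[OF tendsto_ereal[OF la]]) (use elim(1) in blast)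
      show "ereal ((1 / L) powr (1 / \<gamma>)) \<le> scaled_limsup \<gamma> X"
        by (rule LIMSEQ_le_const2[OF tendsto_ereal[OF lb]]) (use elim(2) in blast)
    qed
  qed
qed

text \<open>If X t lies in (2 ^ k, 2 ^ (k + 1)], then t exceeds exp (x k / 2), because the walk
  stays within 2 ^ k up to that time. As F is monotone, it remains to compare 2 ^ (k + 1) with F (x
  k / 2).\<close>

lemma walk_upper:
  assumes \<omega>: "\<And>k. 0 < \<omega> k \<and> \<omega> k < 1" and \<alpha>: "0 < \<alpha>" and \<eta>: "0 < \<eta>" "\<eta> < \<epsilon>"
    and ev: "\<forall>\<^sub>F k in sequentially. \<exists>j\<le>2 ^ k. climb \<alpha> \<eta> k \<le> potential \<omega> j"
  shows "AE X in quenched_law \<omega>.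
    \<forall>\<^sub>\<infinity>t. real (X t) \<le> ln (real t) powr \<alpha> * ln (ln (real t)) powr (2 + \<epsilon>)"
proof -
  define x where "x k = climb \<alpha> \<eta> k" for k :: nat
  define F where "F u = u powr \<alpha> * ln u powr (2 + \<epsilon>)" for u :: real
  have "summable (\<lambda>k. exp (x k / 2 - x k))"
  proof (rule summable_bigo_inverse_square)
    show "(\<lambda>k. exp (x k / 2 - x k)) \<in> O(\<lambda>k. real k powr - 2)"
      unfolding x_def using \<alpha> \<eta> by real_asymp
  qed
  \<comment> \<open>The maximum includes the site 2 ^ k, whereas \<open>AE_eventually_below\<close>
    asks for sites strictly below the level; hence the level 2 ^ k + 1.\<close>
  moreover have "\<forall>\<^sub>F k in sequentially. \<exists>j<2 ^ k + 1. x k \<le> potential \<omega> j"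
    using ev by eventually_elim (auto simp: x_def less_Suc_eq_le)
  ultimately have "AE X in quenched_law \<omega>. \<forall>\<^sub>F k in sequentially.
      \<forall>s. real s \<le> exp (x k / 2) \<longrightarrow> X s < 2 ^ k + 1"
    by (intro AE_eventually_below[OF \<omega>])
  then show ?thesis
  proof (rule AE_mp, intro AE_I2 impI)
    fix X assume X: "\<forall>\<^sub>F k in sequentially. \<forall>s. real s \<le> exp (x k / 2) \<longrightarrow> X s < (2::nat) ^ k + 1"
    \<comment> \<open>This puts the arguments into the range where the logarithm is nonnegative and
      F is monotone.\<close>
    have "\<forall>\<^sub>F k in sequentially. exp 1 \<le> x k / 2"
      using \<alpha> \<eta> unfolding x_def by real_asymp
    \<comment> \<open>(x k) powr \<alpha> is 2 ^ k / k powr (2 + \<eta>) and ln (x k) is of order k,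
      so F (x k / 2) is of order 2 ^ k * k powr (\<epsilon> - \<eta>): the spare power absorbs all
      constants.\<close>
    moreover have "\<forall>\<^sub>F k in sequentially. 2 ^ Suc k \<le> F (x k / 2)"
      using \<alpha> \<eta> unfolding x_def F_def by real_asymp
    ultimately have "\<forall>\<^sub>F k in sequentially. (\<forall>s. real s \<le> exp (x k / 2) \<longrightarrow> X s < (2::nat) ^ k + 1) \<and>
        exp 1 \<le> x k / 2 \<and> 2 ^ Suc k \<le> F (x k / 2)"
      using X by eventually_elim simp
    then obtain k0 where k0: "\<And>k s. k0 \<le> k \<Longrightarrow> real s \<le> exp (x k / 2) \<Longrightarrow> X s < (2::nat) ^ k + 1"
      "\<And>k. k0 \<le> k \<Longrightarrow> exp 1 \<le> x k / 2" "\<And>k. k0 \<le> k \<Longrightarrow> 2 ^ Suc k \<le> F (x k / 2)"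
      by (auto simp: eventually_sequentially)
    have "\<forall>\<^sub>F t in sequentially. 2 ^ k0 \<le> F (ln (real t))"
      unfolding F_def using \<alpha> \<eta> by real_asymp
    then have "\<forall>\<^sub>F t in sequentially. real (X t) \<le> F (ln (real t))"
      using eventually_gt_at_top[of 1]
    proof eventually_elim
      case (elim t)
      show ?case
      proof (cases "X t \<le> 2 ^ k0")
        case True
        then have "real (X t) \<le> 2 ^ k0" by (metis of_nat_le_iff of_nat_numeral of_nat_power)
        then show ?thesis using elim by linarith
      next
        case False
        have ex: "\<exists>k. X t \<le> 2 ^ k" using less_exp[of "X t"] by (intro exI[of _ "X t"]) simp
        define l where "l = (LEAST k. X t \<le> 2 ^ k)"
        have l: "X t \<le> 2 ^ l" unfolding l_def by (rule LeastI_ex[OF ex])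
        have "k0 < l"
        proof (rule ccontr)
          assume "\<not> k0 < l"
          then have "(2::nat) ^ l \<le> 2 ^ k0" by (intro power_increasing) auto
          then show False using l False by linarith
        qed
        then obtain k where k: "l = Suc k" "k0 \<le> k" by (cases l) auto
        have "\<not> X t \<le> 2 ^ k" using k by (intro not_less_Least) (simp add: l_def)
        then have "\<not> real t \<le> exp (x k / 2)" using k0(1)[OF k(2), of t] by auto
        then have "exp (x k / 2) < exp (ln (real t))" using elim by simp
        then have "x k / 2 < ln (real t)" by simp
        moreover have e: "exp 1 \<le> x k / 2" by (rule k0(2)[OF k(2)])
        ultimately have "F (x k / 2) \<le> F (ln (real t))"
        proof -
          assume lt: "x k / 2 < ln (real t)"
          have p: "0 < x k / 2" using e exp_gt_zero[of "1::real"] by linarith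
          have "1 \<le> x k / 2" using e exp_ge_add_one_self[of "1::real"] by linarith
          then show ?thesis
            unfolding F_def using lt p \<alpha> \<eta> by (intro mult_mono powr_mono2) auto
        qed
        moreover have "real (X t) \<le> 2 ^ Suc k" using l k by (metis of_nat_le_iff of_nat_numeral of_nat_power)
        ultimately show ?thesis using k0(3)[OF k(2)] by linarith
      qed
    qed
    then show "\<forall>\<^sub>\<infinity>t. real (X t) \<le> ln (real t) powr \<alpha> * ln (ln (real t)) powr (2 + \<epsilon>)"
      by (simp add: cofinite_eq_sequentially F_def)
  qed
qed

text \<open>Confinement to [-K x, K x] bounds every rise by 2 K x. Time exp (3 K x) exceeds exp (2 K
  x) by exp (K x), which beats the polynomial factor in the level 2 ^ (j ^ 2).\<close>

lemma walk_lower: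
  assumes \<omega>: "\<And>k. 0 < \<omega> k \<and> \<omega> k < 1" and \<alpha>: "0 < \<alpha>" and K: "0 < K"
    and inf: "\<exists>\<^sub>\<infinity>j. \<forall>i\<le>2 ^ (j\<^sup>2). \<bar>potential \<omega> i\<bar> \<le> K * confinement \<alpha> j"
  shows "AE X in quenched_law \<omega>. \<exists>\<^sub>\<infinity>t.
    real (X t) \<ge> 1 / (3 * (3 * K) powr \<alpha>) * ln (real t) powr \<alpha> * ln (ln (ln (real t)))"
proof -
  define x where "x j = confinement \<alpha> j" for j :: nat
  define q where "q = 1 / (1 - \<omega> 0)"
  \<comment> \<open>With u = 3 K x j the power in F u becomes 2 ^ (j ^ 2) / (3 ln j), and ln (ln u)
    is asymptotic to 2 ln j. So F u is about 2/3 of the level 2 ^ (j ^ 2); the 3 in the constant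
    puts the ratio below 1.\<close>
  define c where "c = 1 / (3 * (3 * K) powr \<alpha>)"
  have c: "0 < c" using K by (simp add: c_def)
  define F where "F u = c * u powr \<alpha> * ln (ln u)" for u :: real
  have "summable (\<lambda>j. real (2 ^ (j\<^sup>2)) * (q + 2 * real (2 ^ (j\<^sup>2))) * exp (2 * K * x j - 3 * K * x j))"
  proof (rule summable_bigo_inverse_square)
    have "(\<lambda>j. 2 ^ (j\<^sup>2) * (q + 2 * 2 ^ (j\<^sup>2)) * exp (2 * K * x j - 3 * K * x j)) \<in> O(\<lambda>k. real k powr - 2)"
      unfolding x_def using \<alpha> K by real_asymp
    then show "(\<lambda>j. real (2 ^ (j\<^sup>2)) * (q + 2 * real (2 ^ (j\<^sup>2))) * exp (2 * K * x j - 3 * K * x j)) \<in> O(\<lambda>k. real k powr - 2)"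
      by simp
  qed
  then have "AE X in quenched_law \<omega>. \<forall>\<^sub>F j in sequentially.
      (\<forall>i l. i \<le> l \<longrightarrow> l < 2 ^ (j\<^sup>2) \<longrightarrow> potential \<omega> l - potential \<omega> i \<le> 2 * K * x j) \<longrightarrow>
      (\<exists>s. real s \<le> exp (3 * K * x j) \<and> 2 ^ (j\<^sup>2) \<le> X s)"
    using K unfolding q_def by (intro AE_eventually_above[OF \<omega>]) (auto simp: x_def)
  then show ?thesis
  proof (rule AE_mp, intro AE_I2 impI)
    fix X assume X: "\<forall>\<^sub>F j in sequentially.
      (\<forall>i l. i \<le> l \<longrightarrow> l < 2 ^ (j\<^sup>2) \<longrightarrow> potential \<omega> l - potential \<omega> i \<le> 2 * K * x j) \<longrightarrow>
      (\<exists>s. real s \<le> exp (3 * K * x j) \<and> (2::nat) ^ (j\<^sup>2) \<le> X s)"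
    have F: "\<exists>\<^sub>F j in sequentially. \<exists>s. real s \<le> exp (3 * K * x j) \<and> 2 ^ (j\<^sup>2) \<le> X s"
      using frequently_eventually_conj[OF inf[unfolded cofinite_eq_sequentially] X]
    proof (rule frequently_elim1)
      fix j
      assume *: "((\<forall>i l. i \<le> l \<longrightarrow> l < 2 ^ (j\<^sup>2) \<longrightarrow> potential \<omega> l - potential \<omega> i \<le> 2 * K * x j) \<longrightarrow>
        (\<exists>s. real s \<le> exp (3 * K * x j) \<and> (2::nat) ^ (j\<^sup>2) \<le> X s)) \<and>
        (\<forall>i\<le>2 ^ (j\<^sup>2). \<bar>potential \<omega> i\<bar> \<le> K * confinement \<alpha> j)"
      have "potential \<omega> l - potential \<omega> i \<le> 2 * K * x j" if "i \<le> l" "l < 2 ^ (j\<^sup>2)" for i l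
      proof -
        have "\<bar>potential \<omega> i\<bar> \<le> K * x j" "\<bar>potential \<omega> l\<bar> \<le> K * x j"
          using * that by (auto simp: x_def)
        then show ?thesis by linarith
      qed
      then show "\<exists>s. real s \<le> exp (3 * K * x j) \<and> 2 ^ (j\<^sup>2) \<le> X s" using * by blast
    qed
    have "\<forall>\<^sub>F j in sequentially. F (3 * K * x j) \<le> 2 ^ (j\<^sup>2)"
      unfolding F_def c_def x_def using \<alpha> K by real_asymp
    then obtain j0 where j0: "\<And>j. j0 \<le> j \<Longrightarrow> F (3 * K * x j) \<le> 2 ^ (j\<^sup>2)"
      by (auto simp: eventually_sequentially)
    have "filterlim (\<lambda>j::nat. (2::nat) ^ (j\<^sup>2)) at_top sequentially"
    proof (rule filterlim_at_top_mono[OF filterlim_ident], rule always_eventually, rule allI)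
      fix j :: nat
      have "j \<le> j\<^sup>2" by (simp add: power2_eq_square)
      also have "\<dots> \<le> 2 ^ (j\<^sup>2)" using less_exp[of "j\<^sup>2"] by simp
      finally show "j \<le> 2 ^ (j\<^sup>2)" .
    qed
    from this F have "\<exists>\<^sub>\<infinity>t. F (ln (real t)) \<le> real (X t)"
    \<comment> \<open>From exp (exp 1) on, the triple logarithm is nonnegative, as monotonicity of
      the product F requires.\<close>
    proof (rule INFM_reached[where ?k0.0 = j0 and ?s0.0 = "nat \<lceil>exp (exp (1::real))\<rceil>"])
      fix j s :: nat
      assume j: "j0 \<le> j" and s: "nat \<lceil>exp (exp (1::real))\<rceil> \<le> s" "real s \<le> exp (3 * K * x j)" "2 ^ (j\<^sup>2) \<le> X s"
      have "exp (exp 1) \<le> real s" using s(1) by linarith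
      moreover have spos: "0 < real s" using calculation exp_gt_zero[of "exp (1::real)"] by linarith
      ultimately have l1: "exp 1 \<le> ln (real s)" by (simp add: ln_ge_iff)
      then have lpos: "0 < ln (real s)" using exp_gt_zero[of "1::real"] by linarith
      have l2: "1 \<le> ln (ln (real s))" using l1 lpos by (simp add: ln_ge_iff)
      have "ln (real s) \<le> ln (exp (3 * K * x j))" using s(2) spos by (subst ln_le_cancel_iff) auto
      then have le: "ln (real s) \<le> 3 * K * x j" by simp
      have le2: "ln (ln (real s)) \<le> ln (3 * K * x j)"
        using le lpos by (intro ln_mono) auto
      have "F (ln (real s)) \<le> F (3 * K * x j)"
        unfolding F_def
      proof (rule mult_mono)
        show "c * ln (real s) powr \<alpha> \<le> c * (3 * K * x j) powr \<alpha>"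
          using c le lpos \<alpha> by (intro mult_left_mono powr_mono2) auto
        show "ln (ln (ln (real s))) \<le> ln (ln (3 * K * x j))"
          using le2 l2 by (subst ln_le_cancel_iff) linarith+
      qed (use c l2 in auto)
      also have "\<dots> \<le> 2 ^ (j\<^sup>2)" by (rule j0[OF j])
      also have "\<dots> \<le> real (X s)" using s(3) by (metis of_nat_le_iff of_nat_numeral of_nat_power)
      finally show "F (ln (real s)) \<le> real (X s)" .
    qed
    then show "\<exists>\<^sub>\<infinity>t. real (X t) \<ge> 1 / (3 * (3 * K) powr \<alpha>) * ln (real t) powr \<alpha> * ln (ln (ln (real t)))"
      by (simp add: F_def c_def)
  qed
qed

section \<open>Persistence of symmetric random walks\<close>

definition psum :: "(nat \<Rightarrow> real) \<Rightarrow> nat \<Rightarrow> real" where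
  "psum f n = (\<Sum>i<n. f i)"

lemma psum_0 [simp]: "psum f 0 = 0"
  by (simp add: psum_def)

lemma psum_Suc [simp]: "psum f (Suc n) = psum f n + f n"
  by (simp add: psum_def)

lemma psum_add: "psum f (m + n) = psum f m + psum (\<lambda>i. f (m + i)) n"
  by (induction n) simp_all

lemma psum_uminus: "psum (\<lambda>i. - f i) n = - psum f n"
  by (simp add: psum_def sum_negf)

lemma psum_cong: "(\<And>i. i < n \<Longrightarrow> f i = g i) \<Longrightarrow> psum f n = psum g n"
  by (simp add: psum_def)

text \<open>Time reversal: the walk whose first k steps are read backwards has, between times j and
  k, the increment of the original walk up to time k - j.\<close>

lemma psum_reverse:
  assumes "j \<le> k"
  shows "psum (\<lambda>i. f (k - Suc i)) k - psum (\<lambda>i. f (k - Suc i)) j = psum f (k - j)"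
  using assms
proof (induction rule: inc_induct)
  case (step j)
  have "psum f (k - j) = psum f (k - Suc j) + f (k - Suc j)"
    using step.hyps Suc_diff_Suc[of j k] psum_Suc[of f "k - Suc j"] by simp
  then show ?case using step.IH by simp
qed simp

text \<open>Steps are coordinates on the infinite product of \<open>\<mu>\<close>. Shifting,
  reordering and flipping the signs of the steps then preserve the measure \<open>S\<close>, and the
  fluctuation identities below rest on these maps.\<close>

locale symmetric_iid = sequence_space \<mu> for \<mu> :: "real measure" +
  assumes sets_mu: "sets \<mu> = sets borel"
    and symmetric_mu: "distr \<mu> borel uminus = \<mu>"
begin

lemma space_mu [simp]: "space \<mu> = UNIV"
  using sets_eq_imp_space_eq[OF sets_mu] by simp

lemma measurable_to_mu: "measurable N \<mu> = measurable N borel"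
  by (rule measurable_cong_sets[OF refl sets_mu])

lemma measurable_coord [measurable]: "(\<lambda>f. f i) \<in> borel_measurable S"
  using measurable_component_singleton[of i UNIV "\<lambda>_. \<mu>"] by (simp add: measurable_to_mu)

lemma space_S [simp]: "space S = UNIV"
  by (simp add: space_PiM)

lemma sets_Collect_S: "Measurable.pred S P \<Longrightarrow> {f. P f} \<in> sets S"
  by (simp add: pred_def)

lemma measurable_psum [measurable]: "(\<lambda>f. psum f n) \<in> borel_measurable S"
  unfolding psum_def by measurable

lemma measurable_shift: "(\<lambda>f i. f (m + i)) \<in> measurable S S"
  by (rule measurable_PiM_single') (simp_all add: measurable_to_mu)

text \<open>\<open>comb_seq m\<close> glues the first m coordinates of one sequence to another
  sequence and maps the product of \<open>S\<close> with itself to \<open>S\<close>; the event pulls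
  back to a rectangle. This is the Markov property at a fixed time.\<close>

lemma prob_split:
  assumes [measurable]: "Measurable.pred S P" "Measurable.pred S Q"
    and dep: "\<And>f g. (\<And>i. i < m \<Longrightarrow> f i = g i) \<Longrightarrow> P f = P g"
  shows "measure S {f. P f \<and> Q (\<lambda>i. f (m + i))} = measure S {f. P f} * measure S {f. Q f}"
proof -
  have [measurable]: "{f. P f} \<in> sets S" "{f. Q f} \<in> sets S"
    by (simp_all add: sets_Collect_S)
  have [measurable]: "Measurable.pred S (\<lambda>f. Q (\<lambda>i. f (m + i)))"
    by (rule measurable_compose[OF measurable_shift]) simp
  have E [measurable]: "{f. P f \<and> Q (\<lambda>i. f (m + i))} \<in> sets S"
    by (rule sets_Collect_S) measurable
  have "P (comb_seq m f g) = P f" for f g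
    by (rule dep) (simp add: comb_seq_less)
  moreover have "Q (\<lambda>i. comb_seq m f g (m + i)) = Q g" for f g
    using comb_seq_add[of m f g] by (simp add: add.commute)
  ultimately have "(\<lambda>(f, g). comb_seq m f g) -` {f. P f \<and> Q (\<lambda>i. f (m + i))} \<inter> space (S \<Otimes>\<^sub>M S) =
      {f. P f} \<times> {f. Q f}"
    by (auto simp: space_pair_measure)
  moreover have "emeasure S {f. P f \<and> Q (\<lambda>i. f (m + i))} =
      emeasure (distr (S \<Otimes>\<^sub>M S) S (\<lambda>(f, g). comb_seq m f g)) {f. P f \<and> Q (\<lambda>i. f (m + i))}"
    by (simp only: PiM_comb_seq)
  ultimately have "emeasure S {f. P f \<and> Q (\<lambda>i. f (m + i))} = emeasure (S \<Otimes>\<^sub>M S) ({f. P f} \<times> {f. Q f})"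
    by (simp add: emeasure_distr[OF measurable_comb_seq E])
  also have "\<dots> = emeasure S {f. P f} * emeasure S {f. Q f}"
    by (intro P.emeasure_pair_measure_Times) measurable
  finally show ?thesis
    by (simp add: measure_def enn2real_mult)
qed

lemma prob_reindex:
  assumes [measurable]: "Measurable.pred S P" and \<pi>: "inj \<pi>"
  shows "measure S {f. P (\<lambda>i. f (\<pi> i))} = measure S {f. P f}"
proof -
  have eq: "S = distr S S (\<lambda>f i. f (\<pi> i))"
    using distr_PiM_reindex[of UNIV "\<lambda>_. \<mu>" \<pi> UNIV] \<pi> M.prob_space_axioms by (simp add: restrict_UNIV)
  have "(\<lambda>f i. f (\<pi> i)) \<in> measurable S S"
    by (rule measurable_PiM_single') (simp_all add: measurable_to_mu)
  moreover have "{f. P f} \<in> sets S" by (simp add: sets_Collect_S)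
  ultimately have "measure (distr S S (\<lambda>f i. f (\<pi> i))) {f. P f} = measure S {f. P (\<lambda>i. f (\<pi> i))}"
    by (subst measure_distr) (auto simp: vimage_def)
  then show ?thesis using eq by simp
qed

lemma emeasure_uminus:
  assumes "A \<in> sets borel" shows "emeasure \<mu> (uminus -` A) = emeasure \<mu> A"
proof -
  have "emeasure \<mu> A = emeasure (distr \<mu> borel uminus) A" by (simp only: symmetric_mu)
  also have "\<dots> = emeasure \<mu> (uminus -` A)" using assms by (subst emeasure_distr) (simp_all add: measurable_cong_sets[OF sets_mu refl])
  finally show ?thesis by simp
qed

lemma distr_uminus: "distr S S (\<lambda>f i. - f i) = S"
proof (rule PiM_eq)
  have m: "(\<lambda>f i. - f i) \<in> measurable S S"
    by (rule measurable_PiM_single') (simp_all add: measurable_to_mu)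
  fix J E assume J: "finite J" "J \<subseteq> (UNIV :: nat set)" and E: "\<And>j. j \<in> J \<Longrightarrow> E j \<in> sets \<mu>"
  then have E': "E j \<in> sets borel" "uminus -` E j \<in> sets \<mu>" if "j \<in> J" for j
    using that measurable_sets[of uminus borel borel "E j"] by (simp_all add: sets_mu)
  have "(\<lambda>f i. - f i) -` prod_emb UNIV (\<lambda>_. \<mu>) J (Pi\<^sub>E J E) =
      prod_emb UNIV (\<lambda>_. \<mu>) J (Pi\<^sub>E J (\<lambda>j. uminus -` E j))"
    by (auto simp: prod_emb_def PiE_iff)
  then have "emeasure (distr S S (\<lambda>f i. - f i)) (prod_emb UNIV (\<lambda>_. \<mu>) J (Pi\<^sub>E J E)) =
      emeasure S (prod_emb UNIV (\<lambda>_. \<mu>) J (Pi\<^sub>E J (\<lambda>j. uminus -` E j)))"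
    using J E by (subst emeasure_distr[OF m]) (simp_all add: sets_PiM_I)
  also have "\<dots> = (\<Prod>j\<in>J. emeasure \<mu> (uminus -` E j))"
    using J E' M.prob_space_axioms by (intro emeasure_PiM_emb) simp_all
  also have "\<dots> = (\<Prod>j\<in>J. emeasure \<mu> (E j))"
    by (intro prod.cong refl emeasure_uminus E')
  finally show "emeasure (distr S S (\<lambda>f i. - f i)) (prod_emb UNIV (\<lambda>_. \<mu>) J (Pi\<^sub>E J E)) =
      (\<Prod>j\<in>J. emeasure \<mu> (E j))" .
qed simp

lemma prob_uminus:
  assumes [measurable]: "Measurable.pred S P"
  shows "measure S {f. P (\<lambda>i. - f i)} = measure S {f. P f}"
proof -
  have m: "(\<lambda>f i. - f i) \<in> measurable S S"
    by (rule measurable_PiM_single') (simp_all add: measurable_to_mu)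
  have "{f. P f} \<in> sets S" by (simp add: sets_Collect_S)
  then have "measure (distr S S (\<lambda>f i. - f i)) {f. P f} = measure S {f. P (\<lambda>i. - f i)}"
    by (subst measure_distr[OF m]) (auto simp: vimage_def)
  then show ?thesis by (simp add: distr_uminus)
qed

lemma prob_coord:
  assumes "A \<in> sets borel" shows "measure S {f. f i \<in> A} = measure \<mu> A"
  using emeasure_PiM_Collect_single[of i A] assms by (simp add: measure_def sets_mu)

lemma prob_all_coords:
  assumes [measurable]: "A \<in> sets borel"
  shows "measure S {f. \<forall>i<n. f i \<in> A} = measure \<mu> A ^ n"
proof (induction n)
  case 0
  then show ?case using P.prob_space by simp
next
  case (Suc n)
  have "{f. \<forall>i<Suc n. f i \<in> A} = {f. (\<forall>i<n. f i \<in> A) \<and> (\<lambda>g. g 0 \<in> A) (\<lambda>i. f (n + i))}"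
    by (auto simp: less_Suc_eq)
  also have "measure S \<dots> = measure S {f. \<forall>i<n. f i \<in> A} * measure S {f. f 0 \<in> A}"
    by (intro prob_split) auto
  finally show ?case by (simp add: Suc.IH prob_coord)
qed

text \<open>The constraint \<open>A\<close> on the steps carries the argument past plain persistence
  (\<open>A = UNIV\<close>): with \<open>A = {-x..x}\<close> it expresses that no big jump has
  occurred yet. The values are probabilities of joint events and are not conditioned on the
  constraint.\<close>

definition weak :: "real set \<Rightarrow> nat \<Rightarrow> real" where
  "weak A n = measure S {f. (\<forall>i<n. f i \<in> A) \<and> (\<forall>j\<le>n. psum f j \<le> 0)}"

definition strict :: "real set \<Rightarrow> nat \<Rightarrow> real" where
  "strict A n = measure S {f. (\<forall>i<n. f i \<in> A) \<and> (\<forall>j\<in>{1..n}. psum f j < 0)}"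

lemma weak_nonneg: "0 \<le> weak A n" and strict_nonneg: "0 \<le> strict A n"
  by (simp_all add: weak_def strict_def)

lemma strict_le_weak:
  assumes [measurable]: "A \<in> sets borel" shows "strict A n \<le> weak A n"
  unfolding strict_def weak_def
proof (rule P.finite_measure_mono)
  show "{f. (\<forall>i<n. f i \<in> A) \<and> (\<forall>j\<in>{1..n}. psum f j < 0)} \<subseteq>
      {f. (\<forall>i<n. f i \<in> A) \<and> (\<forall>j\<le>n. psum f j \<le> 0)}"
  proof safe
    fix f j assume *: "\<forall>j\<in>{1..n}. psum f j < 0" "j \<le> n"
    then show "psum f j \<le> 0" by (cases "j = 0") (simp_all add: order_less_imp_le)
  qed
  show "{f. (\<forall>i<n. f i \<in> A) \<and> (\<forall>j\<le>n. psum f j \<le> 0)} \<in> sets S"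
    by (rule sets_Collect_S) measurable
qed

lemma strict_antimono:
  assumes [measurable]: "A \<in> sets borel" and "m \<le> n" shows "strict A n \<le> strict A m"
  unfolding strict_def
proof (rule P.finite_measure_mono)
  show "{f. (\<forall>i<m. f i \<in> A) \<and> (\<forall>j\<in>{1..m}. psum f j < 0)} \<in> sets S"
    by (rule sets_Collect_S) measurable
qed (use assms(2) in auto)

text \<open>Reversing the first k steps turns a strict maximum at the end into positivity of the
  partial sums, and flipping the signs makes them negative. Both moves respect the constraint
  because \<open>A\<close> is symmetric.\<close>

lemma prob_last_is_strict_max:
  assumes A [measurable]: "A \<in> sets borel" and sym: "\<And>x. - x \<in> A \<longleftrightarrow> x \<in> A"
  shows "measure S {f. (\<forall>i<k. f i \<in> A) \<and> (\<forall>j<k. psum f j < psum f k)} = strict A k"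
proof -
  \<comment> \<open>Reverses the first k indices and fixes the others, so that it is injective on
    all indices.\<close>
  define \<pi> where "\<pi> i = (if i < k then k - Suc i else i)" for i
  define P where "P f \<longleftrightarrow> (\<forall>i<k. f i \<in> A) \<and> (\<forall>j<k. psum f j < psum f k)" for f
  have [measurable]: "Measurable.pred S P" unfolding P_def by measurable
  have [measurable]: "Measurable.pred S (\<lambda>f. P (\<lambda>i. f (\<pi> i)))"
    by (rule measurable_compose[of "\<lambda>f i. f (\<pi> i)" S S])
       (auto intro!: measurable_PiM_single' simp: measurable_to_mu)
  have "inj \<pi>" by (auto simp: inj_def \<pi>_def split: if_splits)
  then have "measure S {f. P f} = measure S {f. P (\<lambda>i. f (\<pi> i))}"
    by (simp add: prob_reindex)
  also have "\<dots> = measure S {f. P (\<lambda>i. - f (\<pi> i))}"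
    by (subst prob_uminus[symmetric]) auto
  also have "{f. P (\<lambda>i. - f (\<pi> i))} = {f. (\<forall>i<k. f i \<in> A) \<and> (\<forall>j\<in>{1..k}. psum f j < 0)}"
  proof -
    have ps: "psum (\<lambda>i. - f (\<pi> i)) j = - psum (\<lambda>i. f (k - Suc i)) j" if "j \<le> k" for f j
      using that by (subst psum_uminus) (auto intro!: psum_cong simp: \<pi>_def)
    have 1: "(\<forall>j<k. psum (\<lambda>i. - f (\<pi> i)) j < psum (\<lambda>i. - f (\<pi> i)) k) \<longleftrightarrow>
        (\<forall>j<k. psum f (k - j) < 0)" for f
    proof (rule all_cong)
      fix j assume "j < k"
      then show "psum (\<lambda>i. - f (\<pi> i)) j < psum (\<lambda>i. - f (\<pi> i)) k \<longleftrightarrow> psum f (k - j) < 0"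
        using psum_reverse[of j k f] by (simp add: ps) linarith
    qed
    have 2: "(\<forall>j<k. psum f (k - j) < 0) \<longleftrightarrow> (\<forall>j\<in>{1..k}. psum f j < 0)" for f
    proof safe
      fix j assume *: "\<forall>j<k. psum f (k - j) < 0" "j \<in> {1..k}"
      then have "psum f (k - (k - j)) < 0" by (intro *(1)[rule_format]) auto
      then show "psum f j < 0" using * by simp
    qed auto
    have 3: "(\<forall>i<k. - f (\<pi> i) \<in> A) \<longleftrightarrow> (\<forall>i<k. f i \<in> A)" for f
    proof safe
      fix i assume *: "\<forall>i<k. - f (\<pi> i) \<in> A" "i < k"
      then have "- f (\<pi> (k - Suc i)) \<in> A" by (intro *(1)[rule_format]) auto
      then show "f i \<in> A" using * sym by (simp add: \<pi>_def)
    qed (use sym in \<open>auto simp: \<pi>_def\<close>)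
    show ?thesis unfolding P_def 1 2 3 ..
  qed
  finally show ?thesis by (simp add: P_def strict_def)
qed

text \<open>Decomposition according to the first time at which the maximum over \<open>{..n}\<close> is attained.\<close>

lemma sum_strict_weak:
  assumes A [measurable]: "A \<in> sets borel" and sym: "\<And>x. - x \<in> A \<longleftrightarrow> x \<in> A"
  shows "(\<Sum>k\<le>n. strict A k * weak A (n - k)) = measure \<mu> A ^ n"
proof -
  define P where "P k f \<longleftrightarrow> (\<forall>i<k. f i \<in> A) \<and> (\<forall>j<k. psum f j < psum f k)" for k f
  define Q where "Q k f \<longleftrightarrow> (\<forall>i<n-k. f i \<in> A) \<and> (\<forall>j\<le>n-k. psum f j \<le> 0)" for k f
  define E where "E k = {f. P k f \<and> Q k (\<lambda>i. f (k + i))}" for k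
  have mP [measurable]: "Measurable.pred S (P k)" for k unfolding P_def by measurable
  have mQ [measurable]: "Measurable.pred S (Q k)" for k unfolding Q_def by measurable
  have [measurable]: "Measurable.pred S (\<lambda>f. Q k (\<lambda>i. f (k + i)))" for k
    by (rule measurable_compose[OF measurable_shift]) simp
  have mE: "E k \<in> sets S" for k
    unfolding E_def by (rule sets_Collect_S) measurable
  have E_iff: "f \<in> E k \<longleftrightarrow> (\<forall>i<n. f i \<in> A) \<and> (\<forall>j<k. psum f j < psum f k) \<and>
      (\<forall>j\<le>n. psum f j \<le> psum f k)" if "k \<le> n" for f k
  proof -
    have 1: "(\<forall>i<k. f i \<in> A) \<and> (\<forall>i<n-k. f (k + i) \<in> A) \<longleftrightarrow> (\<forall>i<n. f i \<in> A)"
    proof safe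
      fix i assume *: "\<forall>i<k. f i \<in> A" "\<forall>i<n-k. f (k + i) \<in> A" "i < n"
      show "f i \<in> A"
      proof (cases "i < k")
        case False
        then have "f (k + (i - k)) \<in> A" using * by (intro *(2)[rule_format]) auto
        then show ?thesis using False by simp
      qed (use * in auto)
    qed (use that in auto)
    have 2: "(\<forall>j<k. psum f j < psum f k) \<and> (\<forall>j\<le>n-k. psum (\<lambda>i. f (k + i)) j \<le> 0) \<longleftrightarrow>
       (\<forall>j<k. psum f j < psum f k) \<and> (\<forall>j\<le>n. psum f j \<le> psum f k)"
    proof safe
      fix j assume *: "\<forall>j<k. psum f j < psum f k" "\<forall>j\<le>n-k. psum (\<lambda>i. f (k + i)) j \<le> 0" "j \<le> n"
      show "psum f j \<le> psum f k"
      proof (cases "j < k")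
        case False
        then have "psum (\<lambda>i. f (k + i)) (j - k) \<le> 0" using * by (intro *(2)[rule_format]) auto
        then show ?thesis using False psum_add[of f k "j - k"] by simp
      qed (use * in \<open>simp add: order_less_imp_le\<close>)
    next
      fix j assume *: "\<forall>j\<le>n. psum f j \<le> psum f k" "j \<le> n - k"
      then have "psum f (k + j) \<le> psum f k" using that by (intro *(1)[rule_format]) auto
      then show "psum (\<lambda>i. f (k + i)) j \<le> 0" by (simp add: psum_add)
    qed
    show ?thesis unfolding E_def P_def Q_def mem_Collect_eq using 1 2 by blast
  qed
  have disj: "disjoint_family_on E {..n}"
    unfolding disjoint_family_on_def
  proof (intro ballI impI)
    have "E k \<inter> E l = {}" if "k < l" "l \<le> n" for k l
      using that E_iff[of k] E_iff[of l] by (fastforce dest: spec)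
    then show "E k \<inter> E l = {}" if "k \<in> {..n}" "l \<in> {..n}" "k \<noteq> l" for k l
      using that by (cases "k < l") (auto simp: Int_commute[of "E k"])
  qed
  have union: "(\<Union>k\<in>{..n}. E k) = {f. \<forall>i<n. f i \<in> A}"
  proof safe
    fix f assume f: "\<forall>i<n. f i \<in> A"
    define m where "m = Max (psum f ` {..n})"
    have m: "psum f j \<le> m" if "j \<le> n" for j
      unfolding m_def using that by (intro Max_ge) auto
    have "m \<in> psum f ` {..n}" unfolding m_def by (rule Max_in) auto
    then have ex: "\<exists>k. k \<le> n \<and> psum f k = m" by auto
    define k where "k = (LEAST k. k \<le> n \<and> psum f k = m)"
    have k: "k \<le> n" "psum f k = m" using LeastI_ex[OF ex] by (auto simp: k_def)
    have "psum f j < m" if "j < k" for j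
    proof -
      have "\<not> (j \<le> n \<and> psum f j = m)"
        using that unfolding k_def by (rule not_less_Least)
      then show ?thesis using m[of j] that k(1) by (simp add: less_le)
    qed
    then have "f \<in> E k" using f k m by (simp add: E_iff)
    then show "f \<in> (\<Union>k\<in>{..n}. E k)" using k by auto
  qed (auto simp: E_iff)
  have "measure \<mu> A ^ n = measure S (\<Union>k\<in>{..n}. E k)"
    by (simp add: union prob_all_coords)
  also have "\<dots> = (\<Sum>k\<le>n. measure S (E k))"
    using mE disj by (intro P.finite_measure_finite_Union) auto
  also have "\<dots> = (\<Sum>k\<le>n. strict A k * weak A (n - k))"
  proof (rule sum.cong)
    fix k
    have "measure S (E k) = measure S {f. P k f} * measure S {f. Q k f}"
      unfolding E_def
    proof (rule prob_split[OF mP mQ])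
      fix f g :: "nat \<Rightarrow> real" assume *: "\<And>i. i < k \<Longrightarrow> f i = g i"
      then have "psum f j = psum g j" if "j \<le> k" for j using that by (intro psum_cong) auto
      then show "P k f = P k g" using * by (auto simp: P_def)
    qed
    then show "measure S (E k) = strict A k * weak A (n - k)"
      using prob_last_is_strict_max[OF A sym, of k] by (simp add: P_def Q_def weak_def)
  qed simp
  finally show ?thesis by simp
qed

text \<open>Sum the first-maximum decomposition over all lengths up to m, replace
  \<open>strict\<close> by the larger \<open>weak\<close>, and enlarge the triangle i + j \<le> m to
  a square: the square of the sum of \<open>weak\<close> dominates (m + 1) times the smallest of the
  powers.\<close>

lemma sum_weak_ge:
  assumes A [measurable]: "A \<in> sets borel" and sym: "\<And>x. - x \<in> A \<longleftrightarrow> x \<in> A"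
  shows "sqrt (real (Suc m) * measure \<mu> A ^ m) \<le> (\<Sum>k\<le>m. weak A k)"
proof -
  have le1: "measure \<mu> A \<le> 1" by simp
  have "real (Suc m) * measure \<mu> A ^ m = (\<Sum>n\<le>m. measure \<mu> A ^ m)" by simp
  also have "\<dots> \<le> (\<Sum>n\<le>m. measure \<mu> A ^ n)"
    by (intro sum_mono power_decreasing) (auto simp: le1)
  also have "\<dots> = (\<Sum>n\<le>m. \<Sum>k\<le>n. strict A k * weak A (n - k))"
    by (simp add: sum_strict_weak[OF A sym])
  also have "\<dots> \<le> (\<Sum>n\<le>m. \<Sum>k\<le>n. weak A k * weak A (n - k))"
    by (intro sum_mono mult_right_mono strict_le_weak weak_nonneg A)
  also have "\<dots> = (\<Sum>(i,j)\<in>{(i,j). i + j \<le> m}. weak A i * weak A j)"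
    by (rule sum.triangle_reindex_eq[symmetric])
  also have "\<dots> \<le> (\<Sum>(i,j)\<in>{..m} \<times> {..m}. weak A i * weak A j)"
    by (rule sum_mono2) (auto simp: weak_nonneg)
  also have "\<dots> = (\<Sum>k\<le>m. weak A k)\<^sup>2"
    by (simp add: power2_eq_square sum_product sum.cartesian_product)
  finally show ?thesis
    by (intro real_le_lsqrt) (auto simp: sum_nonneg weak_nonneg)
qed

text \<open>For \<open>A = UNIV\<close> the decomposition sums to 1. As \<open>strict\<close>
  decreases in its length, \<open>strict UNIV n\<close> times the sum of \<open>weak\<close> is at
  most 1, and that sum is at least sqrt (n + 1).\<close>

lemma strict_UNIV_le: "strict UNIV n \<le> 1 / sqrt (real (Suc n))"
proof -
  have "strict UNIV n * sqrt (real (Suc n)) \<le> strict UNIV n * (\<Sum>k\<le>n. weak UNIV k)"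
    using sum_weak_ge[of UNIV n] M.prob_space by (intro mult_left_mono strict_nonneg) auto
  also have "\<dots> = (\<Sum>k\<le>n. strict UNIV n * weak UNIV (n - k))"
    using sum.nat_diff_reindex[of "weak UNIV" "Suc n"]
    by (simp only: diff_Suc_Suc lessThan_Suc_atMost sum_distrib_left[symmetric])
  also have "\<dots> \<le> (\<Sum>k\<le>n. strict UNIV k * weak UNIV (n - k))"
    by (intro sum_mono mult_right_mono strict_antimono weak_nonneg) auto
  also have "\<dots> = 1"
    using sum_strict_weak[of UNIV n] M.prob_space by simp
  finally show ?thesis by (simp add: field_simps)
qed

text \<open>A negative first step followed by a walk that stays nonpositive gives a strictly
  negative walk one step longer, so the bound for \<open>strict\<close> carries over at the price of
  one factor.\<close>

lemma weak_UNIV_le: "measure \<mu> {..<0} * weak UNIV n \<le> 1 / sqrt (real n + 2)"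
proof -
  have "measure \<mu> {..<0} * weak UNIV n =
      measure S {f. f 0 < 0} * measure S {f. \<forall>j\<le>n. psum f j \<le> 0}"
    using prob_coord[of "{..<0}" 0] by (simp add: weak_def)
  also have "\<dots> = measure S {f. f 0 < 0 \<and> (\<lambda>g. \<forall>j\<le>n. psum g j \<le> 0) (\<lambda>i. f (1 + i))}"
    by (subst prob_split) auto
  also have "\<dots> \<le> strict UNIV (Suc n)"
    unfolding strict_def
  proof (rule P.finite_measure_mono)
    show "{f. f 0 < 0 \<and> (\<forall>j\<le>n. psum (\<lambda>i. f (1 + i)) j \<le> 0)} \<subseteq>
       {f. (\<forall>i<Suc n. f i \<in> UNIV) \<and> (\<forall>j\<in>{1..Suc n}. psum f j < 0)}"
    proof safe
      fix f :: "nat \<Rightarrow> real" and j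
      assume *: "f 0 < 0" "\<forall>j\<le>n. psum (\<lambda>i. f (1 + i)) j \<le> 0" "j \<in> {1..Suc n}"
      then obtain l where "j = 1 + l" "l \<le> n" by (cases j) auto
      then have "psum f j = f 0 + psum (\<lambda>i. f (1 + i)) l"
        using psum_add[of f 1 l] by simp
      then show "psum f j < 0" using * \<open>l \<le> n\<close> by fastforce
    qed simp
    show "{f. (\<forall>i<Suc n. f i \<in> UNIV) \<and> (\<forall>j\<in>{1..Suc n}. psum f j < 0)} \<in> sets S"
      by (rule sets_Collect_S) measurable
  qed
  also have "\<dots> \<le> 1 / sqrt (real (Suc (Suc n)))" by (rule strict_UNIV_le)
  finally show ?thesis by (simp add: add.commute)
qed

text \<open>A walk that stays nonpositive, then makes a first jump below \<open>- x\<close>, and afterwards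
  does not rise by more than \<open>x\<close>, is still nonpositive at time \<open>n\<close>.\<close>

lemma prob_max_le_weak:
  assumes x: "0 < x" and mn: "m \<le> n"
  shows "(\<Sum>i<m. weak {-x..x} i) * measure \<mu> {..<-x} * measure S {f. \<forall>j\<le>n. psum f j \<le> x}
    \<le> weak UNIV n"
proof -
  define P where "P i f \<longleftrightarrow> (\<forall>j<i. f j \<in> {-x..x}) \<and> (\<forall>j\<le>i. psum f j \<le> 0)" for i f
  \<comment> \<open>The horizon after the jump is \<open>n\<close> whatever the jump time, so all
    the events \<open>E i\<close> share the same last factor.\<close>
  define Q where "Q f \<longleftrightarrow> (\<forall>j\<le>n. psum f j \<le> x)" for f
  define E where "E i = {f. (P i f \<and> f i < - x) \<and> Q (\<lambda>l. f (Suc i + l))}" for i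
  have [measurable]: "Measurable.pred S (P i)" for i unfolding P_def by measurable
  have [measurable]: "Measurable.pred S Q" unfolding Q_def by measurable
  have [measurable]: "Measurable.pred S (\<lambda>f. Q (\<lambda>l. f (k + l)))" for k
    by (rule measurable_compose[OF measurable_shift]) simp
  have mE: "E i \<in> sets S" for i
    unfolding E_def by (rule sets_Collect_S) measurable
  have depP: "P i f = P i g" if "\<And>j. j < i \<Longrightarrow> f j = g j" for i f g
  proof -
    have "psum f j = psum g j" if "j \<le> i" for j using that \<open>\<And>j. j < i \<Longrightarrow> f j = g j\<close> by (intro psum_cong) auto
    then show ?thesis using that by (auto simp: P_def)
  qed
  have ms: "measure S (E i) = weak {-x..x} i * measure \<mu> {..<-x} * measure S {f. Q f}" for i
  proof -
    have "measure S (E i) = measure S {f. P i f \<and> f i < - x} * measure S {f. Q f}"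
      unfolding E_def
    proof (rule prob_split)
      fix f g :: "nat \<Rightarrow> real" assume *: "\<And>j. j < Suc i \<Longrightarrow> f j = g j"
      then show "(P i f \<and> f i < - x) = (P i g \<and> g i < - x)" using depP[of i f g] by auto
    qed measurable
    also have "{f. P i f \<and> f i < - x} = {f. P i f \<and> (\<lambda>g. g 0 < - x) (\<lambda>l. f (i + l))}" by simp
    also have "measure S \<dots> = measure S {f. P i f} * measure S {f. f 0 < - x}"
    proof (rule prob_split)
      fix f g :: "nat \<Rightarrow> real" assume "\<And>j. j < i \<Longrightarrow> f j = g j"
      then show "P i f = P i g" by (rule depP)
    qed measurable
    also have "measure S {f. f 0 < - x} = measure \<mu> {..<-x}"
      using prob_coord[of "{..<-x}" 0] by simp
    finally show ?thesis by (simp add: weak_def P_def)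
  qed
  have disj: "disjoint_family_on E {..<m}"
    unfolding disjoint_family_on_def
  proof (intro ballI impI)
    have "E k \<inter> E l = {}" if "k < l" for k l
      using that by (fastforce simp: E_def P_def)
    then show "E k \<inter> E l = {}" if "k \<in> {..<m}" "l \<in> {..<m}" "k \<noteq> l" for k l
      using that by (cases "k < l") (auto simp: Int_commute[of "E k"])
  qed
  have sub: "(\<Union>i\<in>{..<m}. E i) \<subseteq> {f. (\<forall>i<n. f i \<in> UNIV) \<and> (\<forall>j\<le>n. psum f j \<le> 0)}"
  proof safe
    fix f i j assume i: "i < m" and f: "f \<in> E i" and j: "j \<le> n"
    show "psum f j \<le> 0"
    proof (cases "j \<le> i")
      case True
      then show ?thesis using f by (auto simp: E_def P_def)
    next
      case False
      define l where "l = j - Suc i"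
      have l: "j = Suc i + l" "l \<le> n" using False j by (auto simp: l_def)
      have "psum f j = psum f i + f i + psum (\<lambda>k. f (Suc i + k)) l"
        unfolding l psum_add by simp
      moreover have "psum f i \<le> 0" "f i < - x" "psum (\<lambda>k. f (Suc i + k)) l \<le> x"
        using f l by (auto simp: E_def P_def Q_def)
      ultimately show ?thesis by linarith
    qed
  qed simp
  have "(\<Sum>i<m. weak {-x..x} i) * measure \<mu> {..<-x} * measure S {f. Q f} = (\<Sum>i<m. measure S (E i))"
    by (simp add: ms sum_distrib_right)
  also have "\<dots> = measure S (\<Union>i\<in>{..<m}. E i)"
    using mE disj by (intro P.finite_measure_finite_Union[symmetric]) auto
  also have "\<dots> \<le> weak UNIV n"
    unfolding weak_def
  proof (rule P.finite_measure_mono[OF sub])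
    show "{f. (\<forall>i<n. f i \<in> UNIV) \<and> (\<forall>j\<le>n. psum f j \<le> 0)} \<in> sets S"
      by (rule sets_Collect_S) measurable
  qed
  finally show ?thesis by (simp add: Q_def)
qed

end

section \<open>Kolmogorov's maximal inequality\<close>

text \<open>The exit is detected from the stopped sum itself, so the value at k is visibly a
  function of the first k terms; \<open>stopped_sum_exceeds_iff\<close> relates it to the exit of
  \<open>psum\<close>.\<close>

primrec stopped_sum :: "real \<Rightarrow> (nat \<Rightarrow> real) \<Rightarrow> nat \<Rightarrow> real" where
  "stopped_sum a f 0 = 0"
| "stopped_sum a f (Suc k) =
     stopped_sum a f k + (if a < \<bar>stopped_sum a f k\<bar> then 0 else f k)"

lemma stopped_sum_cong: "(\<And>i. i < k \<Longrightarrow> f i = g i) \<Longrightarrow> stopped_sum a f k = stopped_sum a g k"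
  by (induction k) simp_all

lemma stopped_sum_exceeds_iff:
  assumes "0 \<le> a"
  shows "a < \<bar>stopped_sum a f k\<bar> \<longleftrightarrow> (\<exists>j\<le>k. a < \<bar>psum f j\<bar>)"
proof -
  have "(a < \<bar>stopped_sum a f k\<bar> \<longleftrightarrow> (\<exists>j\<le>k. a < \<bar>psum f j\<bar>)) \<and>
      (\<not> a < \<bar>stopped_sum a f k\<bar> \<longrightarrow> stopped_sum a f k = psum f k)"
    by (induction k) (use assms in \<open>auto simp: le_Suc_eq\<close>)
  then show ?thesis by blast
qed

lemma measurable_stopped_sum:
  assumes "\<And>i. i < k \<Longrightarrow> (\<lambda>w. X i w) \<in> borel_measurable N"
  shows "(\<lambda>w. stopped_sum a (\<lambda>i. X i w) k) \<in> borel_measurable N"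
  using assms
proof (induction k)
  case (Suc k)
  then have [measurable]: "(\<lambda>w. stopped_sum a (\<lambda>i. X i w) k) \<in> borel_measurable N" "X k \<in> borel_measurable N"
    by auto
  show ?case unfolding stopped_sum.simps by measurable
qed simp

lemma stopped_sum_bounded:
  "(\<And>i. i < k \<Longrightarrow> \<bar>f i\<bar> \<le> B i) \<Longrightarrow> \<bar>stopped_sum a f k\<bar> \<le> (\<Sum>i<k. B i)"
proof (induction k)
  case (Suc k)
  have "\<bar>stopped_sum a f k\<bar> \<le> (\<Sum>i<k. B i)" "\<bar>f k\<bar> \<le> B k" using Suc by auto
  then show ?case by (auto simp: abs_le_iff split: if_splits)
qed simp

text \<open>Stopping at the exit from \<open>[-a, a]\<close> keeps the second moment below the sum of the variances.\<close>

lemma (in prob_space) Kolmogorov_maximal_inequality: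
  fixes X :: "nat \<Rightarrow> 'a \<Rightarrow> real"
  assumes ind: "indep_vars (\<lambda>_. borel) X UNIV"
    and bd: "\<And>i w. w \<in> space M \<Longrightarrow> \<bar>X i w\<bar> \<le> B i"
    and mean: "\<And>i. expectation (X i) = 0"
    and a: "0 < a"
  shows "prob {w \<in> space M. \<exists>k\<le>n. a < \<bar>psum (\<lambda>i. X i w) k\<bar>}
    \<le> (\<Sum>i<n. expectation (\<lambda>w. (X i w)\<^sup>2)) / a\<^sup>2"
proof -
  have X [measurable]: "X i \<in> borel_measurable M" for i
    using ind by (auto simp: indep_vars_def)
  define R where "R k w = stopped_sum a (\<lambda>i. X i w) k" for k w
  have R [measurable]: "R k \<in> borel_measurable M" for k
    unfolding R_def[abs_def] by (rule measurable_stopped_sum) simp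
  have Rb: "\<bar>R k w\<bar> \<le> (\<Sum>i<k. B i)" if "w \<in> space M" for k w
    unfolding R_def by (rule stopped_sum_bounded) (use bd that in auto)
  \<comment> \<open>The position before exit and 0 afterwards. The cross term of the squared
    increment is 2 * Y k * X k; its mean vanishes because \<open>Y k\<close> depends on earlier
    terms only and \<open>X k\<close> is centred.\<close>
  define Y where "Y k w = (if a < \<bar>R k w\<bar> then 0 else R k w)" for k w
  have Y [measurable]: "Y k \<in> borel_measurable M" for k
    unfolding Y_def[abs_def] by measurable
  have Bnn: "0 \<le> B i" for i
    using not_empty bd[of _ i] by (metis abs_ge_zero all_not_in_conv order_trans)
  have Yb: "\<bar>Y k w\<bar> \<le> (\<Sum>i<k. B i)" if "w \<in> space M" for k w
    using Rb[OF that, of k] by (auto simp: Y_def Bnn sum_nonneg)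
  have iX: "integrable M (X i)" for i
    by (rule integrable_const_bound[where B = "B i"]) (auto simp: bd)
  have sq: "x\<^sup>2 \<le> b\<^sup>2" if "\<bar>x\<bar> \<le> b" for x b :: real
    using power_mono[OF that, of 2] by simp
  have iX2: "integrable M (\<lambda>w. (X i w)\<^sup>2)" for i
    by (rule integrable_const_bound[where B = "(B i)\<^sup>2"])
       (auto intro!: AE_I2 sq bd)
  have iY: "integrable M (Y k)" for k
    by (rule integrable_const_bound[where B = "\<Sum>i<k. B i"]) (auto simp: Yb)
  have iR2: "integrable M (\<lambda>w. (R k w)\<^sup>2)" for k
    by (rule integrable_const_bound[where B = "(\<Sum>i<k. B i)\<^sup>2"])
       (auto intro!: AE_I2 sq Rb)
  have indYX: "indep_var borel (Y k) borel (X k)" for k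
  proof -
    have ind_k: "indep_var (PiM {..<k} (\<lambda>_. borel)) (\<lambda>w. restrict (\<lambda>i. X i w) {..<k})
        (PiM {k} (\<lambda>_. borel)) (\<lambda>w. restrict (\<lambda>i. X i w) {k})"
      by (rule indep_var_restrict[OF ind]) auto
    have m: "(\<lambda>f. stopped_sum a f k) \<in> borel_measurable (PiM {..<k} (\<lambda>_. borel))"
      using measurable_stopped_sum[of k "\<lambda>i f. f i" "PiM {..<k} (\<lambda>_. borel)"] by simp
    have "indep_var borel ((\<lambda>f. if a < \<bar>stopped_sum a f k\<bar> then 0 else stopped_sum a f k) \<circ>
         (\<lambda>w. restrict (\<lambda>i. X i w) {..<k})) borel ((\<lambda>f. f k) \<circ> (\<lambda>w. restrict (\<lambda>i. X i w) {k}))"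
    proof (rule indep_var_compose[OF ind_k])
      note m [measurable]
      show "(\<lambda>f. if a < \<bar>stopped_sum a f k\<bar> then 0 else stopped_sum a f k)
          \<in> borel_measurable (PiM {..<k} (\<lambda>_. borel))" by measurable
    qed simp
    moreover have "stopped_sum a (restrict (\<lambda>i. X i w) {..<k}) k = R k w" for w
      unfolding R_def by (rule stopped_sum_cong) simp
    moreover have "Y k = (\<lambda>f. if a < \<bar>stopped_sum a f k\<bar> then 0 else stopped_sum a f k) \<circ>
        (\<lambda>w. restrict (\<lambda>i. X i w) {..<k})"
      using calculation(2) by (simp add: fun_eq_iff Y_def)
    moreover have "X k = (\<lambda>f. f k) \<circ> (\<lambda>w. restrict (\<lambda>i. X i w) {k})"
      by (simp add: fun_eq_iff)
    ultimately show ?thesis by (simp only:)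
  qed
  have step: "expectation (\<lambda>w. (R (Suc k) w)\<^sup>2) \<le>
      expectation (\<lambda>w. (R k w)\<^sup>2) + expectation (\<lambda>w. (X k w)\<^sup>2)" for k
  proof -
    have iYX: "integrable M (\<lambda>w. Y k w * X k w)"
      by (rule indep_var_integrable[OF indYX iY iX])
    \<comment> \<open>Pointwise an equality before exit; after exit the left side stays put and the
      right side gains a square.\<close>
    have "expectation (\<lambda>w. (R (Suc k) w)\<^sup>2) \<le>
        expectation (\<lambda>w. ((R k w)\<^sup>2 + (X k w)\<^sup>2) + 2 * (Y k w * X k w))"
      using iR2[of k] iR2[of "Suc k"] iX2[of k] iYX
      by (intro integral_mono Bochner_Integration.integrable_add integrable_mult_right)
         (auto simp: R_def Y_def power2_eq_square algebra_simps)
    also have "\<dots> = expectation (\<lambda>w. (R k w)\<^sup>2) + expectation (\<lambda>w. (X k w)\<^sup>2) +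
        2 * expectation (\<lambda>w. Y k w * X k w)"
      using iR2[of k] iX2[of k] iYX by simp
    also have "expectation (\<lambda>w. Y k w * X k w) = 0"
      using indep_var_lebesgue_integral[OF indYX iY iX] mean by simp
    finally show ?thesis by simp
  qed
  have "expectation (\<lambda>w. (R n w)\<^sup>2) \<le> (\<Sum>i<n. expectation (\<lambda>w. (X i w)\<^sup>2))"
  proof (induction n)
    case 0
    then show ?case by (simp add: R_def)
  next
    case (Suc n)
    then show ?case using step[of n] by simp
  qed
  moreover have "prob {w \<in> space M. a\<^sup>2 \<le> (R n w)\<^sup>2} \<le> expectation (\<lambda>w. (R n w)\<^sup>2) / a\<^sup>2"
    using iR2[of n] a by (intro integral_Markov_inequality_measure[where A = "{}"]) auto
  moreover have "prob {w \<in> space M. \<exists>k\<le>n. a < \<bar>psum (\<lambda>i. X i w) k\<bar>} \<le>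
      prob {w \<in> space M. a\<^sup>2 \<le> (R n w)\<^sup>2}"
  proof (rule finite_measure_mono)
    show "{w \<in> space M. \<exists>k\<le>n. a < \<bar>psum (\<lambda>i. X i w) k\<bar>} \<subseteq> {w \<in> space M. a\<^sup>2 \<le> (R n w)\<^sup>2}"
    proof safe
      fix w k assume "w \<in> space M" "k \<le> n" "a < \<bar>psum (\<lambda>i. X i w) k\<bar>"
      then have "a < \<bar>R n w\<bar>"
        using stopped_sum_exceeds_iff[of a "\<lambda>i. X i w" n] a by (auto simp: R_def)
      then show "a\<^sup>2 \<le> (R n w)\<^sup>2" using a by (simp add: abs_le_square_iff[symmetric])
    qed
  qed measurable
  ultimately show ?thesis
    by (meson divide_right_mono order_trans zero_le_power2)
qed

section \<open>Symmetric walks with regularly varying tails\<close>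

lemma dyadic_ceiling:
  assumes "1 \<le> (x::real)"
  shows "\<exists>k. x \<le> 2 ^ k \<and> 2 ^ k \<le> 2 * x"
proof -
  have ex: "\<exists>k. x \<le> 2 ^ k" using real_arch_pow[of 2 x] by (auto intro: less_imp_le)
  define k where "k = (LEAST k. x \<le> 2 ^ k)"
  have k: "x \<le> 2 ^ k" unfolding k_def by (rule LeastI_ex[OF ex])
  have "(2::real) ^ k \<le> 2 * x"
  proof (cases k)
    case 0
    then show ?thesis using assms by simp
  next
    case (Suc l)
    have "\<not> x \<le> 2 ^ l" using Suc by (intro not_less_Least) (simp add: k_def)
    then show ?thesis using Suc by simp
  qed
  with k show ?thesis by blast
qed

text \<open>The tail asymptotics in quantitative form. The upper bound covers all positive x, with
  \<open>C0\<close> large enough for small ones; the lower bound starts at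
  \<open>x0\<close>.\<close>

locale symmetric_stable = symmetric_iid +
  fixes \<alpha> c0 C0 x0 :: real
  assumes alpha: "1 < \<alpha>" "\<alpha> < 2" and pos: "0 < c0" "0 < C0" "0 < x0"
    and lower: "\<And>x. x0 \<le> x \<Longrightarrow> c0 * x powr - \<alpha> \<le> measure \<mu> {..<-x}"
    and upper: "\<And>x. 0 < x \<Longrightarrow> measure \<mu> {z. x < \<bar>z\<bar>} \<le> C0 * x powr - \<alpha>"
begin

text \<open>In \<open>prob_max_le_weak\<close> take m of order x powr \<alpha>: the sum of
  \<open>weak\<close> is at least of order sqrt m, a jump has probability of order 1 / m, and the
  right side is at most of order 1 / sqrt n. Solving for the probability gives the order sqrt (m /
  n).\<close>

lemma prob_max_le:
  "\<exists>C>0. \<exists>x1>0. \<forall>x\<ge>x1. \<forall>n. x powr \<alpha> \<le> 2 * C0 * real n \<longrightarrow>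
     measure S {f. \<forall>j\<le>n. psum f j \<le> x} \<le> C * sqrt (x powr \<alpha> / real n)"
proof -
  define p where "p = measure \<mu> {..<0}"
  have "0 < c0 * x0 powr - \<alpha>" using pos by simp
  also have "\<dots> \<le> measure \<mu> {..<-x0}" by (rule lower) simp
  also have "\<dots> \<le> p" unfolding p_def using pos by (intro M.finite_measure_mono) (auto simp: sets_mu)
  finally have p: "0 < p" .
  \<comment> \<open>Beyond \<open>x1\<close> the lower tail bound applies and x powr \<alpha> is at
    least 2 * C0, which makes the number m of steps positive.\<close>
  define x1 where "x1 = max x0 ((2 * C0) powr (1 / \<alpha>))"
  have main: "measure S {f. \<forall>j\<le>n. psum f j \<le> x} \<le> (sqrt (8 * C0) / (p * c0)) * sqrt (x powr \<alpha> / real n)"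
    if x: "x1 \<le> x" and n: "x powr \<alpha> \<le> 2 * C0 * real n" for x n
  proof -
    have xpos: "0 < x" using x pos by (auto simp: x1_def)
    define y where "y = x powr \<alpha>"
    have y: "0 < y" using xpos by (simp add: y_def)
    have "((2 * C0) powr (1 / \<alpha>)) powr \<alpha> \<le> x powr \<alpha>"
      using x alpha by (intro powr_mono2) (auto simp: x1_def)
    then have y2: "2 * C0 \<le> y" using alpha pos by (simp add: powr_powr y_def)
    \<comment> \<open>Chosen so that m steps have total probability at most 1/2 of exceeding x in
      absolute value; Bernoulli's inequality then keeps the power of \<open>\<theta>\<close> above
      1/2. The assumed bound on x powr \<alpha> gives m \<le> n.\<close>
    define m where "m = nat \<lfloor>y / (2 * C0)\<rfloor>"
    have "1 \<le> y / (2 * C0)" using y2 pos by simp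
    then have m1: "1 \<le> m" and m_le: "real m \<le> y / (2 * C0)" and "y / (2 * C0) < real m + 1"
      unfolding m_def by linarith+
    then have m_ge: "y / (2 * C0) \<le> 2 * real m" by linarith
    have "y / (2 * C0) \<le> real n" using n pos by (simp add: y_def field_simps)
    with m_le have mn: "m \<le> n" by linarith
    define \<theta> where "\<theta> = measure \<mu> {-x..x}"
    have "{-x..x} = UNIV - {z. x < \<bar>z\<bar>}" by auto
    then have "\<theta> = 1 - measure \<mu> {z. x < \<bar>z\<bar>}"
      using M.prob_compl[of "{z. x < \<bar>z\<bar>}"] by (simp add: \<theta>_def sets_mu)
    also have "\<dots> \<ge> 1 - C0 / y"
      using upper[OF xpos] by (simp add: y_def powr_minus divide_inverse)
    finally have \<theta>: "1 - C0 / y \<le> \<theta>" .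
    have "C0 / y \<le> 1 / 2" using y2 y by (simp add: field_simps)
    have "1 / 2 \<le> 1 + real (m - 1) * (- (C0 / y))"
    proof -
      have "real (m - 1) * (C0 / y) \<le> real m * (C0 / y)"
        using pos y by (intro mult_right_mono) auto
      also have "\<dots> \<le> y / (2 * C0) * (C0 / y)"
        using m_le pos y by (intro mult_right_mono) auto
      also have "\<dots> = 1 / 2" using pos y by simp
      finally show ?thesis by simp
    qed
    also have "\<dots> \<le> (1 + - (C0 / y)) ^ (m - 1)"
      using order_trans[OF \<open>C0 / y \<le> 1 / 2\<close>, of 1] by (intro Bernoulli_inequality) simp
    also have "\<dots> \<le> \<theta> ^ (m - 1)"
      using \<theta> order_trans[OF \<open>C0 / y \<le> 1 / 2\<close>, of 1] by (intro power_mono) simp_all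
    finally have \<theta>m: "1 / 2 \<le> \<theta> ^ (m - 1)" .
    have "sqrt (y / (8 * C0)) \<le> sqrt (real m * \<theta> ^ (m - 1))"
    proof (rule real_sqrt_le_mono)
      have "y / (8 * C0) \<le> real m * (1 / 2)" using m_ge pos by (simp add: field_simps)
      also have "\<dots> \<le> real m * \<theta> ^ (m - 1)" using \<theta>m by (intro mult_left_mono) auto
      finally show "y / (8 * C0) \<le> real m * \<theta> ^ (m - 1)" .
    qed
    also have "\<dots> = sqrt (real (Suc (m - 1)) * \<theta> ^ (m - 1))" using m1 by simp
    also have "\<dots> \<le> (\<Sum>k\<le>m-1. weak {-x..x} k)"
      unfolding \<theta>_def by (rule sum_weak_ge) auto
    also have "{..m-1} = {..<m}" using m1 by auto
    finally have W: "sqrt (y / (8 * C0)) \<le> (\<Sum>k<m. weak {-x..x} k)" .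
    define q where "q = measure S {f. \<forall>j\<le>n. psum f j \<le> x}"
    have low: "c0 / y \<le> measure \<mu> {..<-x}"
      using lower[of x] x by (simp add: x1_def y_def powr_minus divide_inverse)
    have "sqrt (y / (8 * C0)) * (c0 / y) * q \<le> (\<Sum>i<m. weak {-x..x} i) * measure \<mu> {..<-x} * q"
      using W low pos y by (intro mult_mono) (auto simp: q_def sum_nonneg weak_nonneg)
    also have "\<dots> \<le> weak UNIV n"
      unfolding q_def by (rule prob_max_le_weak[OF xpos mn])
    also have "weak UNIV n \<le> 1 / (p * sqrt (real n))"
    proof -
      have n0: "0 < real n" using m1 mn by simp
      have "p * weak UNIV n \<le> 1 / sqrt (real n + 2)"
        unfolding p_def by (rule weak_UNIV_le)
      also have "\<dots> \<le> 1 / sqrt (real n)" using n0 by (intro divide_left_mono) auto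
      finally show ?thesis using p n0 by (simp add: field_simps)
    qed
    finally have *: "sqrt (y / (8 * C0)) * (c0 / y) * q \<le> 1 / (p * sqrt (real n))" .
    define s where "s = sqrt y"
    have s: "0 < s" "y = s * s" using y by (auto simp: s_def)
    have c: "0 < sqrt (8 * C0)" using pos by simp
    have eq: "sqrt (y / (8 * C0)) * (c0 / y) = c0 / (s * sqrt (8 * C0))"
      unfolding real_sqrt_divide s_def[symmetric] using s by (simp add: s(2))
    have le: "c0 / (s * sqrt (8 * C0)) * q \<le> 1 / (p * sqrt (real n))" using * unfolding eq .
    have "q = (c0 / (s * sqrt (8 * C0)) * q) * (s * sqrt (8 * C0) / c0)"
      using s c pos by simp
    also have "\<dots> \<le> (1 / (p * sqrt (real n))) * (s * sqrt (8 * C0) / c0)"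
      using le s c pos by (intro mult_right_mono) simp_all
    also have "\<dots> = (sqrt (8 * C0) / (p * c0)) * sqrt (y / real n)"
      by (simp add: s_def real_sqrt_divide field_simps)
    finally show ?thesis by (simp add: q_def y_def)
  qed
  show ?thesis
  proof (intro exI conjI)
    show "0 < sqrt (8 * C0) / (p * c0)" using p pos by simp
    show "0 < x1" using pos by (simp add: x1_def)
  qed (use main in blast)
qed

section \<open>Truncated moments of a step\<close>

definition trunc :: "nat \<Rightarrow> real \<Rightarrow> real" where
  "trunc p x = (\<integral>z. (if \<bar>z\<bar> \<le> x then \<bar>z\<bar> ^ p else 0) \<partial>\<mu>)"

lemma measurable_mu: "measurable \<mu> N = measurable borel N"
  by (rule measurable_cong_sets[OF sets_mu refl])

lemma integrable_trunc: "integrable \<mu> (\<lambda>z. if \<bar>z\<bar> \<le> x then \<bar>z\<bar> ^ p else 0)"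
proof (rule M.integrable_const_bound[where B = "\<bar>x\<bar> ^ p"])
  have "\<bar>z\<bar> ^ p \<le> \<bar>x\<bar> ^ p" if "\<bar>z\<bar> \<le> x" for z using that by (intro power_mono) auto
  then show "AE z in \<mu>. norm (if \<bar>z\<bar> \<le> x then \<bar>z\<bar> ^ p else 0) \<le> \<bar>x\<bar> ^ p" by (intro AE_I2) simp
qed (simp add: measurable_mu)

lemma integral_tail: "(\<integral>z. (if x < \<bar>z\<bar> then c else 0) \<partial>\<mu>) = c * measure \<mu> {z. x < \<bar>z\<bar>}"
  and integrable_tail: "integrable \<mu> (\<lambda>z. if x < \<bar>z\<bar> then c else (0::real))"
proof -
  have eq: "(\<lambda>z. if x < \<bar>z\<bar> then c else 0) = (\<lambda>z. c * indicator {z. x < \<bar>z\<bar>} z)"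
    by (auto simp: indicator_def)
  have m: "{z. x < \<bar>z\<bar>} \<in> sets \<mu>" unfolding sets_mu by measurable
  show "(\<integral>z. (if x < \<bar>z\<bar> then c else 0) \<partial>\<mu>) = c * measure \<mu> {z. x < \<bar>z\<bar>}"
    "integrable \<mu> (\<lambda>z. if x < \<bar>z\<bar> then c else (0::real))"
    unfolding eq using m by (simp_all add: M.emeasure_eq_measure)
qed

text \<open>Values between x and 2 x contribute at most (2 x) ^ p times the tail probability at
  x.\<close>

lemma trunc_double:
  assumes "0 < x" shows "trunc p (2 * x) \<le> trunc p x + 2 ^ p * C0 * x powr (real p - \<alpha>)"
proof -
  have "trunc p (2 * x) \<le> (\<integral>z. (if \<bar>z\<bar> \<le> x then \<bar>z\<bar> ^ p else 0) + (if x < \<bar>z\<bar> then (2 * x) ^ p else 0) \<partial>\<mu>)"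
    unfolding trunc_def
  proof (rule integral_mono)
    fix z :: real
    have "\<bar>z\<bar> ^ p \<le> (2 * x) ^ p" if "\<bar>z\<bar> \<le> 2 * x" using that by (intro power_mono) auto
    then show "(if \<bar>z\<bar> \<le> 2 * x then \<bar>z\<bar> ^ p else 0) \<le>
        (if \<bar>z\<bar> \<le> x then \<bar>z\<bar> ^ p else 0) + (if x < \<bar>z\<bar> then (2 * x) ^ p else 0)"
      using assms by auto
  qed (intro Bochner_Integration.integrable_add integrable_trunc integrable_tail)+
  also have "\<dots> = trunc p x + (2 * x) ^ p * measure \<mu> {z. x < \<bar>z\<bar>}"
    by (simp add: integrable_trunc integrable_tail integral_tail trunc_def)
  also have "\<dots> \<le> trunc p x + (2 * x) ^ p * (C0 * x powr - \<alpha>)"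
    using upper[OF assms] assms by (intro add_left_mono mult_left_mono) auto
  also have "(2 * x) ^ p * (C0 * x powr - \<alpha>) = 2 ^ p * C0 * x powr (real p - \<alpha>)"
    using assms powr_add[of x "real p" "- \<alpha>"] by (simp add: powr_realpow power_mult_distrib)
  finally show ?thesis .
qed

lemma trunc_2_bound: "\<exists>K>0. \<forall>x\<ge>1. trunc 2 x \<le> K * x powr (2 - \<alpha>)"
proof -
  define r where "r = 2 powr (2 - \<alpha>) - 1"
  \<comment> \<open>The induction over powers of 2 closes if K + 4 * C0 \<le> K * 2 powr (2 -
    \<alpha>), which is possible because \<alpha> < 2; the summand 1 covers the start.\<close>
  define K where "K = 1 + 4 * C0 / r"
  have r: "0 < r" using alpha by (simp add: r_def)
  have K: "1 \<le> K" "4 * C0 \<le> K * r" using r pos by (simp_all add: K_def field_simps)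
  have dy: "trunc 2 (2 ^ k) \<le> K * (2 ^ k) powr (2 - \<alpha>)" for k
  proof (induction k)
    case 0
    have "trunc 2 1 \<le> (\<integral>z. 1 \<partial>\<mu>)"
      unfolding trunc_def by (intro integral_mono integrable_trunc) (auto simp: abs_square_le_1)
    then show ?case using K M.prob_space by simp
  next
    case (Suc k)
    define y where "y = ((2::real) ^ k) powr (2 - \<alpha>)"
    have y: "0 \<le> y" by (simp add: y_def)
    have "trunc 2 (2 ^ Suc k) \<le> K * y + 4 * C0 * y"
      using trunc_double[of "2 ^ k" 2] Suc by (simp add: y_def)
    also have "\<dots> \<le> K * y + K * r * y"
      using K y by (intro add_left_mono mult_right_mono)
    also have "\<dots> = K * (2 ^ Suc k) powr (2 - \<alpha>)"
      by (simp add: y_def r_def powr_mult algebra_simps)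
    finally show ?case .
  qed
  have "trunc 2 x \<le> (4 * K) * x powr (2 - \<alpha>)" if "1 \<le> x" for x
  proof -
    from dyadic_ceiling[OF that] obtain k where k: "x \<le> 2 ^ k" "2 ^ k \<le> 2 * x" by blast
    have "trunc 2 x \<le> trunc 2 (2 ^ k)"
      unfolding trunc_def using k by (intro integral_mono integrable_trunc) auto
    also have "\<dots> \<le> K * (2 ^ k) powr (2 - \<alpha>)" by (rule dy)
    also have "\<dots> \<le> K * (2 * x) powr (2 - \<alpha>)"
      using k K alpha by (intro mult_left_mono powr_mono2) auto
    also have "\<dots> = K * 2 powr (2 - \<alpha>) * x powr (2 - \<alpha>)"
      using that by (simp add: powr_mult)
    also have "\<dots> \<le> K * 2 powr 2 * x powr (2 - \<alpha>)"
      using K alpha by (intro mult_right_mono mult_left_mono powr_mono) auto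
    finally show ?thesis by (simp add: powr_numeral mult.commute)
  qed
  then show ?thesis using K by (intro exI[of _ "4 * K"]) auto
qed

text \<open>As \<alpha> > 1, the dyadic shells contribute a geometric series of ratio 2 powr (1 -
  \<alpha>), so the truncated first moments stay bounded and monotone convergence applies.\<close>

lemma integrable_abs: "integrable \<mu> (\<lambda>z. \<bar>z\<bar>)"
proof -
  define q where "q = 2 powr (1 - \<alpha>)"
  have q: "0 < q" "q < 1"
    using alpha powr_less_mono[of "1 - \<alpha>" 0 2] by (simp_all add: q_def)
  have dy: "trunc 1 (2 ^ k) \<le> 1 + 2 * C0 * (\<Sum>j<k. q ^ j)" for k
  proof (induction k)
    case 0
    have "trunc 1 1 \<le> (\<integral>z. 1 \<partial>\<mu>)"
      unfolding trunc_def by (intro integral_mono integrable_trunc) auto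
    then show ?case using M.prob_space by simp
  next
    case (Suc k)
    have "((2::real) ^ k) powr (1 - \<alpha>) = q ^ k"
      by (simp add: q_def powr_realpow[symmetric] powr_powr mult.commute)
    then show ?case using trunc_double[of "2 ^ k" 1] Suc by (simp add: algebra_simps)
  qed
  have "trunc 1 (2 ^ k) \<le> 1 + 2 * C0 * (1 / (1 - q))" for k
  proof -
    have "(\<Sum>j<k. q ^ j) = (1 - q ^ k) / (1 - q)"
      using q by (simp add: sum_gp_strict)
    also have "\<dots> \<le> 1 / (1 - q)" using q by (intro divide_right_mono) auto
    finally show ?thesis using dy[of k] pos mult_left_mono[of "\<Sum>j<k. q ^ j" "1 / (1 - q)" "2 * C0"] by simp
  qed
  moreover have mono: "incseq (\<lambda>k. trunc 1 (2 ^ k))"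
    unfolding trunc_def incseq_def power_one_right
  proof (intro allI impI integral_mono integrable_trunc[where p = 1, unfolded power_one_right])
    fix m n :: nat and z :: real assume "m \<le> n"
    then have "(2::real) ^ m \<le> 2 ^ n" by (intro power_increasing) auto
    from order_trans[OF _ this, of "\<bar>z\<bar>"]
    show "(if \<bar>z\<bar> \<le> 2 ^ m then \<bar>z\<bar> else 0) \<le> (if \<bar>z\<bar> \<le> 2 ^ n then \<bar>z\<bar> else 0)" by simp
  qed
  ultimately obtain L where L: "(\<lambda>k. trunc 1 (2 ^ k)) \<longlonglongrightarrow> L"
    using incseq_convergent[OF mono, of "1 + 2 * C0 * (1 / (1 - q))"] by blast
  show ?thesis
  proof (rule integrable_monotone_convergence)
    show "integrable \<mu> (\<lambda>z. if \<bar>z\<bar> \<le> 2 ^ k then \<bar>z\<bar> else 0)" for k :: nat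
      by (rule integrable_trunc[where p = 1, unfolded power_one_right])
    show "AE z in \<mu>. mono (\<lambda>k. if \<bar>z\<bar> \<le> 2 ^ k then \<bar>z\<bar> else 0)"
    proof (rule AE_I2, rule monoI)
      fix m n :: nat and z :: real assume "m \<le> n"
      then have "(2::real) ^ m \<le> 2 ^ n" by (intro power_increasing) auto
      from order_trans[OF _ this, of "\<bar>z\<bar>"]
      show "(if \<bar>z\<bar> \<le> 2 ^ m then \<bar>z\<bar> else 0) \<le> (if \<bar>z\<bar> \<le> 2 ^ n then \<bar>z\<bar> else 0)" by simp
    qed
    show "AE z in \<mu>. (\<lambda>k. if \<bar>z\<bar> \<le> 2 ^ k then \<bar>z\<bar> else 0) \<longlonglongrightarrow> \<bar>z\<bar>"
    proof (rule AE_I2, rule tendsto_eventually)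
      fix z :: real
      obtain k where k: "\<bar>z\<bar> < 2 ^ k" using real_arch_pow[of 2 "\<bar>z\<bar>"] by auto
      show "\<forall>\<^sub>F k in sequentially. (if \<bar>z\<bar> \<le> 2 ^ k then \<bar>z\<bar> else 0) = \<bar>z\<bar>"
        using eventually_ge_at_top[of k]
      proof eventually_elim
        case (elim n)
        then have "(2::real) ^ k \<le> 2 ^ n" by (intro power_increasing) auto
        with k have "\<bar>z\<bar> \<le> 2 ^ n" by linarith
        then show ?case by simp
      qed
    qed
    show "(\<lambda>k. \<integral>z. (if \<bar>z\<bar> \<le> 2 ^ k then \<bar>z\<bar> else 0) \<partial>\<mu>) \<longlonglongrightarrow> L"
      using L by (simp only: trunc_def power_one_right)
    show "(\<lambda>z. \<bar>z\<bar>) \<in> borel_measurable \<mu>" by (simp add: measurable_mu)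
  qed
qed

end

section \<open>Second Borel-Cantelli lemma on blocks, and small balls\<close>

context symmetric_iid
begin

lemma distr_coord: "distr S borel (\<lambda>f. f i) = \<mu>"
proof -
  have "distr S borel (\<lambda>f. f i) = distr S \<mu> (\<lambda>f. f i)"
    by (rule distr_cong) (simp_all add: sets_mu)
  then show ?thesis using distr_PiM_component[of UNIV "\<lambda>_. \<mu>" i] M.prob_space_axioms by simp
qed

lemma integral_coord:
  fixes g :: "real \<Rightarrow> real"
  assumes "g \<in> borel_measurable borel"
  shows "(\<integral>f. g (f i) \<partial>S) = (\<integral>z. g z \<partial>\<mu>)"
  using integral_distr[OF measurable_coord assms, of i] by (simp only: distr_coord)

lemma indep_coords: "P.indep_vars (\<lambda>_. borel) (\<lambda>i f. f i) UNIV"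
proof (subst P.indep_vars_iff_distr_eq_PiM')
  have "distr S (PiM UNIV (\<lambda>_. borel)) (\<lambda>f. f) = S"
    by (rule distr_id2) (intro sets_PiM_cong refl sets_mu[symmetric])
  then show "distr S (PiM UNIV (\<lambda>_. borel)) (\<lambda>f. \<lambda>i\<in>UNIV. f i) = PiM UNIV (\<lambda>i. distr S borel (\<lambda>f. f i))"
    by (simp only: distr_coord restrict_UNIV)
qed simp_all

text \<open>Truncating symmetrically keeps the steps centred, so
  \<open>Kolmogorov_maximal_inequality\<close> applies without recentring.\<close>

lemma integral_odd:
  fixes g :: "real \<Rightarrow> real"
  assumes [measurable]: "g \<in> borel_measurable borel" and odd: "\<And>z. g (- z) = - g z"
  shows "(\<integral>z. g z \<partial>\<mu>) = 0"
proof -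
  have "(\<integral>z. g z \<partial>\<mu>) = (\<integral>z. g z \<partial>distr \<mu> borel uminus)" by (simp only: symmetric_mu)
  also have "\<dots> = (\<integral>z. g (- z) \<partial>\<mu>)"
    by (rule integral_distr) (simp_all add: measurable_cong_sets[OF sets_mu refl])
  finally show ?thesis by (simp add: odd)
qed

text \<open>The second Borel-Cantelli lemma: block events depend on disjoint sets of steps, so the
  probability that l consecutive ones fail is a product of factors 1 - p, hence at most the
  exponential of minus their sum.\<close>

lemma AE_infinitely_many_blocks:
  fixes Q :: "nat \<Rightarrow> (nat \<Rightarrow> real) \<Rightarrow> bool" and N :: "nat \<Rightarrow> nat"
  assumes Q [measurable]: "\<And>j. Measurable.pred S (Q j)"
    and dep: "\<And>j f g. (\<And>i. i < N (Suc j) - N j \<Longrightarrow> f i = g i) \<Longrightarrow> Q j f = Q j g"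
    and N: "mono N"
    and div: "\<not> summable (\<lambda>j. measure S {f. Q j f})"
  shows "AE f in S. \<exists>\<^sub>\<infinity>j. Q j (\<lambda>i. f (N j + i))"
proof -
  define p where "p j = measure S {f. Q j f}" for j
  have p: "0 \<le> p j" "p j \<le> 1" for j by (simp_all add: p_def)
  have mQ [measurable]: "Measurable.pred S (\<lambda>f. Q j (\<lambda>i. f (N j + i)))" for j
    by (rule measurable_compose[OF measurable_shift]) simp
  have depN: "Q j (\<lambda>i. f (N j + i)) = Q j (\<lambda>i. g (N j + i))"
    if "\<And>i. i < N (Suc j) \<Longrightarrow> f i = g i" for j f g
    by (rule dep) (use that in auto)
  have D: "measure S {f. \<forall>j\<in>{n..<n+l}. \<not> Q j (\<lambda>i. f (N j + i))} \<le> exp (- (\<Sum>k<l. p (n + k)))" for n l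
  proof (induction l)
    case 0
    then show ?case by simp
  next
    case (Suc l)
    have "{f. \<forall>j\<in>{n..<n+Suc l}. \<not> Q j (\<lambda>i. f (N j + i))} =
        {f. (\<forall>j\<in>{n..<n+l}. \<not> Q j (\<lambda>i. f (N j + i))) \<and> (\<lambda>g. \<not> Q (n + l) g) (\<lambda>i. f (N (n + l) + i))}"
      by (auto simp: less_Suc_eq)
    also have "measure S \<dots> = measure S {f. \<forall>j\<in>{n..<n+l}. \<not> Q j (\<lambda>i. f (N j + i))} *
        measure S {f. \<not> Q (n + l) f}"
    proof (rule prob_split)
      fix f g :: "nat \<Rightarrow> real" assume eq: "\<And>i. i < N (n + l) \<Longrightarrow> f i = g i"
      have "Q j (\<lambda>i. f (N j + i)) = Q j (\<lambda>i. g (N j + i))" if "j \<in> {n..<n+l}" for j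
      proof (rule depN)
        fix i assume "i < N (Suc j)"
        also have "N (Suc j) \<le> N (n + l)" using that by (intro monoD[OF N]) auto
        finally show "f i = g i" by (rule eq)
      qed
      then show "(\<forall>j\<in>{n..<n+l}. \<not> Q j (\<lambda>i. f (N j + i))) = (\<forall>j\<in>{n..<n+l}. \<not> Q j (\<lambda>i. g (N j + i)))"
        by blast
    qed measurable
    also have "measure S {f. \<not> Q (n + l) f} = 1 - p (n + l)"
      using P.prob_neg[of "Q (n + l)"] sets_Collect_S[of "Q (n + l)"] by (simp add: p_def)
    also have "measure S {f. \<forall>j\<in>{n..<n+l}. \<not> Q j (\<lambda>i. f (N j + i))} * (1 - p (n + l)) \<le>
        exp (- (\<Sum>k<l. p (n + k))) * exp (- p (n + l))"
      using Suc.IH p exp_ge_add_one_self[of "- p (n + l)"] by (intro mult_mono) auto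
    also have "\<dots> = exp (- (\<Sum>k<Suc l. p (n + k)))"
      by (simp add: exp_add[symmetric])
    finally show ?case .
  qed
  have "AE f in S. \<exists>j\<ge>n. Q j (\<lambda>i. f (N j + i))" for n
  proof -
    define c where "c = measure S {f. \<forall>j\<ge>n. \<not> Q j (\<lambda>i. f (N j + i))}"
    have "c = 0"
    proof (rule ccontr)
      assume "c \<noteq> 0"
      then have c: "0 < c" by (simp add: c_def less_le)
      \<comment> \<open>If failure from n on had positive probability c, every partial sum would be
        at most - ln c, contradicting divergence.\<close>
      have "(\<Sum>k<l. p (k + n)) \<le> - ln c" for l
      proof -
        have "c \<le> measure S {f. \<forall>j\<in>{n..<n+l}. \<not> Q j (\<lambda>i. f (N j + i))}"
          unfolding c_def
        proof (rule P.finite_measure_mono)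
          show "{f. \<forall>j\<in>{n..<n+l}. \<not> Q j (\<lambda>i. f (N j + i))} \<in> sets S"
            by (rule sets_Collect_S) measurable
        qed auto
        also note D
        finally have "ln c \<le> ln (exp (- (\<Sum>k<l. p (n + k))))"
          using c by (subst ln_le_cancel_iff) auto
        then show ?thesis by (simp add: add.commute)
      qed
      then have "summable (\<lambda>k. p (k + n))"
        by (intro summableI_nonneg_bounded p)
      then have "summable p" by (simp only: summable_iff_shift)
      with div show False by (simp add: p_def[abs_def])
    qed
    then have "emeasure S {f. \<forall>j\<ge>n. \<not> Q j (\<lambda>i. f (N j + i))} = 0"
      by (simp add: c_def P.emeasure_eq_measure)
    moreover have "{f. \<forall>j\<ge>n. \<not> Q j (\<lambda>i. f (N j + i))} \<in> sets S"
      by (rule sets_Collect_S) measurable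
    ultimately show ?thesis
      by (intro AE_I[of _ _ "{f. \<forall>j\<ge>n. \<not> Q j (\<lambda>i. f (N j + i))}"]) auto
  qed
  then have "AE f in S. \<forall>n. \<exists>j\<ge>n. Q j (\<lambda>i. f (N j + i))"
    by (simp only: AE_all_countable) blast
  then show ?thesis by (simp add: INFM_nat_le)
qed

text \<open>In each block of \<open>m\<close> steps the walk stays within \<open>y\<close> of its starting point and, by symmetry,
  moves towards the origin with probability at least \<open>1/4\<close>.\<close>

lemma small_ball:
  assumes half: "measure S {f. \<exists>k\<le>m. y < \<bar>psum f k\<bar>} \<le> 1 / 2" and y: "0 \<le> y"
  shows "(1 / 4) ^ r \<le> measure S {f. \<forall>k\<le>r * m. \<bar>psum f k\<bar> \<le> 2 * y}"
proof -
  define Qm where "Qm f \<longleftrightarrow> (\<forall>k\<le>m. \<bar>psum f k\<bar> \<le> y) \<and> psum f m \<le> 0" for f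
  define Qp where "Qp f \<longleftrightarrow> (\<forall>k\<le>m. \<bar>psum f k\<bar> \<le> y) \<and> 0 \<le> psum f m" for f
  \<comment> \<open>The induction carries two radii: 2 * y at all times, but y at the ends of
    blocks. Starting a block within y and moving at most y inside it gives the larger
    radius.\<close>
  define E where "E r f \<longleftrightarrow> (\<forall>k\<le>r * m. \<bar>psum f k\<bar> \<le> 2 * y) \<and> \<bar>psum f (r * m)\<bar> \<le> y" for r f
  have Qm [measurable]: "Measurable.pred S Qm" unfolding Qm_def[abs_def] by measurable
  have Qp [measurable]: "Measurable.pred S Qp" unfolding Qp_def[abs_def] by measurable
  have E [measurable]: "Measurable.pred S (E r)" for r unfolding E_def[abs_def] by measurable
  have sQm [measurable]: "Measurable.pred S (\<lambda>f. Qm (\<lambda>i. f (k + i)))" for k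
    by (rule measurable_compose[OF measurable_shift Qm])
  have sQp [measurable]: "Measurable.pred S (\<lambda>f. Qp (\<lambda>i. f (k + i)))" for k
    by (rule measurable_compose[OF measurable_shift Qp])
  have "{f. Qp f} = {f. Qm (\<lambda>i. - f i)}"
    by (simp add: Qm_def Qp_def psum_uminus)
  then have eq: "measure S {f. Qp f} = measure S {f. Qm f}"
    by (simp add: prob_uminus)
  have "1 / 2 \<le> 1 - measure S {f. \<exists>k\<le>m. y < \<bar>psum f k\<bar>}" using half by simp
  also have "\<dots> = measure S {f. \<not> (\<exists>k\<le>m. y < \<bar>psum f k\<bar>)}"
    using P.prob_neg[of "\<lambda>f. \<exists>k\<le>m. y < \<bar>psum f k\<bar>"] sets_Collect_S[of "\<lambda>f. \<exists>k\<le>m. y < \<bar>psum f k\<bar>"] by simp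
  also have "\<dots> \<le> measure S ({f. Qm f} \<union> {f. Qp f})"
    by (rule P.finite_measure_mono) (auto simp: Qm_def Qp_def not_less intro!: sets.Un sets_Collect_S Qm Qp)
  also have "\<dots> \<le> measure S {f. Qm f} + measure S {f. Qp f}"
    by (rule measure_Un_le) (auto intro!: sets_Collect_S Qm Qp)
  finally have quarter: "1 / 4 \<le> measure S {f. Qm f}" "1 / 4 \<le> measure S {f. Qp f}"
    using eq by auto
  have "(1 / 4) ^ r \<le> measure S {f. E r f}" for r
  proof (induction r)
    case 0
    have "{f. E 0 f} = UNIV" using y by (auto simp: E_def)
    then show ?case using P.prob_space by simp
  next
    case (Suc r)
    \<comment> \<open>The next block is steered by the sign of the current position: down from above
      0, up from below. Either way its end is again within y of 0.\<close>
    let ?A = "{f. (E r f \<and> 0 \<le> psum f (r * m)) \<and> Qm (\<lambda>i. f (r * m + i))}"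
    let ?B = "{f. (E r f \<and> psum f (r * m) < 0) \<and> Qp (\<lambda>i. f (r * m + i))}"
    have dep: "E r f = E r g \<and> psum f (r * m) = psum g (r * m)" if "\<And>i. i < r * m \<Longrightarrow> f i = g i" for f g
    proof -
      have "psum f k = psum g k" if "k \<le> r * m" for k
        using that \<open>\<And>i. i < r * m \<Longrightarrow> f i = g i\<close> by (intro psum_cong) auto
      then show ?thesis by (auto simp: E_def)
    qed
    have A: "measure S ?A = measure S {f. E r f \<and> 0 \<le> psum f (r * m)} * measure S {f. Qm f}"
    proof (rule prob_split)
      fix f g :: "nat \<Rightarrow> real" assume "\<And>i. i < r * m \<Longrightarrow> f i = g i"
      from dep[OF this] show "(E r f \<and> 0 \<le> psum f (r * m)) = (E r g \<and> 0 \<le> psum g (r * m))" by simp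
    qed measurable
    have B: "measure S ?B = measure S {f. E r f \<and> psum f (r * m) < 0} * measure S {f. Qp f}"
    proof (rule prob_split)
      fix f g :: "nat \<Rightarrow> real" assume "\<And>i. i < r * m \<Longrightarrow> f i = g i"
      from dep[OF this] show "(E r f \<and> psum f (r * m) < 0) = (E r g \<and> psum g (r * m) < 0)" by simp
    qed measurable
    have mA: "?A \<in> sets S" by (rule sets_Collect_S) measurable
    have mB: "?B \<in> sets S" by (rule sets_Collect_S) measurable
    have mE: "{f. E (Suc r) f} \<in> sets S" by (rule sets_Collect_S) measurable
    have sub: "?A \<union> ?B \<subseteq> {f. E (Suc r) f}"
    proof -
      have "E (Suc r) f" if e: "E r f"
        and q: "\<And>k. k \<le> m \<Longrightarrow> \<bar>psum (\<lambda>i. f (r * m + i)) k\<bar> \<le> y"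
        and s: "\<bar>psum f (r * m) + psum (\<lambda>i. f (r * m + i)) m\<bar> \<le> y" for f
        unfolding E_def
      proof (intro conjI allI impI)
        fix k assume k: "k \<le> Suc r * m"
        show "\<bar>psum f k\<bar> \<le> 2 * y"
        proof (cases "k \<le> r * m")
          case True
          then show ?thesis using e by (simp add: E_def)
        next
          case False
          define l where "l = k - r * m"
          have l: "k = r * m + l" "l \<le> m" using False k by (auto simp: l_def)
          have "\<bar>psum f (r * m)\<bar> \<le> y" using e by (simp add: E_def)
          then show ?thesis using q[OF l(2)] unfolding l(1) psum_add by linarith
        qed
      next
        have "psum f (Suc r * m) = psum f (r * m) + psum (\<lambda>i. f (r * m + i)) m"
          unfolding psum_add[symmetric] by (simp add: add.commute)
        then show "\<bar>psum f (Suc r * m)\<bar> \<le> y" using s by simp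
      qed
      moreover have "\<bar>psum f (r * m)\<bar> \<le> y" if "E r f" for f using that by (simp add: E_def)
      ultimately show ?thesis
        by (fastforce simp: Qm_def Qp_def abs_le_iff)
    qed
    have "(1 / 4) ^ Suc r \<le> (1 / 4) * measure S {f. E r f}"
      using Suc.IH by simp
    also have "measure S {f. E r f} =
        measure S ({f. E r f \<and> 0 \<le> psum f (r * m)} \<union> {f. E r f \<and> psum f (r * m) < 0})"
      by (rule arg_cong[where f = "measure S"]) auto
    also have "\<dots> = measure S {f. E r f \<and> 0 \<le> psum f (r * m)} + measure S {f. E r f \<and> psum f (r * m) < 0}"
    proof (rule P.finite_measure_Union)
      show "{f. E r f \<and> 0 \<le> psum f (r * m)} \<in> sets S" by (rule sets_Collect_S) measurable
      show "{f. E r f \<and> psum f (r * m) < 0} \<in> sets S" by (rule sets_Collect_S) measurable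
    qed auto
    also have "1 / 4 * (measure S {f. E r f \<and> 0 \<le> psum f (r * m)} + measure S {f. E r f \<and> psum f (r * m) < 0})
        \<le> measure S ?A + measure S ?B"
      unfolding A B
      using mult_right_mono[OF quarter(1), of "measure S {f. E r f \<and> 0 \<le> psum f (r * m)}"]
        mult_right_mono[OF quarter(2), of "measure S {f. E r f \<and> psum f (r * m) < 0}"]
      by (simp add: algebra_simps)
    also have "\<dots> = measure S (?A \<union> ?B)"
      using mA mB by (intro P.finite_measure_Union[symmetric]) auto
    also have "\<dots> \<le> measure S {f. E (Suc r) f}"
      by (rule P.finite_measure_mono[OF sub mE])
    finally show ?case .
  qed
  also have "measure S {f. E r f} \<le> measure S {f. \<forall>k\<le>r * m. \<bar>psum f k\<bar> \<le> 2 * y}"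
  proof (rule P.finite_measure_mono)
    show "{f. \<forall>k\<le>r * m. \<bar>psum f k\<bar> \<le> 2 * y} \<in> sets S" by (rule sets_Collect_S) measurable
  qed (auto simp: E_def)
  finally show ?thesis .
qed

end

section \<open>Almost sure behaviour of the symmetric walk\<close>

context symmetric_stable
begin

text \<open>Either some step exceeds x, with probability at most n * C0 * x powr - \<alpha>, or the
  walk with steps truncated at x exceeds x. For the latter, Kolmogorov's inequality and
  \<open>trunc_2_bound\<close> give the same order.\<close>

lemma maximal_tail:
  "\<exists>C>0. \<forall>x\<ge>1. \<forall>n. measure S {f. \<exists>k\<le>n. x < \<bar>psum f k\<bar>} \<le> C * real n * x powr - \<alpha>"
proof -
  obtain K where K: "0 < K" "\<And>x. 1 \<le> x \<Longrightarrow> trunc 2 x \<le> K * x powr (2 - \<alpha>)"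
    using trunc_2_bound by blast
  have "measure S {f. \<exists>k\<le>n. x < \<bar>psum f k\<bar>} \<le> (C0 + K) * real n * x powr - \<alpha>" if x: "1 \<le> x" for x n
  proof -
    define h where "h z = (if \<bar>z\<bar> \<le> x then z else 0)" for z :: real
    have h [measurable]: "h \<in> borel_measurable borel" unfolding h_def[abs_def] by measurable
    let ?U = "{f. \<exists>k\<le>n. x < \<bar>psum (\<lambda>i. h (f i)) k\<bar>}"
    let ?V = "\<Union>i\<in>{..<n}. {f. x < \<bar>f i\<bar>}"
    have mV: "{f. x < \<bar>f i\<bar>} \<in> sets S" for i by (rule sets_Collect_S) measurable
    have mU: "?U \<in> sets S" by (rule sets_Collect_S) (unfold psum_def, measurable)
    have ind: "P.indep_vars (\<lambda>_. borel) (\<lambda>i f. h (f i)) UNIV"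
      by (rule P.indep_vars_compose2[OF indep_coords]) simp
    have t: "(\<integral>f. (h (f i))\<^sup>2 \<partial>S) = trunc 2 x" for i
      using integral_coord[of "\<lambda>z. (h z)\<^sup>2" i] by (simp add: trunc_def h_def if_distrib[of "\<lambda>z. z\<^sup>2"] cong: if_cong)
    have "measure S {f \<in> space S. \<exists>k\<le>n. x < \<bar>psum (\<lambda>i. h (f i)) k\<bar>} \<le>
        (\<Sum>i<n. (\<integral>f. (h (f i))\<^sup>2 \<partial>S)) / x\<^sup>2"
    proof (rule P.Kolmogorov_maximal_inequality[OF ind, of "\<lambda>_. x"])
      have "(\<integral>z. h z \<partial>\<mu>) = 0" by (rule integral_odd[OF h]) (simp add: h_def)
      then show "(\<integral>f. h (f i) \<partial>S) = 0" for i
        by (simp only: integral_coord[OF h])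
    qed (use x in \<open>auto simp: h_def\<close>)
    also have "\<dots> \<le> real n * (K * x powr (2 - \<alpha>)) / x\<^sup>2"
      unfolding t using K(2)[OF x] by (simp add: divide_right_mono mult_left_mono)
    also have "\<dots> = K * real n * x powr - \<alpha>"
      using x powr_add[of x 2 "- \<alpha>"] by (simp add: powr_numeral)
    finally have U: "measure S ?U \<le> K * real n * x powr - \<alpha>" by simp
    have "measure S ?V \<le> (\<Sum>i<n. measure S {f. x < \<bar>f i\<bar>})"
      using mV by (intro P.finite_measure_subadditive_finite) auto
    also have "\<dots> = real n * measure \<mu> {z. x < \<bar>z\<bar>}"
      using prob_coord[of "{z. x < \<bar>z\<bar>}"] by simp
    also have "\<dots> \<le> real n * (C0 * x powr - \<alpha>)"
      using upper[of x] x by (intro mult_left_mono) auto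
    finally have V: "measure S ?V \<le> C0 * real n * x powr - \<alpha>" by (simp add: algebra_simps)
    have "{f. \<exists>k\<le>n. x < \<bar>psum f k\<bar>} \<subseteq> ?V \<union> ?U"
    proof safe
      fix f k assume *: "f \<notin> ?V" "k \<le> n" "x < \<bar>psum f k\<bar>"
      have "\<bar>f i\<bar> \<le> x" if "i < k" for i
        using *(1,2) that by (auto simp: not_less)
      then have "psum (\<lambda>i. h (f i)) k = psum f k"
        by (intro psum_cong) (simp add: h_def)
      then show "\<exists>k\<le>n. x < \<bar>psum (\<lambda>i. h (f i)) k\<bar>" using * by auto
    qed
    then have "measure S {f. \<exists>k\<le>n. x < \<bar>psum f k\<bar>} \<le> measure S (?V \<union> ?U)"
      using mU mV by (intro P.finite_measure_mono) auto
    also have "\<dots> \<le> measure S ?V + measure S ?U"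
      using mU mV by (intro measure_Un_le) auto
    finally show ?thesis using U V by (simp add: algebra_simps)
  qed
  then show ?thesis using K(1) pos by (intro exI[of _ "C0 + K"]) auto
qed

text \<open>At this height the ratio in \<open>prob_max_le\<close> is a constant times k powr -(2 +
  \<eta>), whose root is summable. The factor 2 leaves room for the perturbation between walk and
  potential.\<close>

lemma AE_max_exceeds:
  assumes \<eta>: "0 < \<eta>"
  shows "AE f in S. \<forall>\<^sub>F k in sequentially.
    \<exists>j\<le>2 ^ k. 2 * climb \<alpha> \<eta> k < psum f j"
proof -
  obtain C x1 where C: "0 < C" "0 < x1" and le: "\<And>x n. x1 \<le> x \<Longrightarrow> x powr \<alpha> \<le> 2 * C0 * real n \<Longrightarrow>
      measure S {f. \<forall>j\<le>n. psum f j \<le> x} \<le> C * sqrt (x powr \<alpha> / real n)"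
    using prob_max_le by blast
  define u where "u k = 2 * climb \<alpha> \<eta> k" for k :: nat
  have u_powr: "u k powr \<alpha> = 2 powr \<alpha> * (2 ^ k / real k powr (2 + \<eta>))" for k
    using alpha by (simp add: u_def powr_mult powr_powr)
  have "filterlim u at_top sequentially"
    unfolding u_def using alpha \<eta> by real_asymp
  then have ev1: "\<forall>\<^sub>F k in sequentially. x1 \<le> u k"
    by (simp add: filterlim_at_top)
  have "((\<lambda>k. 2 powr \<alpha> / real k powr (2 + \<eta>)) \<longlongrightarrow> 0) sequentially"
    using \<eta> by real_asymp
  then have ev2: "\<forall>\<^sub>F k in sequentially. 2 powr \<alpha> / real k powr (2 + \<eta>) < 2 * C0"
    using pos by (auto dest!: order_tendstoD(2)[of _ 0 _ "2 * C0"])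
  have "AE f in S. \<forall>\<^sub>F k in sequentially. \<not> (\<forall>j\<le>2 ^ k. psum f j \<le> u k)"
  proof (rule P.AE_eventually_not)
    show "\<forall>\<^sub>F k in sequentially. measure S {f \<in> space S. \<forall>j\<le>2 ^ k. psum f j \<le> u k} \<le>
        C * 2 powr (\<alpha> / 2) * real k powr (- (1 + \<eta> / 2))"
      using ev1 ev2 eventually_gt_at_top[of 0]
    proof eventually_elim
      case (elim k)
      have "u k powr \<alpha> = (2 powr \<alpha> / real k powr (2 + \<eta>)) * 2 ^ k"
        by (simp add: u_powr)
      also have "\<dots> \<le> (2 * C0) * 2 ^ k" using elim by (intro mult_right_mono) auto
      finally have "measure S {f \<in> space S. \<forall>j\<le>2 ^ k. psum f j \<le> u k} \<le> C * sqrt (u k powr \<alpha> / real (2 ^ k))"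
        using elim le[of "u k" "2 ^ k"] by simp
      also have "u k powr \<alpha> / real (2 ^ k) = 2 powr \<alpha> / real k powr (2 + \<eta>)"
        by (simp add: u_powr)
      also have "\<dots> = (2 powr (\<alpha> / 2) * real k powr (- (1 + \<eta> / 2)))\<^sup>2"
      proof -
        have "2 powr \<alpha> = (2 powr (\<alpha> / 2))\<^sup>2" by (simp add: powr_power)
        moreover have "real k powr (2 + \<eta>) = (real k powr (1 + \<eta> / 2))\<^sup>2"
          using elim by (simp add: powr_power algebra_simps)
        ultimately show ?thesis
          by (simp only: powr_minus_divide power_mult_distrib power_one_over power_divide) simp
      qed
      also have "sqrt \<dots> = 2 powr (\<alpha> / 2) * real k powr (- (1 + \<eta> / 2))"
        by (rule real_sqrt_unique) auto
      finally show ?case by simp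
    qed
    show "summable (\<lambda>k. C * 2 powr (\<alpha> / 2) * real k powr (- (1 + \<eta> / 2)))"
      using \<eta> by (intro summable_mult) (simp add: summable_real_powr_iff)
  qed measurable
  then show ?thesis by (simp add: u_def not_le)
qed

text \<open>Infinitely often the walk stays within 2 y of its position at the start of a block, and
  eventually that position and all earlier ones are within y of 0; together this gives radius 3
  y.\<close>

lemma AE_confined:
  "\<exists>K>0. AE f in S. \<exists>\<^sub>\<infinity>j. \<forall>i\<le>2 ^ (j\<^sup>2). \<bar>psum f i\<bar> \<le> K * confinement \<alpha> j"
proof -
  obtain C where C: "0 < C" and tail: "\<And>x n. 1 \<le> x \<Longrightarrow>
      measure S {f. \<exists>k\<le>n. x < \<bar>psum f k\<bar>} \<le> C * real n * x powr - \<alpha>"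
    using maximal_tail by blast
  define N :: "nat \<Rightarrow> nat" where "N j = 2 ^ (j\<^sup>2)" for j
  \<comment> \<open>With blocks of about 2 * ln 4 * N j / ln j steps, this constant makes the exit
    bound of \<open>maximal_tail\<close> at most 1/2. At most ln j / ln 4 such blocks, plus one for
    rounding, fill N j steps, and \<open>small_ball\<close> yields 1 / (4 j).\<close>
  define \<kappa> where "\<kappa> = (4 * C * ln 4) powr (1 / \<alpha>)"
  define y where "y j = \<kappa> * confinement \<alpha> j" for j :: nat
  have \<kappa>: "0 < \<kappa>" using C by (simp add: \<kappa>_def)
  have y0: "0 \<le> y j" for j using \<kappa> by (simp add: y_def)
  have y_powr: "y j powr \<alpha> = 4 * C * ln 4 * (2 ^ (j\<^sup>2) / ln (real j))" if "1 < j" for j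
    using alpha C that by (simp add: y_def \<kappa>_def powr_mult powr_powr)
  have Nr: "real (N j) = 2 ^ (j\<^sup>2)" for j by (simp add: N_def)
  have "filterlim y at_top sequentially"
    unfolding y_def using alpha \<kappa> by real_asymp
  then have ev1: "\<forall>\<^sub>F j in sequentially. 1 \<le> y j"
    by (simp add: filterlim_at_top)
  have "filterlim (\<lambda>j. 2 * ln 4 * (2 ^ (j\<^sup>2) / ln (real j))) at_top sequentially"
    by real_asymp
  then have ev2: "\<forall>\<^sub>F j in sequentially. 1 \<le> 2 * ln 4 * (2 ^ (j\<^sup>2) / ln (real j))"
    by (simp add: filterlim_at_top)
  have ball: "\<forall>\<^sub>F j in sequentially. 1 / (4 * real j) \<le> measure S {f. \<forall>k\<le>N j. \<bar>psum f k\<bar> \<le> 2 * y j}"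
    using ev1 ev2 eventually_gt_at_top[of 1]
  proof eventually_elim
    case (elim j)
    define v where "v = 2 * ln 4 * (2 ^ (j\<^sup>2) / ln (real j))"
    define m where "m = nat \<lfloor>v\<rfloor>"
    have lnj: "0 < ln (real j)" using elim by simp
    have "1 \<le> v" using elim by (simp add: v_def)
    then have m1: "1 \<le> m" and m_le: "real m \<le> v" and "v < real m + 1"
      unfolding m_def by linarith+
    then have m_ge: "v \<le> 2 * real m" by linarith
    define r where "r = N j div m + 1"
    have "measure S {f. \<exists>k\<le>m. y j < \<bar>psum f k\<bar>} \<le> C * real m * y j powr - \<alpha>"
      using elim by (intro tail) auto
    also have "\<dots> \<le> C * v * y j powr - \<alpha>"
      using m_le C by (intro mult_right_mono mult_left_mono) auto
    also have "\<dots> = C * v / (y j powr \<alpha>)"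
      by (simp add: powr_minus divide_inverse)
    also have "\<dots> = 1 / 2"
      unfolding y_powr[OF \<open>1 < j\<close>] v_def using C lnj by (simp add: field_simps)
    finally have half: "measure S {f. \<exists>k\<le>m. y j < \<bar>psum f k\<bar>} \<le> 1 / 2" .
    have "real (N j div m) \<le> real (N j) / real m"
      by (rule of_nat_div_le_of_nat)
    also have "\<dots> \<le> ln (real j) / ln 4"
    proof -
      have "real (N j) * ln 4 = v / 2 * ln (real j)"
        using lnj by (simp add: v_def Nr)
      also have "\<dots> \<le> real m * ln (real j)"
        using m_ge lnj by (intro mult_right_mono) auto
      finally show ?thesis using m1 by (simp add: field_simps)
    qed
    finally have div: "real (N j div m) \<le> ln (real j) / ln 4" .
    have "1 / (4 * real j) = (1 / 4) * exp (- (ln 4 * (ln (real j) / ln 4)))"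
      using elim by (simp add: exp_minus inverse_eq_divide)
    also have "\<dots> \<le> (1 / 4) * exp (- (ln 4 * real (N j div m)))"
      using mult_left_mono[OF div, of "ln 4"] by (intro mult_left_mono) simp_all
    also have "exp (- (ln 4 * real (N j div m))) = (1 / 4 :: real) ^ (N j div m)"
      by (simp add: exp_minus mult.commute[of "ln 4"] exp_of_nat_mult power_one_over inverse_eq_divide)
    also have "(1 / 4) * (1 / 4 :: real) ^ (N j div m) = (1 / 4) ^ r"
      by (simp add: r_def)
    also have "\<dots> \<le> measure S {f. \<forall>k\<le>r * m. \<bar>psum f k\<bar> \<le> 2 * y j}"
      by (rule small_ball[OF half y0])
    also have "\<dots> \<le> measure S {f. \<forall>k\<le>N j. \<bar>psum f k\<bar> \<le> 2 * y j}"
    proof (rule P.finite_measure_mono)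
      have "N j mod m < m" using m1 by simp
      then have "N j \<le> r * m"
        using div_mult_mod_eq[of "N j" m] unfolding r_def add_mult_distrib by linarith
      then show "{f. \<forall>k\<le>r * m. \<bar>psum f k\<bar> \<le> 2 * y j} \<subseteq> {f. \<forall>k\<le>N j. \<bar>psum f k\<bar> \<le> 2 * y j}"
        by auto
      show "{f. \<forall>k\<le>N j. \<bar>psum f k\<bar> \<le> 2 * y j} \<in> sets S"
        by (rule sets_Collect_S) measurable
    qed
    finally show ?case .
  qed
  \<comment> \<open>Block \<open>j\<close> ends at time \<open>N (Suc j)\<close>, so it is measured
    on the scale \<open>y (Suc j)\<close>.\<close>
  define Q where "Q j f \<longleftrightarrow> (\<forall>k\<le>N (Suc j) - N j. \<bar>psum f k\<bar> \<le> 2 * y (Suc j))" for j f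
  have Q: "Measurable.pred S (Q j)" for j unfolding Q_def[abs_def] by measurable
  have "AE f in S. \<exists>\<^sub>\<infinity>j. Q j (\<lambda>i. f (N j + i))"
  proof (rule AE_infinitely_many_blocks[OF Q])
    fix j and f g :: "nat \<Rightarrow> real" assume "\<And>i. i < N (Suc j) - N j \<Longrightarrow> f i = g i"
    then have "psum f k = psum g k" if "k \<le> N (Suc j) - N j" for k
      using that by (intro psum_cong) auto
    then show "Q j f = Q j g" by (auto simp: Q_def)
  next
    show "mono N" unfolding N_def by (intro monoI power_increasing power_mono) auto
  next
    show "\<not> summable (\<lambda>j. measure S {f. Q j f})"
    proof
      assume "summable (\<lambda>j. measure S {f. Q j f})"
      then have "summable (\<lambda>j. 1 / (4 * real (Suc j)))"
      proof (rule summable_comparison_test_ev[rotated])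
        have "\<forall>\<^sub>F j in sequentially. 1 / (4 * real (Suc j)) \<le>
            measure S {f. \<forall>k\<le>N (Suc j). \<bar>psum f k\<bar> \<le> 2 * y (Suc j)}"
          using ball by (simp only: eventually_sequentially_Suc[of "\<lambda>j. 1 / (4 * real j) \<le> measure S {f. \<forall>k\<le>N j. \<bar>psum f k\<bar> \<le> 2 * y j}"])
        then show "\<forall>\<^sub>F j in sequentially. norm (1 / (4 * real (Suc j))) \<le> measure S {f. Q j f}"
        proof eventually_elim
          case (elim j)
          also have "measure S {f. \<forall>k\<le>N (Suc j). \<bar>psum f k\<bar> \<le> 2 * y (Suc j)} \<le> measure S {f. Q j f}"
            by (rule P.finite_measure_mono) (auto simp: Q_def intro!: sets_Collect_S[OF Q, unfolded Q_def])
          finally show ?case by simp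
        qed
      qed
      then have "summable (\<lambda>j. 4 * (1 / (4 * real (Suc j))))" by (rule summable_mult)
      moreover have "4 * (1 / (4 * real (Suc j))) = inverse (real (Suc j))" for j
        by (simp add: inverse_eq_divide del: of_nat_Suc)
      ultimately have "summable (\<lambda>j. inverse (real (Suc j)))" by (simp only:)
      then have "summable (\<lambda>j. inverse (real j))"
        using summable_Suc_iff[of "\<lambda>j. inverse (real j)"] by simp
      then show False using not_summable_harmonic[where 'a = real] by simp
    qed
  qed
  \<comment> \<open>Consecutive exponents differ by 2 j + 1, so the first \<open>N j\<close> steps
    reach the next scale with probability at most ln (j + 1) / 2 ^ (2 j + 1) up to a constant
    factor, which is summable.\<close>
  moreover have "AE f in S. \<forall>\<^sub>F j in sequentially. \<not> (\<exists>k\<le>N j. y (Suc j) < \<bar>psum f k\<bar>)"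
  proof (rule P.AE_eventually_not)
      have "\<forall>\<^sub>F j in sequentially. 1 \<le> y (Suc j)"
        using ev1 by (simp only: eventually_sequentially_Suc[of "\<lambda>j. 1 \<le> y j"])
      then show "\<forall>\<^sub>F j in sequentially. measure S {f \<in> space S. \<exists>k\<le>N j. y (Suc j) < \<bar>psum f k\<bar>} \<le> (1 / 2) ^ j"
        using eventually_gt_at_top[of 0]
      proof eventually_elim
        case (elim j)
        have ln4: "1 \<le> ln (4 :: real)"
          using ln_ge_iff[of 4 1] exp_le by simp
        have lnS: "0 < ln (real (Suc j))" using elim by simp
        have sq: "(Suc j)\<^sup>2 = j\<^sup>2 + (j + Suc j)" by (simp add: power2_eq_square)
        have "measure S {f. \<exists>k\<le>N j. y (Suc j) < \<bar>psum f k\<bar>} \<le> C * real (N j) * y (Suc j) powr - \<alpha>"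
          using elim by (intro tail) auto
        also have "\<dots> = C * real (N j) / (y (Suc j) powr \<alpha>)"
          by (simp add: powr_minus divide_inverse)
        also have "\<dots> = ln (real (Suc j)) / (4 * ln 4 * 2 ^ (j + Suc j))"
          using elim C lnS ln4 by (subst y_powr) (simp_all add: Nr sq power_add field_simps)
        also have "\<dots> \<le> 2 ^ Suc j / (1 * 2 ^ (j + Suc j))"
        proof (rule frac_le)
          have "ln (real (Suc j)) \<le> real (Suc j)" using ln_le_minus_one[of "real (Suc j)"] by simp
          also have "\<dots> \<le> 2 ^ Suc j" using of_nat_less_two_power[of "Suc j", where 'a = real] by linarith
          finally show "ln (real (Suc j)) \<le> 2 ^ Suc j" .
          show "1 * 2 ^ (j + Suc j) \<le> 4 * ln 4 * (2 :: real) ^ (j + Suc j)"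
            using ln4 by (intro mult_right_mono) auto
        qed auto
        also have "\<dots> = (1 / 2) ^ j" by (simp add: power_add power_one_over)
        finally show ?case by simp
      qed
    show "summable (\<lambda>j. (1 / 2 :: real) ^ j)" by (simp add: summable_geometric)
  qed measurable
  ultimately have "AE f in S. \<exists>\<^sub>\<infinity>j. \<forall>i\<le>N j. \<bar>psum f i\<bar> \<le> 3 * y j"
  proof eventually_elim
    case (elim f)
    have "\<exists>\<^sub>\<infinity>j. \<forall>i\<le>N (Suc j). \<bar>psum f i\<bar> \<le> 3 * y (Suc j)"
      using frequently_eventually_conj[OF elim(1)[unfolded cofinite_eq_sequentially] elim(2)]
      unfolding cofinite_eq_sequentially
    proof (rule frequently_elim1, intro allI impI)
      fix j i
      assume *: "\<not> (\<exists>k\<le>N j. y (Suc j) < \<bar>psum f k\<bar>) \<and> Q j (\<lambda>i. f (N j + i))"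
        and i: "i \<le> N (Suc j)"
      have pre: "\<bar>psum f k\<bar> \<le> y (Suc j)" if "k \<le> N j" for k
        using * that by (auto simp: not_less)
      show "\<bar>psum f i\<bar> \<le> 3 * y (Suc j)"
      proof (cases "i \<le> N j")
        case True
        then show ?thesis using pre[of i] y0[of "Suc j"] by linarith
      next
        case False
        define l where "l = i - N j"
        have l: "i = N j + l" "l \<le> N (Suc j) - N j" using False i by (auto simp: l_def)
        have "\<bar>psum (\<lambda>i. f (N j + i)) l\<bar> \<le> 2 * y (Suc j)" using * l by (auto simp: Q_def)
        then show ?thesis using pre[of "N j"] unfolding l(1) psum_add by simp
      qed
    qed
    then show ?case
      unfolding INFM_nat_le by (meson Suc_leD Suc_le_mono)
  qed
  then show ?thesis
    using \<kappa> by (intro exI[of _ "3 * \<kappa>"]) (simp add: y_def N_def mult.assoc)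
qed

end

section \<open>The potential of the mixed environment\<close>

text \<open>The increment of the potential at a site is a function of the pair (chi, xi) there, so
  independence within each family and between the two families must be combined. Rectangles form an
  intersection-stable generator on which the probabilities factorise.\<close>

lemma (in prob_space) indep_vars_Pair:
  fixes X Y :: "nat \<Rightarrow> 'a \<Rightarrow> real"
  assumes X: "indep_vars (\<lambda>_. borel) X UNIV" and Y: "indep_vars (\<lambda>_. borel) Y UNIV"
    and XY: "indep_var (\<Pi>\<^sub>M n\<in>UNIV. borel) (\<lambda>w n. X n w) (\<Pi>\<^sub>M n\<in>UNIV. borel) (\<lambda>w n. Y n w)"
  shows "indep_vars (\<lambda>_. borel \<Otimes>\<^sub>M borel) (\<lambda>n w. (X n w, Y n w)) UNIV"
proof -
  have mX [measurable]: "X n \<in> borel_measurable M" for n using X by (auto simp: indep_vars_def)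
  have mY [measurable]: "Y n \<in> borel_measurable M" for n using Y by (auto simp: indep_vars_def)
  define G where "G n = {(X n -` a \<inter> space M) \<inter> (Y n -` b \<inter> space M) | a b. a \<in> sets borel \<and> b \<in> sets borel}" for n
  have G_ev: "G n \<subseteq> events" for n
    by (auto simp: G_def intro!: sets.Int measurable_sets[OF mX] measurable_sets[OF mY])
  have prod: "prob ((\<Inter>j\<in>J. X j -` a j \<inter> space M) \<inter> (\<Inter>j\<in>J. Y j -` b j \<inter> space M)) =
      (\<Prod>j\<in>J. prob (X j -` a j \<inter> space M)) * (\<Prod>j\<in>J. prob (Y j -` b j \<inter> space M))"
    if J: "finite J" "J \<noteq> {}" and ab: "\<And>j. j \<in> J \<Longrightarrow> a j \<in> sets borel" "\<And>j. j \<in> J \<Longrightarrow> b j \<in> sets borel"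
    for J and a b :: "nat \<Rightarrow> real set"
  proof -
    let ?P = "\<Pi>\<^sub>M n\<in>(UNIV::nat set). (borel :: real measure)"
    define A where "A = prod_emb UNIV (\<lambda>_. borel :: real measure) J (Pi\<^sub>E J a)"
    define B where "B = prod_emb UNIV (\<lambda>_. borel :: real measure) J (Pi\<^sub>E J b)"
    have "A \<in> sets ?P" "B \<in> sets ?P"
      unfolding A_def B_def using J ab by (auto intro!: sets_PiM_I)
    from indep_varD[OF XY this]
    have "prob ((\<lambda>w. (\<lambda>n. X n w, \<lambda>n. Y n w)) -` (A \<times> B) \<inter> space M) =
       prob ((\<lambda>w n. X n w) -` A \<inter> space M) * prob ((\<lambda>w n. Y n w) -` B \<inter> space M)" .
    moreover have "(\<lambda>w n. X n w) -` A \<inter> space M = (\<Inter>j\<in>J. X j -` a j \<inter> space M)"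
      using J by (auto simp: A_def prod_emb_def PiE_iff)
    moreover have "(\<lambda>w n. Y n w) -` B \<inter> space M = (\<Inter>j\<in>J. Y j -` b j \<inter> space M)"
      using J by (auto simp: B_def prod_emb_def PiE_iff)
    moreover have "(\<lambda>w. (\<lambda>n. X n w, \<lambda>n. Y n w)) -` (A \<times> B) \<inter> space M =
        ((\<lambda>w n. X n w) -` A \<inter> space M) \<inter> ((\<lambda>w n. Y n w) -` B \<inter> space M)" by auto
    ultimately show ?thesis
      using indep_varsD[OF X J(2) J(1), of a] indep_varsD[OF Y J(2) J(1), of b] ab by simp
  qed
  have G: "indep_sets G UNIV"
  proof (rule indep_setsI[OF G_ev])
    fix A J assume J: "J \<noteq> {}" "J \<subseteq> (UNIV :: nat set)" "finite J" and A: "\<forall>j\<in>J. A j \<in> G j"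
    then obtain a b where ab: "\<And>j. j \<in> J \<Longrightarrow> a j \<in> sets borel" "\<And>j. j \<in> J \<Longrightarrow> b j \<in> sets borel"
        "\<And>j. j \<in> J \<Longrightarrow> A j = (X j -` a j \<inter> space M) \<inter> (Y j -` b j \<inter> space M)"
      unfolding G_def by simp metis
    have single: "prob (A j) = prob (X j -` a j \<inter> space M) * prob (Y j -` b j \<inter> space M)" if "j \<in> J" for j
      using prod[of "{j}" a b] ab that by simp
    have "(\<Inter>j\<in>J. A j) = (\<Inter>j\<in>J. X j -` a j \<inter> space M) \<inter> (\<Inter>j\<in>J. Y j -` b j \<inter> space M)"
      using ab(3) by auto
    then show "prob (\<Inter>j\<in>J. A j) = (\<Prod>j\<in>J. prob (A j))"
      using prod[OF J(3,1) ab(1,2)] by (simp add: single prod.distrib)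
  qed
  have "Int_stable (G n)" for n
  proof (rule Int_stableI)
    fix u v assume "u \<in> G n" "v \<in> G n"
    then obtain a b c d where "a \<in> sets borel" "b \<in> sets borel" "c \<in> sets borel" "d \<in> sets borel"
      "u = (X n -` a \<inter> space M) \<inter> (Y n -` b \<inter> space M)" "v = (X n -` c \<inter> space M) \<inter> (Y n -` d \<inter> space M)"
      unfolding G_def by blast
    then show "u \<inter> v \<in> G n"
      unfolding G_def mem_Collect_eq by (intro exI[of _ "a \<inter> c"] exI[of _ "b \<inter> d"]) auto
  qed
  then have sG: "indep_sets (\<lambda>n. sigma_sets (space M) (G n)) UNIV"
    by (intro indep_sets_sigma[OF G]) auto
  show ?thesis
    unfolding indep_vars_def2
  proof (intro conjI ballI indep_sets_mono_sets[OF sG])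
    fix n :: nat
    let ?S = "sigma (space M) (G n)"
    have Gs: "G n \<subseteq> Pow (space M)" using G_ev sets.sets_into_space by blast
    note sp = space_measure_of[OF Gs] and st = sets_measure_of[OF Gs]
    have "X n \<in> borel_measurable ?S"
    proof (rule measurableI)
      fix a :: "real set" assume a: "a \<in> sets borel"
      have "X n -` a \<inter> space M = (X n -` a \<inter> space M) \<inter> (Y n -` UNIV \<inter> space M)" by blast
      then have "X n -` a \<inter> space M \<in> G n"
        unfolding G_def using a by (intro CollectI exI[of _ a] exI[of _ UNIV] conjI) auto
      then show "X n -` a \<inter> space ?S \<in> sets ?S"
        unfolding sp st by (rule sigma_sets.Basic)
    qed (simp only: space_borel UNIV_I)
    moreover have "Y n \<in> borel_measurable ?S"
    proof (rule measurableI)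
      fix b :: "real set" assume b: "b \<in> sets borel"
      have "Y n -` b \<inter> space M = (X n -` UNIV \<inter> space M) \<inter> (Y n -` b \<inter> space M)" by blast
      then have "Y n -` b \<inter> space M \<in> G n"
        unfolding G_def using b by (intro CollectI exI[of _ UNIV] exI[of _ b] conjI) auto
      then show "Y n -` b \<inter> space ?S \<in> sets ?S"
        unfolding sp st by (rule sigma_sets.Basic)
    qed (simp only: space_borel UNIV_I)
    ultimately have m: "(\<lambda>w. (X n w, Y n w)) \<in> measurable ?S (borel \<Otimes>\<^sub>M borel)"
      by (rule measurable_Pair)
    show "{(\<lambda>w. (X n w, Y n w)) -` A \<inter> space M |A. A \<in> sets (borel \<Otimes>\<^sub>M borel)} \<subseteq> sigma_sets (space M) (G n)"
      using measurable_sets[OF m] unfolding sp st by blast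
  qed measurable
qed

text \<open>The mean value theorem for z powr (1 - \<beta>), in the form that lets the bounds on the
  sum of k powr - \<beta> telescope by induction.\<close>

lemma powr_diff_bounds:
  fixes x \<beta> :: real
  assumes x: "0 < x" and \<beta>: "0 < \<beta>" "\<beta> < 1"
  shows "(1 - \<beta>) * (x + 1) powr - \<beta> \<le> (x + 1) powr (1 - \<beta>) - x powr (1 - \<beta>)"
    and "(x + 1) powr (1 - \<beta>) - x powr (1 - \<beta>) \<le> (1 - \<beta>) * x powr - \<beta>"
proof -
  have "\<exists>z. x < z \<and> z < x + 1 \<and> (x + 1) powr (1 - \<beta>) - x powr (1 - \<beta>) =
      (x + 1 - x) * ((1 - \<beta>) * z powr (1 - \<beta> - 1))"
  proof (rule MVT2)
    fix z assume "x \<le> z" "z \<le> x + 1"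
    then show "((\<lambda>z. z powr (1 - \<beta>)) has_real_derivative (1 - \<beta>) * z powr (1 - \<beta> - 1)) (at z)"
      using x by (intro has_real_derivative_powr) auto
  qed simp
  then obtain z where z: "x < z" "z < x + 1"
    "(x + 1) powr (1 - \<beta>) - x powr (1 - \<beta>) = (1 - \<beta>) * z powr - \<beta>" by auto
  have "(x + 1) powr - \<beta> \<le> z powr - \<beta>" "z powr - \<beta> \<le> x powr - \<beta>"
    using z x \<beta> by (auto intro!: powr_mono2')
  then show "(1 - \<beta>) * (x + 1) powr - \<beta> \<le> (x + 1) powr (1 - \<beta>) - x powr (1 - \<beta>)"
    "(x + 1) powr (1 - \<beta>) - x powr (1 - \<beta>) \<le> (1 - \<beta>) * x powr - \<beta>"
    unfolding z(3) using \<beta> by (auto intro!: mult_left_mono)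
qed

lemma sum_powr_le:
  assumes \<beta>: "0 < \<beta>" "\<beta> < 1"
  shows "(\<Sum>k<n. real (Suc k) powr - \<beta>) \<le> real n powr (1 - \<beta>) / (1 - \<beta>)"
proof (induction n)
  case (Suc n)
  show ?case
  proof (cases "n = 0")
    case True
    then show ?thesis using \<beta> by simp
  next
    case False
    then have "real (Suc n) powr - \<beta> \<le> (real (Suc n) powr (1 - \<beta>) - real n powr (1 - \<beta>)) / (1 - \<beta>)"
      using powr_diff_bounds(1)[of "real n", OF _ \<beta>] \<beta> by (simp add: field_simps)
    then show ?thesis using Suc by (simp add: diff_divide_distrib)
  qed
qed simp

lemma sum_powr_ge:
  assumes \<beta>: "0 < \<beta>" "\<beta> < 1"
  shows "(real (Suc n) powr (1 - \<beta>) - 1) / (1 - \<beta>) \<le> (\<Sum>k<n. real (Suc k) powr - \<beta>)"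
proof (induction n)
  case (Suc n)
  have "(real (Suc (Suc n)) powr (1 - \<beta>) - real (Suc n) powr (1 - \<beta>)) / (1 - \<beta>) \<le> real (Suc n) powr - \<beta>"
    using powr_diff_bounds(2)[of "real (Suc n)", OF _ \<beta>] \<beta> by (simp add: field_simps)
  then show ?case using Suc by (simp add: diff_divide_distrib)
qed simp

lemma sum_powr_asymp:
  assumes \<beta>: "0 < \<beta>" "\<beta> < 1"
  shows "(\<lambda>n. (\<Sum>k<n. real (Suc k) powr - \<beta>) / real n powr (1 - \<beta>)) \<longlonglongrightarrow> 1 / (1 - \<beta>)"
proof (rule tendsto_sandwich)
  show "\<forall>\<^sub>F n in sequentially. (real (Suc n) powr (1 - \<beta>) - 1) / (1 - \<beta>) / real n powr (1 - \<beta>) \<le>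
      (\<Sum>k<n. real (Suc k) powr - \<beta>) / real n powr (1 - \<beta>)"
    by (intro always_eventually allI divide_right_mono sum_powr_ge \<beta>) auto
  show "\<forall>\<^sub>F n in sequentially. (\<Sum>k<n. real (Suc k) powr - \<beta>) / real n powr (1 - \<beta>) \<le> 1 / (1 - \<beta>)"
    using eventually_gt_at_top[of 0]
  proof eventually_elim
    case (elim n)
    then show ?case using divide_right_mono[OF sum_powr_le[OF \<beta>, of n], of "real n powr (1 - \<beta>)"] by simp
  qed
  have "(\<lambda>n. (real (Suc n) powr (1 - \<beta>) - 1) / (1 - \<beta>) / real n powr (1 - \<beta>)) \<longlonglongrightarrow> inverse (1 - \<beta>)"
    using \<beta> by real_asymp
  then show "(\<lambda>n. (real (Suc n) powr (1 - \<beta>) - 1) / (1 - \<beta>) / real n powr (1 - \<beta>)) \<longlonglongrightarrow> 1 / (1 - \<beta>)"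
    by (simp add: inverse_eq_divide)
qed simp

section \<open>The law of \<zeta> satisfies the assumptions on the steps\<close>

locale stable_environment = mixed_environment M \<delta> \<phi> chi xi
  for M :: "'a measure" and \<delta> :: real and \<phi> :: "nat \<Rightarrow> real" and chi xi :: "nat \<Rightarrow> 'a \<Rightarrow> real" +
  fixes \<alpha> \<beta> c' :: real
  assumes symmetric: "\<And>x. x \<ge> 0 \<Longrightarrow>
      \<P>(w in M. log_odds xi 0 w \<le> - x) = \<P>(w in M. log_odds xi 0 w \<ge> x)"
    and alpha: "1 < \<alpha>" "\<alpha> < 2"
    and c': "0 < c'"
    and tail: "(\<lambda>r::real. \<P>(w in M. log_odds xi 0 w > r)) \<sim>[at_top] (\<lambda>r. c' * r powr (- \<alpha>))"
    and beta: "0 < \<beta>" "\<beta> < 1"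
    and phi: "\<And>n. n \<ge> 1 \<Longrightarrow> \<phi> n = real n powr (- \<beta>)"
begin

definition \<mu> :: "real measure" where
  "\<mu> = distr M borel (log_odds xi 0)"

lemma measurable_log_odds [measurable]: "log_odds xi n \<in> borel_measurable M"
  unfolding log_odds_def[abs_def] by measurable

lemma sets_mu: "sets \<mu> = sets borel" and space_mu [simp]: "space \<mu> = UNIV"
  by (simp_all add: \<mu>_def)

lemma prob_space_mu: "prob_space \<mu>"
  unfolding \<mu>_def by (rule prob_space_distr) simp

lemma distr_log_odds: "distr M borel (log_odds xi n) = \<mu>"
proof -
  have h: "(\<lambda>x::real. ln (x / (1 - x))) \<in> borel_measurable borel" by measurable
  have eq: "distr M borel (log_odds xi n) = distr (distr M borel (xi n)) borel (\<lambda>x. ln (x / (1 - x)))" for n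
    by (subst distr_distr[OF h measurable_xi]) (simp add: comp_def log_odds_def[abs_def])
  show ?thesis unfolding \<mu>_def eq[of n] eq[of 0] xi_ident[of n] ..
qed

lemma measure_mu: "A \<in> sets borel \<Longrightarrow> measure \<mu> A = prob {w \<in> space M. log_odds xi 0 w \<in> A}"
  unfolding \<mu>_def by (subst measure_distr) (auto simp: vimage_def Int_def conj_commute)

lemma mu_tails: "0 \<le> x \<Longrightarrow> measure \<mu> {..-x} = measure \<mu> {x..}"
  using symmetric[of x] by (simp add: measure_mu)

text \<open>Symmetry is given for closed half-lines. Open ones are increasing unions of closed ones,
  so continuity from below transfers it.\<close>

lemma mu_strict_tails:
  assumes "0 \<le> x"
  shows "measure \<mu> {..<-x} = measure \<mu> {x<..}"
proof -
  interpret mu: prob_space \<mu> by (rule prob_space_mu)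
  define e where "e n = 1 / real (Suc n)" for n
  have e: "0 < e n" "e n \<le> e m" if "m \<le> n" for m n
    using that by (auto simp: e_def frac_le)
  have ex: "\<exists>n. e n < d" if "0 < d" for d
    using reals_Archimedean[OF that] by (auto simp: e_def inverse_eq_divide)
  have "(\<lambda>n. measure \<mu> {..-(x + e n)}) \<longlonglongrightarrow> measure \<mu> (\<Union>n. {..-(x + e n)})"
  proof (rule mu.finite_Lim_measure_incseq)
    show "incseq (\<lambda>n. {..-(x + e n)})"
      by (rule incseq_SucI) (use e(2)[of _ "Suc _"] in auto)
  qed (auto simp: sets_mu)
  moreover have "(\<Union>n. {..-(x + e n)}) = {..<-x}"
  proof safe
    fix z assume "z < - x"
    then obtain n where "e n < - x - z" using ex[of "- x - z"] by auto
    then show "z \<in> (\<Union>n. {..-(x + e n)})" by (intro UN_I[of n]) auto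
  next
    fix z n assume "z \<le> - (x + e n)"
    then show "z < - x" using e(1)[of n n] by linarith
  qed
  moreover have "(\<lambda>n. measure \<mu> {x + e n..}) \<longlonglongrightarrow> measure \<mu> (\<Union>n. {x + e n..})"
  proof (rule mu.finite_Lim_measure_incseq)
    show "incseq (\<lambda>n. {x + e n..})"
      by (rule incseq_SucI) (use e(2)[of _ "Suc _"] in auto)
  qed (auto simp: sets_mu)
  moreover have "(\<Union>n. {x + e n..}) = {x<..}"
  proof safe
    fix z assume "z > x"
    then obtain n where "e n < z - x" using ex[of "z - x"] by auto
    then show "z \<in> (\<Union>n. {x + e n..})" by (intro UN_I[of n]) auto
  next
    fix z n assume "z \<ge> x + e n"
    then show "z > x" using e(1)[of n n] by linarith
  qed
  moreover have "measure \<mu> {..-(x + e n)} = measure \<mu> {x + e n..}" for n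
    using e(1)[of n n] assms by (intro mu_tails) auto
  ultimately show ?thesis by (simp add: LIMSEQ_unique)
qed

text \<open>Comparison of distribution functions: closed tails settle y \<le> 0, and for positive y
  the complements are open tails.\<close>

lemma symmetric_mu: "distr \<mu> borel uminus = \<mu>"
proof (rule cdf_unique)
  interpret mu: prob_space \<mu> by (rule prob_space_mu)
  have m: "uminus \<in> borel_measurable \<mu>" by (simp add: measurable_cong_sets[OF sets_mu refl])
  show "real_distribution \<mu>"
    by (intro real_distribution.intro prob_space_mu real_distribution_axioms.intro) (simp add: sets_mu)
  show "real_distribution (distr \<mu> borel uminus)"
    by (intro real_distribution.intro mu.prob_space_distr m real_distribution_axioms.intro) simp
  show "cdf (distr \<mu> borel uminus) = cdf \<mu>"
  proof
    fix y :: real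
    have "uminus -` {..y} = {-y..}" by auto
    then have "cdf (distr \<mu> borel uminus) y = measure \<mu> {-y..}"
      using m by (simp add: cdf_def measure_distr)
    also have "\<dots> = measure \<mu> {..y}"
    proof (cases "y \<le> 0")
      case True
      then show ?thesis using mu_tails[of "-y"] by simp
    next
      case False
      have "{-y..} = space \<mu> - {..<-y}" "{..y} = space \<mu> - {y<..}" by auto
      then have "measure \<mu> {-y..} = 1 - measure \<mu> {..<-y}" "measure \<mu> {..y} = 1 - measure \<mu> {y<..}"
        using mu.prob_compl[of "{..<-y}"] mu.prob_compl[of "{y<..}"] by (simp_all add: sets_mu)
      then show ?thesis using mu_strict_tails[of y] False by simp
    qed
    finally show "cdf (distr \<mu> borel uminus) y = cdf \<mu> y" by (simp add: cdf_def)
  qed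
qed

lemma stable_mu: "\<exists>c0 C0 x0. symmetric_stable \<mu> \<alpha> c0 C0 x0"
proof -
  interpret mu: prob_space \<mu> by (rule prob_space_mu)
  have "\<forall>\<^sub>F r in at_top. (1 / 2 :: real) < measure \<mu> {r<..} / (c' * r powr - \<alpha>) \<and>
      measure \<mu> {r<..} / (c' * r powr - \<alpha>) < 2"
  proof -
    \<comment> \<open>The quotient behind asymptotic equivalence takes the value 1 where both sides
      vanish; this case cannot occur for r > 0.\<close>
    define g where "g r = (if measure \<mu> {r<..} = 0 \<and> c' * r powr - \<alpha> = 0 then 1
        else measure \<mu> {r<..} / (c' * r powr - \<alpha>))" for r
    have "((\<lambda>r. if measure \<mu> {r<..} = 0 \<and> c' * r powr - \<alpha> = 0 then 1
        else measure \<mu> {r<..} / (c' * r powr - \<alpha>)) \<longlongrightarrow> 1) at_top"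
    proof -
      have mm: "measure \<mu> {r<..} = \<P>(w in M. log_odds xi 0 w > r)" for r
        by (simp add: measure_mu)
      show ?thesis using tail unfolding asymp_equiv_def mm .
    qed
    then have t: "(g \<longlongrightarrow> 1) at_top" by (simp only: g_def[abs_def])
    have "\<forall>\<^sub>F r in at_top. 1 / 2 < g r" by (rule order_tendstoD(1)[OF t]) simp
    moreover have "\<forall>\<^sub>F r in at_top. g r < 2" by (rule order_tendstoD(2)[OF t]) simp
    ultimately show ?thesis
      using eventually_gt_at_top[of 0]
    proof eventually_elim
      case (elim r)
      have "c' * r powr - \<alpha> \<noteq> 0" using c' elim by simp
      then show ?case using elim by (simp add: g_def)
    qed
  qed
  then obtain r0 where r0: "\<And>r. r0 \<le> r \<Longrightarrow> 1 / 2 < measure \<mu> {r<..} / (c' * r powr - \<alpha>) \<and>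
      measure \<mu> {r<..} / (c' * r powr - \<alpha>) < 2"
    by (auto simp: eventually_at_top_linorder)
  define x0 where "x0 = max 1 r0"
  have x0: "1 \<le> x0" by (simp add: x0_def)
  have bounds: "c' / 2 * x powr - \<alpha> \<le> measure \<mu> {x<..}" "measure \<mu> {x<..} \<le> 2 * c' * x powr - \<alpha>"
    if "x0 \<le> x" for x
  proof -
    have "0 < c' * x powr - \<alpha>" using that x0 c' by simp
    then show "c' / 2 * x powr - \<alpha> \<le> measure \<mu> {x<..}" "measure \<mu> {x<..} \<le> 2 * c' * x powr - \<alpha>"
      using r0[of x] that by (auto simp: x0_def field_simps)
  qed
  \<comment> \<open>Two tails of at most 2 * c' each beyond \<open>x0\<close>; below
    \<open>x0\<close> the second summand makes the bound at least 1.\<close>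
  define C0 where "C0 = 4 * c' + x0 powr \<alpha>"
  have "symmetric_stable \<mu> \<alpha> (c' / 2) C0 x0"
  proof (unfold_locales)
    show "sets \<mu> = sets borel" by (rule sets_mu)
    show "distr \<mu> borel uminus = \<mu>" by (rule symmetric_mu)
    show "1 < \<alpha>" "\<alpha> < 2" "0 < c' / 2" "0 < x0" using alpha c' x0 by auto
    show "0 < C0" unfolding C0_def using c' x0 by (intro add_pos_nonneg) auto
    show "c' / 2 * x powr - \<alpha> \<le> measure \<mu> {..<-x}" if "x0 \<le> x" for x
      using bounds(1)[OF that] mu_strict_tails[of x] that x0 by simp
    show "measure \<mu> {z. x < \<bar>z\<bar>} \<le> C0 * x powr - \<alpha>" if "0 < x" for x
    proof (cases "x0 \<le> x")
      case True
      have "{z. x < \<bar>z\<bar>} = {..<-x} \<union> {x<..}" using that by auto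
      also have "measure \<mu> \<dots> \<le> measure \<mu> {..<-x} + measure \<mu> {x<..}"
        by (rule measure_Un_le) (simp_all add: sets_mu)
      also have "\<dots> \<le> 4 * c' * x powr - \<alpha>"
        using bounds(2)[OF True] mu_strict_tails[of x] that by simp
      also have "\<dots> \<le> C0 * x powr - \<alpha>" by (simp add: C0_def mult_right_mono)
      finally show ?thesis .
    next
      case False
      have "measure \<mu> {z. x < \<bar>z\<bar>} \<le> x powr \<alpha> * x powr - \<alpha>"
        using that by (simp add: powr_add[symmetric])
      also have "\<dots> \<le> x0 powr \<alpha> * x powr - \<alpha>"
        using False that alpha by (intro mult_right_mono powr_mono2) auto
      also have "\<dots> \<le> C0 * x powr - \<alpha>"
        using c' by (intro mult_right_mono) (auto simp: C0_def)
      finally show ?thesis .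
    qed
  qed
  then show ?thesis by blast
qed

text \<open>Transfers almost sure statements from the product space to the environment. The index
  shift matches the potential, which starts at site 1.\<close>

lemma AE_log_odds:
  assumes "AE f in (\<Pi>\<^sub>M i\<in>(UNIV::nat set). \<mu>). P f"
  shows "AE w in M. P (\<lambda>i. log_odds xi (Suc i) w)"
proof -
  let ?S = "\<Pi>\<^sub>M i\<in>(UNIV::nat set). \<mu>"
  have "indep_vars (\<lambda>_. borel) (\<lambda>n w. ln (xi n w / (1 - xi n w))) UNIV"
    by (rule indep_vars_compose2[OF xi_indep]) measurable
  then have "indep_vars (\<lambda>_. borel) (log_odds xi) UNIV"
    by (simp add: log_odds_def[abs_def])
  then have law: "distr M (\<Pi>\<^sub>M i\<in>UNIV. borel) (\<lambda>w n. log_odds xi n w) = ?S"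
    by (subst (asm) indep_vars_iff_distr_eq_PiM') (simp_all add: distr_log_odds restrict_UNIV)
  have shift: "distr ?S ?S (\<lambda>f i. f (Suc i)) = ?S"
    using distr_PiM_reindex[of UNIV "\<lambda>_. \<mu>" Suc UNIV] prob_space_mu by (simp add: restrict_UNIV)
  have "AE f in distr ?S ?S (\<lambda>f i. f (Suc i)). P f" unfolding shift by (rule assms)
  then have "AE f in ?S. P (\<lambda>i. f (Suc i))"
    by (rule AE_distrD[rotated]) (intro measurable_PiM_single', simp_all add: measurable_component_singleton)
  then have "AE f in distr M (\<Pi>\<^sub>M i\<in>UNIV. borel) (\<lambda>w n. log_odds xi n w). P (\<lambda>i. f (Suc i))"
    by (simp only: law)
  then show ?thesis
    by (rule AE_distrD[rotated]) (intro measurable_PiM_single', simp_all)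
qed

abbreviation environment :: "'a \<Rightarrow> nat \<Rightarrow> real" where
  "environment w \<equiv> (\<lambda>n. env_prob \<delta> chi xi n w)"

lemma ln_odds_environment:
  assumes "w \<in> space M"
  shows "ln (environment w n / (1 - environment w n)) =
    chi n w * drift_rho \<delta> + (1 - chi n w) * log_odds xi n w"
proof -
  consider "chi n w = 0" | "chi n w = 1" using chi_range[OF assms, of n] by auto
  then show ?thesis
  proof cases
    case 2
    have env: "environment w n = (1 - \<delta>) / 2" using 2 by (simp add: env_prob_def)
    have compl: "1 - (1 - \<delta>) / 2 = (1 + \<delta>) / 2" by (simp add: field_simps)
    have quot: "a / 2 / (b / 2) = a / b" for a b :: real by simp
    show ?thesis unfolding env compl quot using 2 by (simp add: drift_rho_def)
  qed (simp add: env_prob_def log_odds_def)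
qed

lemma potential_environment:
  assumes "w \<in> space M"
  shows "potential (environment w) n =
    (\<Sum>k<n. chi (Suc k) w * drift_rho \<delta> + (1 - chi (Suc k) w) * log_odds xi (Suc k) w)"
  unfolding potential_def using ln_odds_environment[OF assms] by simp

section \<open>Moments of the environment, and the potential as a perturbed walk\<close>

lemma integral_log_odds:
  fixes g :: "real \<Rightarrow> real"
  assumes "g \<in> borel_measurable borel"
  shows "expectation (\<lambda>w. g (log_odds xi n w)) = (\<integral>z. g z \<partial>\<mu>)"
  using integral_distr[OF measurable_log_odds assms, of n] by (simp only: distr_log_odds)

lemma integrable_log_odds:
  fixes g :: "real \<Rightarrow> real"
  assumes "integrable \<mu> g"
  shows "integrable M (\<lambda>w. g (log_odds xi n w))"
  using integrable_distr[OF measurable_log_odds[of n], where f = g] assms by (simp only: distr_log_odds)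

lemma integrable_chi: "integrable M (chi n)"
proof (rule integrable_const_bound[where B = 1])
  show "AE w in M. norm (chi n w) \<le> 1"
  proof (rule AE_I2)
    fix w assume "w \<in> space M"
    then have "chi n w \<in> {0, 1}" by (rule chi_range)
    then show "norm (chi n w) \<le> 1" by auto
  qed
qed simp

lemma expectation_chi: "expectation (chi n) = \<phi> n"
proof -
  have "expectation (chi n) = expectation (indicator {w \<in> space M. chi n w = 1})"
    using chi_range[of _ n] by (intro Bochner_Integration.integral_cong) (auto simp: indicator_def)
  then show ?thesis by (simp add: chi_prob)
qed

lemma indep_chi_log_odds:
  assumes g: "g \<in> borel_measurable borel" and h: "h \<in> borel_measurable borel"
  shows "indep_var borel (\<lambda>w. g (chi n w) :: real) borel (\<lambda>w. h (log_odds xi n w) :: real)"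
proof -
  have "indep_var borel ((\<lambda>f. g (f n)) \<circ> (\<lambda>w n. chi n w)) borel
      ((\<lambda>f. h (ln (f n / (1 - f n)))) \<circ> (\<lambda>w n. xi n w))"
  proof (rule indep_var_compose[OF chi_xi_indep])
    note g [measurable] and h [measurable]
    show "(\<lambda>f. g (f n)) \<in> borel_measurable (\<Pi>\<^sub>M n\<in>UNIV. borel)" by measurable
    show "(\<lambda>f. h (ln (f n / (1 - f n)))) \<in> borel_measurable (\<Pi>\<^sub>M n\<in>UNIV. borel)" by measurable
  qed
  then show ?thesis by (simp add: comp_def log_odds_def)
qed

text \<open>The mean is of order \<open>n powr (1 - \<beta>)\<close> because \<open>\<zeta>\<close> is integrable; this is below the order
  \<open>n powr (1 / \<alpha>)\<close> of the random walk exactly in the regime of part (ii).\<close>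

definition perturbation :: "nat \<Rightarrow> 'a \<Rightarrow> real" where
  "perturbation n w = (\<Sum>k<n. chi (Suc k) w * (\<bar>log_odds xi (Suc k) w\<bar> + \<bar>drift_rho \<delta>\<bar>))"

lemma perturbation_nonneg: "w \<in> space M \<Longrightarrow> 0 \<le> perturbation n w"
  unfolding perturbation_def using chi_range[of w]
  by (intro sum_nonneg mult_nonneg_nonneg) (auto, metis insert_iff singletonD zero_le_one order_refl)

lemma measurable_perturbation [measurable]: "perturbation n \<in> borel_measurable M"
  unfolding perturbation_def[abs_def] by measurable

text \<open>A site with chi = 1 replaces \<zeta> by \<rho>, which changes the sum by at most the
  corresponding term of \<open>perturbation\<close>. As these terms are nonnegative, the value at n
  serves all i \<le> n at once.\<close>

lemma potential_near_psum:
  assumes w: "w \<in> space M" and i: "i \<le> n"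
  shows "\<bar>potential (environment w) i - psum (\<lambda>k. log_odds xi (Suc k) w) i\<bar> \<le> perturbation n w"
proof -
  have chi: "chi k w = 0 \<or> chi k w = 1" for k using chi_range[OF w, of k] by simp
  have "\<bar>potential (environment w) i - psum (\<lambda>k. log_odds xi (Suc k) w) i\<bar> =
      \<bar>\<Sum>k<i. chi (Suc k) w * (drift_rho \<delta> - log_odds xi (Suc k) w)\<bar>"
    unfolding potential_environment[OF w] psum_def sum_subtractf[symmetric] by (simp add: algebra_simps)
  also have "\<dots> \<le> (\<Sum>k<i. \<bar>chi (Suc k) w * (drift_rho \<delta> - log_odds xi (Suc k) w)\<bar>)"
    by (rule sum_abs)
  also have "\<dots> \<le> perturbation i w"
    unfolding perturbation_def
  proof (rule sum_mono)
    fix k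
    show "\<bar>chi (Suc k) w * (drift_rho \<delta> - log_odds xi (Suc k) w)\<bar> \<le>
        chi (Suc k) w * (\<bar>log_odds xi (Suc k) w\<bar> + \<bar>drift_rho \<delta>\<bar>)"
      using chi[of "Suc k"] by auto
  qed
  also have "\<dots> \<le> perturbation n w"
    unfolding perturbation_def
  proof (rule sum_mono2)
    show "0 \<le> chi (Suc k) w * (\<bar>log_odds xi (Suc k) w\<bar> + \<bar>drift_rho \<delta>\<bar>)" for k
      using chi[of "Suc k"] by auto
  qed (use i in auto)
  finally show ?thesis .
qed

text \<open>chi and \<zeta> are independent at each site, so each term has mean \<phi> times a
  finite constant, and the values of \<phi> are summed by \<open>sum_powr_le\<close>.\<close>

lemma expectation_perturbation:
  "\<exists>C>0. \<forall>n. integrable M (perturbation n) \<and> expectation (perturbation n) \<le> C * real n powr (1 - \<beta>)"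
proof -
  obtain c0 C0 x0 where "symmetric_stable \<mu> \<alpha> c0 C0 x0" using stable_mu by blast
  then interpret W: symmetric_stable \<mu> \<alpha> c0 C0 x0 .
  define g where "g z = \<bar>z\<bar> + \<bar>drift_rho \<delta>\<bar>" for z
  have g [measurable]: "g \<in> borel_measurable borel" unfolding g_def[abs_def] by measurable
  have ig: "integrable \<mu> g"
    unfolding g_def[abs_def] by (intro Bochner_Integration.integrable_add W.integrable_abs) simp
  define m where "m = (\<integral>z. g z \<partial>\<mu>)"
  have m: "0 \<le> m" unfolding m_def by (rule integral_nonneg_AE) (simp add: g_def)
  have id: "(\<lambda>x::real. x) \<in> borel_measurable borel" by simp
  have "integrable M (\<lambda>w. chi n w * g (log_odds xi n w)) \<and>
      expectation (\<lambda>w. chi n w * g (log_odds xi n w)) = \<phi> n * m" for n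
    using indep_var_integrable[OF indep_chi_log_odds[OF id g, of n] integrable_chi integrable_log_odds[OF ig]]
      indep_var_lebesgue_integral[OF indep_chi_log_odds[OF id g, of n] integrable_chi integrable_log_odds[OF ig]]
    by (simp add: expectation_chi integral_log_odds[OF g] m_def)
  then have int: "integrable M (\<lambda>w. chi n w * g (log_odds xi n w))"
    and ex: "expectation (\<lambda>w. chi n w * g (log_odds xi n w)) = \<phi> n * m" for n by auto
  have pert: "perturbation n = (\<lambda>w. \<Sum>k<n. chi (Suc k) w * g (log_odds xi (Suc k) w))" for n
    by (simp add: perturbation_def g_def fun_eq_iff)
  have "integrable M (perturbation n)" for n
    unfolding pert by (intro Bochner_Integration.integrable_sum int)
  \<comment> \<open>The summand 1 makes the constant positive without a lower bound on m.\<close>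
  moreover have "expectation (perturbation n) \<le> (m / (1 - \<beta>) + 1) * real n powr (1 - \<beta>)" for n
  proof -
    have "expectation (perturbation n) = (\<Sum>k<n. real (Suc k) powr - \<beta> * m)"
      unfolding pert by (subst Bochner_Integration.integral_sum) (simp_all add: int ex phi)
    also have "\<dots> = m * (\<Sum>k<n. real (Suc k) powr - \<beta>)"
      by (simp add: sum_distrib_left mult.commute)
    also have "\<dots> \<le> m * (real n powr (1 - \<beta>) / (1 - \<beta>))"
      by (intro mult_left_mono sum_powr_le beta m)
    also have "\<dots> \<le> (m / (1 - \<beta>) + 1) * real n powr (1 - \<beta>)"
      by (simp add: algebra_simps)
    finally show ?thesis .
  qed
  ultimately show ?thesis
    using m beta by (intro exI[of _ "m / (1 - \<beta>) + 1"]) (auto intro!: add_nonneg_pos)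
qed

text \<open>Markov's inequality along powers of 2 leaves a geometric series of ratio 2 powr (1 -
  \<beta> - \<theta>), below 1 by the choice of \<theta>.\<close>

lemma AE_perturbation:
  assumes \<theta>: "1 - \<beta> < \<theta>"
  shows "AE w in M. \<forall>\<^sub>F k in sequentially. perturbation (2 ^ k) w \<le> (2 ^ k) powr \<theta>"
proof -
  obtain C where C: "0 < C" "\<And>n. integrable M (perturbation n)"
    "\<And>n. expectation (perturbation n) \<le> C * real n powr (1 - \<beta>)"
    using expectation_perturbation by blast
  have "AE w in M. \<forall>\<^sub>F k in sequentially. \<not> (2 ^ k) powr \<theta> < perturbation (2 ^ k) w"
  proof (rule AE_eventually_not[OF _ always_eventually], safe)
    fix k :: nat
    show "prob {w \<in> space M. (2 ^ k) powr \<theta> < perturbation (2 ^ k) w} \<le> C * (2 powr (1 - \<beta> - \<theta>)) ^ k"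
    proof -
      have "prob {w \<in> space M. (2 ^ k) powr \<theta> < perturbation (2 ^ k) w} \<le> prob {w \<in> space M. (2 ^ k) powr \<theta> \<le> perturbation (2 ^ k) w}"
        by (intro finite_measure_mono) auto
      also have "\<dots> \<le> expectation (perturbation (2 ^ k)) / (2 ^ k) powr \<theta>"
        by (rule integral_Markov_inequality_measure[where A = "{}"])
           (auto simp: C perturbation_nonneg intro!: AE_I2)
      also have "\<dots> \<le> C * real (2 ^ k) powr (1 - \<beta>) / (2 ^ k) powr \<theta>"
        by (intro divide_right_mono C) auto
      also have "\<dots> = C * (2 ^ k) powr (1 - \<beta> - \<theta>)" by (simp add: powr_diff)
      also have "((2::real) ^ k) powr (1 - \<beta> - \<theta>) = (2 powr (1 - \<beta> - \<theta>)) ^ k"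
        by (simp add: powr_realpow[symmetric] powr_powr mult.commute)
      finally show ?thesis .
    qed
    have "2 powr (1 - \<beta> - \<theta>) < (1::real)" using \<theta> powr_less_mono[of "1 - \<beta> - \<theta>" 0 2] by simp
    then show "summable (\<lambda>k. C * (2 powr (1 - \<beta> - \<theta>)) ^ k)"
      by (intro summable_mult summable_geometric) simp
  qed measurable
  then show ?thesis by (simp only: not_less)
qed

lemma perturbation_exponent:
  assumes "1 - 1 / \<alpha> < \<beta>"
  obtains \<theta> where "1 - \<beta> < \<theta>" "\<theta> < 1 / \<alpha>"
  using dense[of "1 - \<beta>" "1 / \<alpha>"] assms by auto

lemma AE_potential_exceeds:
  assumes \<beta>: "1 - 1 / \<alpha> < \<beta>" and \<eta>: "0 < \<eta>"
  shows "AE w in M. \<forall>\<^sub>F k in sequentially.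
    \<exists>j\<le>2 ^ k. climb \<alpha> \<eta> k \<le> potential (environment w) j"
proof -
  obtain c0 C0 x0 where "symmetric_stable \<mu> \<alpha> c0 C0 x0" using stable_mu by blast
  then interpret W: symmetric_stable \<mu> \<alpha> c0 C0 x0 .
  obtain \<theta> where \<theta>: "1 - \<beta> < \<theta>" "\<theta> < 1 / \<alpha>" using perturbation_exponent[OF \<beta>] .
  \<comment> \<open>The perturbation is smaller by a power of 2 ^ k, which beats the powers of k in
    \<open>climb\<close>.\<close>
  have small: "\<forall>\<^sub>F k in sequentially. ((2::real) ^ k) powr \<theta> \<le> climb \<alpha> \<eta> k"
    using \<theta> \<eta> alpha by real_asymp
  show ?thesis
    using AE_log_odds[OF W.AE_max_exceeds[OF \<eta>]] AE_perturbation[OF \<theta>(1)] AE_space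
  proof eventually_elim
    case (elim w)
    show ?case
      using elim(1) elim(2) small
    proof eventually_elim
      case (elim k)
      then obtain j where j: "j \<le> 2 ^ k"
        "2 * climb \<alpha> \<eta> k < psum (\<lambda>i. log_odds xi (Suc i) w) j" by blast
      then show ?case
        using potential_near_psum[OF \<open>w \<in> space M\<close> j(1)] elim by (intro exI[of _ j]) linarith
    qed
  qed
qed

lemma AE_potential_confined:
  assumes \<beta>: "1 - 1 / \<alpha> < \<beta>"
  shows "\<exists>K>0. AE w in M. \<exists>\<^sub>\<infinity>j. \<forall>i\<le>2 ^ (j\<^sup>2).
    \<bar>potential (environment w) i\<bar> \<le> K * confinement \<alpha> j"
proof -
  obtain c0 C0 x0 where "symmetric_stable \<mu> \<alpha> c0 C0 x0" using stable_mu by blast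
  then interpret W: symmetric_stable \<mu> \<alpha> c0 C0 x0 .
  obtain \<theta> where \<theta>: "1 - \<beta> < \<theta>" "\<theta> < 1 / \<alpha>" using perturbation_exponent[OF \<beta>] .
  have small: "\<forall>\<^sub>F j in sequentially. ((2::real) ^ (j\<^sup>2)) powr \<theta> \<le> confinement \<alpha> j"
    using \<theta> alpha beta by real_asymp
  obtain K where K: "0 < K" "AE f in W.S. \<exists>\<^sub>\<infinity>j. \<forall>i\<le>2 ^ (j\<^sup>2). \<bar>psum f i\<bar> \<le> K * confinement \<alpha> j"
    using W.AE_confined by blast
  have sq: "filterlim (\<lambda>j::nat. j\<^sup>2) sequentially sequentially"
    by (rule filterlim_at_top_mono[OF filterlim_ident]) (simp add: power2_eq_square)
  have "AE w in M. \<exists>\<^sub>\<infinity>j. \<forall>i\<le>2 ^ (j\<^sup>2).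
      \<bar>potential (environment w) i\<bar> \<le> (K + 1) * confinement \<alpha> j"
    using AE_log_odds[OF K(2)] AE_perturbation[OF \<theta>(1)] AE_space
  proof eventually_elim
    case (elim w)
    have "\<forall>\<^sub>F j in sequentially. perturbation (2 ^ (j\<^sup>2)) w \<le> (2 ^ (j\<^sup>2)) powr \<theta>"
      by (rule eventually_compose_filterlim[OF elim(2) sq])
    with small have ev: "\<forall>\<^sub>F j in sequentially. perturbation (2 ^ (j\<^sup>2)) w \<le> confinement \<alpha> j"
      by eventually_elim simp
    show ?case
      using frequently_eventually_conj[OF elim(1)[unfolded cofinite_eq_sequentially] ev]
      unfolding cofinite_eq_sequentially
    proof (rule frequently_elim1, intro allI impI)
      fix j i :: nat
      assume *: "perturbation (2 ^ (j\<^sup>2)) w \<le> confinement \<alpha> j \<and>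
          (\<forall>i\<le>2 ^ (j\<^sup>2). \<bar>psum (\<lambda>i. log_odds xi (Suc i) w) i\<bar> \<le> K * confinement \<alpha> j)"
        and i: "i \<le> 2 ^ (j\<^sup>2)"
      then have "\<bar>psum (\<lambda>i. log_odds xi (Suc i) w) i\<bar> \<le> K * confinement \<alpha> j" by blast
      then show "\<bar>potential (environment w) i\<bar> \<le> (K + 1) * confinement \<alpha> j"
        using potential_near_psum[OF \<open>w \<in> space M\<close> i] * unfolding distrib_right by linarith
    qed
  qed
  then show ?thesis using K(1) by (intro exI[of _ "K + 1"]) auto
qed

lemma prob_log_odds: "A \<in> sets borel \<Longrightarrow> prob {w \<in> space M. log_odds xi n w \<in> A} = measure \<mu> A"
  unfolding distr_log_odds[of n, symmetric] by (subst measure_distr) (auto simp: vimage_def Int_def conj_commute)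

text \<open>Truncating \<open>\<zeta>\<^sub>n\<close> at \<open>n powr \<tau>\<close> with \<open>1 / \<alpha> < \<tau> < 1 - \<beta>\<close> changes only finitely many terms, and
  makes the fluctuations of the potential smaller than \<open>n powr \<tau>\<close>.\<close>

lemma AE_potential_asymp:
  assumes \<beta>: "\<beta> < 1 - 1 / \<alpha>"
  shows "AE w in M. (\<lambda>n. potential (environment w) n / real n powr (1 - \<beta>)) \<longlonglongrightarrow> drift_rho \<delta> / (1 - \<beta>)"
proof -
  obtain c0 C0 x0 where "symmetric_stable \<mu> \<alpha> c0 C0 x0" using stable_mu by blast
  then interpret W: symmetric_stable \<mu> \<alpha> c0 C0 x0 .
  obtain K where K: "0 < K" "\<And>x. 1 \<le> x \<Longrightarrow> W.trunc 2 x \<le> K * x powr (2 - \<alpha>)"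
    using W.trunc_2_bound by blast
  obtain \<tau> where \<tau>: "1 / \<alpha> < \<tau>" "\<tau> < 1 - \<beta>" using dense[of "1 / \<alpha>" "1 - \<beta>"] \<beta> by auto
  have \<tau>0: "0 < \<tau>" using \<tau> alpha by (meson less_trans zero_less_divide_1_iff zero_less_one)
  have \<tau>\<alpha>: "1 < \<tau> * \<alpha>" using \<tau> alpha by (simp add: field_simps)
  define \<rho> where "\<rho> = drift_rho \<delta>"
  \<comment> \<open>The shift by one makes every truncation level at least 1, including the one at
    site 0, as \<open>trunc_2_bound\<close> requires.\<close>
  define lev where "lev n = real (Suc n) powr \<tau>" for n
  have lev: "1 \<le> lev n" for n unfolding lev_def using \<tau>0 by (intro ge_one_powr_ge_zero) auto
  define h where "h n z = (if \<bar>z\<bar> \<le> lev n then z else 0)" for n and z :: real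
  have h [measurable]: "h n \<in> borel_measurable borel" for n unfolding h_def[abs_def] by measurable
  have h_le: "\<bar>h n z\<bar> \<le> lev n" for n z using lev[of n] by (simp add: h_def)
  have \<phi>: "0 \<le> \<phi> n" "\<phi> n \<le> 1" for n using phi_range by auto
  \<comment> \<open>The centred, bounded part of an increment: the truncated \<zeta> where chi = 0,
    plus the fluctuation of the drift around \<rho> * \<phi>. The mean drift and the truncation
    error are treated separately below.\<close>
  define X where "X n w = (1 - chi n w) * h n (log_odds xi n w) + \<rho> * (chi n w - \<phi> n)" for n w
  have ind: "indep_vars (\<lambda>_. borel) X UNIV"
  proof -
    have "indep_vars (\<lambda>_. borel) (\<lambda>n w. (\<lambda>(c, x). (1 - c) * h n (ln (x / (1 - x))) + \<rho> * (c - \<phi> n))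
        (chi n w, xi n w)) UNIV"
      by (rule indep_vars_compose2[OF indep_vars_Pair[OF chi_indep xi_indep chi_xi_indep]]) measurable
    then show ?thesis by (simp add: X_def[abs_def] log_odds_def)
  qed
  have chi01: "chi n w = 0 \<or> chi n w = 1" if "w \<in> space M" for n w using chi_range[OF that, of n] by simp
  have X_le: "\<bar>X n w\<bar> \<le> lev n + \<bar>\<rho>\<bar>" if "w \<in> space M" for n w
  proof -
    have "\<bar>(1 - chi n w) * h n (log_odds xi n w)\<bar> \<le> lev n"
      using chi01[OF that, of n] h_le[of n "log_odds xi n w"] lev[of n] by auto
    moreover have "\<bar>\<rho> * (chi n w - \<phi> n)\<bar> \<le> \<bar>\<rho>\<bar>"
    proof -
      have "\<bar>chi n w - \<phi> n\<bar> \<le> 1" using chi01[OF that, of n] \<phi>[of n] by auto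
      then show ?thesis using mult_left_mono[of "\<bar>chi n w - \<phi> n\<bar>" 1 "\<bar>\<rho>\<bar>"] by (simp add: abs_mult)
    qed
    ultimately show ?thesis unfolding X_def by linarith
  qed
  have ih: "integrable M (\<lambda>w. h n (log_odds xi n w))" for n
    by (rule integrable_const_bound[where B = "lev n"]) (simp_all add: h_le)
  have X_mean: "expectation (X n) = 0" for n
  proof -
    have "(\<integral>z. h n z \<partial>\<mu>) = 0" by (rule W.integral_odd[OF h]) (simp add: h_def)
    then have h0: "expectation (\<lambda>w. h n (log_odds xi n w)) = 0" by (simp only: integral_log_odds[OF h])
    have g: "(\<lambda>c::real. 1 - c) \<in> borel_measurable borel" by simp
    have i1: "integrable M (\<lambda>w. 1 - chi n w)" using integrable_chi[of n] by simp
    have "expectation (\<lambda>w. (1 - chi n w) * h n (log_odds xi n w)) = 0"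
      using indep_var_lebesgue_integral[OF indep_chi_log_odds[OF g h, of n] i1 ih] h0 by simp
    moreover have "integrable M (\<lambda>w. (1 - chi n w) * h n (log_odds xi n w))"
      by (rule indep_var_integrable[OF indep_chi_log_odds[OF g h, of n] i1 ih])
    moreover have "expectation (\<lambda>w. \<rho> * (chi n w - \<phi> n)) = 0"
      using integrable_chi[of n] prob_space by (simp add: expectation_chi)
    moreover have "integrable M (\<lambda>w. \<rho> * (chi n w - \<phi> n))" using integrable_chi[of n] by simp
    ultimately show ?thesis unfolding X_def[abs_def] by simp
  qed
  define C where "C = 2 * K + 2 * \<rho>\<^sup>2"
  have C: "0 < C" using K by (auto simp: C_def intro!: add_pos_nonneg)
  have X_sq: "expectation (\<lambda>w. (X n w)\<^sup>2) \<le> C * real (Suc n) powr (\<tau> * (2 - \<alpha>))" for n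
  proof -
    have sq_le: "x\<^sup>2 \<le> b\<^sup>2" if "\<bar>x\<bar> \<le> b" for x b :: real using power_mono[OF that, of 2] by simp
    have mX: "X n \<in> borel_measurable M" unfolding X_def[abs_def] by measurable
    have "expectation (\<lambda>w. (X n w)\<^sup>2) \<le> expectation (\<lambda>w. 2 * (h n (log_odds xi n w))\<^sup>2 + 2 * \<rho>\<^sup>2)"
    proof (rule integral_mono)
      show "integrable M (\<lambda>w. (X n w)\<^sup>2)"
        by (rule integrable_const_bound[where B = "(lev n + \<bar>\<rho>\<bar>)\<^sup>2"])
           (use mX in \<open>auto intro!: AE_I2 sq_le X_le\<close>)
      have "integrable M (\<lambda>w. (h n (log_odds xi n w))\<^sup>2)"
        by (rule integrable_const_bound[where B = "(lev n)\<^sup>2"]) (auto intro!: AE_I2 sq_le h_le)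
      then show "integrable M (\<lambda>w. 2 * (h n (log_odds xi n w))\<^sup>2 + 2 * \<rho>\<^sup>2)" by simp
      fix w assume w: "w \<in> space M"
      let ?a = "(1 - chi n w) * h n (log_odds xi n w)" and ?b = "\<rho> * (chi n w - \<phi> n)"
      have "(?a + ?b)\<^sup>2 \<le> 2 * ?a\<^sup>2 + 2 * ?b\<^sup>2"
        using sum_squares_bound[of ?a ?b] by (simp add: power2_sum)
      moreover have "?a\<^sup>2 \<le> (h n (log_odds xi n w))\<^sup>2" using chi01[OF w, of n] by auto
      moreover have "?b\<^sup>2 \<le> \<rho>\<^sup>2"
      proof -
        have "(chi n w - \<phi> n)\<^sup>2 \<le> 1\<^sup>2" using chi01[OF w, of n] \<phi>[of n] by (intro sq_le) auto
        then show ?thesis using mult_left_mono[of "(chi n w - \<phi> n)\<^sup>2" 1 "\<rho>\<^sup>2"] by (simp add: power_mult_distrib)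
      qed
      ultimately show "(X n w)\<^sup>2 \<le> 2 * (h n (log_odds xi n w))\<^sup>2 + 2 * \<rho>\<^sup>2"
        unfolding X_def by linarith
    qed
    also have "\<dots> = (\<integral>z. 2 * (h n z)\<^sup>2 + 2 * \<rho>\<^sup>2 \<partial>\<mu>)"
      by (rule integral_log_odds) measurable
    also have "\<dots> = 2 * W.trunc 2 (lev n) + 2 * \<rho>\<^sup>2"
    proof -
      have eq: "(h n z)\<^sup>2 = (if \<bar>z\<bar> \<le> lev n then \<bar>z\<bar>\<^sup>2 else 0)" for z by (simp add: h_def)
      show ?thesis
        using W.integrable_trunc[of "lev n" 2] W.M.prob_space unfolding W.trunc_def by (simp add: eq)
    qed
    also have "\<dots> \<le> 2 * (K * lev n powr (2 - \<alpha>)) + 2 * \<rho>\<^sup>2 * lev n powr (2 - \<alpha>)"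
    proof (rule add_mono)
      show "2 * W.trunc 2 (lev n) \<le> 2 * (K * lev n powr (2 - \<alpha>))" using K(2)[OF lev, of n] by simp
      have "1 \<le> lev n powr (2 - \<alpha>)" using lev[of n] alpha by (intro ge_one_powr_ge_zero) auto
      then show "2 * \<rho>\<^sup>2 \<le> 2 * \<rho>\<^sup>2 * lev n powr (2 - \<alpha>)"
        using mult_left_mono[of 1 "lev n powr (2 - \<alpha>)" "2 * \<rho>\<^sup>2"] by simp
    qed
    also have "\<dots> = C * real (Suc n) powr (\<tau> * (2 - \<alpha>))"
      by (simp add: C_def lev_def powr_powr algebra_simps)
    finally show ?thesis .
  qed
  have mX [measurable]: "X n \<in> borel_measurable M" for n unfolding X_def[abs_def] by measurable
  have "AE w in M. \<forall>\<^sub>F k in sequentially. \<not> (\<exists>j\<le>2 ^ k. (2 ^ k) powr \<tau> < \<bar>psum (\<lambda>i. X i w) j\<bar>)"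
  proof (rule AE_eventually_not[OF _ always_eventually], safe)
    fix k :: nat
    show "{w \<in> space M. \<exists>j\<le>2 ^ k. (2 ^ k) powr \<tau> < \<bar>psum (\<lambda>i. X i w) j\<bar>} \<in> events"
      unfolding psum_def by measurable
    show "prob {w \<in> space M. \<exists>j\<le>2 ^ k. (2 ^ k) powr \<tau> < \<bar>psum (\<lambda>i. X i w) j\<bar>} \<le> C * (2 powr (1 - \<tau> * \<alpha>)) ^ k"
    proof -
      define N where "N = (2::real) ^ k"
      have N: "0 < N" by (simp add: N_def)
      have "prob {w \<in> space M. \<exists>j\<le>2 ^ k. (2 ^ k) powr \<tau> < \<bar>psum (\<lambda>i. X i w) j\<bar>} \<le> (\<Sum>i<2 ^ k. expectation (\<lambda>w. (X i w)\<^sup>2)) / (N powr \<tau>)\<^sup>2"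
        unfolding N_def by (rule Kolmogorov_maximal_inequality[OF ind X_le X_mean]) auto
      also have "\<dots> \<le> (\<Sum>i<(2::nat) ^ k. C * N powr (\<tau> * (2 - \<alpha>))) / (N powr \<tau>)\<^sup>2"
      proof (intro divide_right_mono sum_mono)
        fix i :: nat assume "i \<in> {..<2 ^ k}"
        then have "Suc i \<le> 2 ^ k" by simp
        then have "real (Suc i) \<le> real (2 ^ k)" by (rule of_nat_mono)
        then have "real (Suc i) \<le> N" by (simp add: N_def)
        then have "real (Suc i) powr (\<tau> * (2 - \<alpha>)) \<le> N powr (\<tau> * (2 - \<alpha>))"
          using \<tau>0 alpha by (intro powr_mono2) auto
        then show "expectation (\<lambda>w. (X i w)\<^sup>2) \<le> C * N powr (\<tau> * (2 - \<alpha>))"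
          using X_sq[of i] mult_left_mono[of "real (Suc i) powr (\<tau> * (2 - \<alpha>))" "N powr (\<tau> * (2 - \<alpha>))" C] C by linarith
      qed simp
      \<comment> \<open>N variances of order N powr (\<tau> (2 - \<alpha>)) divided by N powr (2
        \<tau>) leave the exponent 1 - \<tau> \<alpha>, which is negative because \<tau> > 1 /
        \<alpha>.\<close>
      also have "\<dots> = C * (N powr 1 * N powr (\<tau> * (2 - \<alpha>)) / N powr (2 * \<tau>))"
        using N by (simp add: N_def powr_power mult.commute)
      also have "\<dots> = C * N powr (1 - \<tau> * \<alpha>)"
        by (simp only: powr_add[symmetric] powr_diff[symmetric]) (simp add: algebra_simps)
      also have "N powr (1 - \<tau> * \<alpha>) = (2 powr (1 - \<tau> * \<alpha>)) ^ k"
        by (simp add: N_def powr_realpow[symmetric] powr_powr mult.commute)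
      finally show ?thesis .
    qed
    have "2 powr (1 - \<tau> * \<alpha>) < (1::real)" using \<tau>\<alpha> powr_less_mono[of "1 - \<tau> * \<alpha>" 0 2] by simp
    then show "summable (\<lambda>k. C * (2 powr (1 - \<tau> * \<alpha>)) ^ k)"
      by (intro summable_mult summable_geometric) simp
  qed
  moreover have "AE w in M. \<forall>\<^sub>F n in sequentially. \<not> lev n < \<bar>log_odds xi n w\<bar>"
  proof (rule AE_eventually_not[OF _ always_eventually], safe)
    fix n
    show "prob {w \<in> space M. lev n < \<bar>log_odds xi n w\<bar>} \<le> C0 * real (Suc n) powr - (\<tau> * \<alpha>)"
    proof -
      have "prob {w \<in> space M. lev n < \<bar>log_odds xi n w\<bar>} = measure \<mu> {z. lev n < \<bar>z\<bar>}"
        using prob_log_odds[of "{z. lev n < \<bar>z\<bar>}" n] by simp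
      also have "\<dots> \<le> C0 * lev n powr - \<alpha>" using lev[of n] by (intro W.upper) auto
      finally show ?thesis by (simp add: lev_def powr_powr)
    qed
    show "summable (\<lambda>n. C0 * real (Suc n) powr - (\<tau> * \<alpha>))"
      using \<tau>\<alpha> summable_Suc_iff[of "\<lambda>n. real n powr - (\<tau> * \<alpha>)"]
      by (intro summable_mult) (simp add: summable_real_powr_iff)
  qed measurable
  ultimately show ?thesis
    using AE_space
  proof eventually_elim
    case (elim w)
    define \<gamma> where "\<gamma> = 1 - \<beta>"
    have \<gamma>: "\<tau> < \<gamma>" "0 < \<gamma>" using \<tau> \<tau>0 by (simp_all add: \<gamma>_def)
    obtain k0 where k0: "\<And>k j. k0 \<le> k \<Longrightarrow> j \<le> 2 ^ k \<Longrightarrow> \<bar>psum (\<lambda>i. X i w) j\<bar> \<le> (2 ^ k) powr \<tau>"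
      using elim(1) by (auto simp: eventually_sequentially not_less)
    \<comment> \<open>The maximal inequality covers all times up to a power of 2, so rounding n up
      to the next such power costs only a factor 2.\<close>
    have ps: "\<bar>psum (\<lambda>i. X i w) n\<bar> \<le> (2 * real n) powr \<tau>" if n: "2 ^ k0 \<le> n" for n
    proof -
      have "1 \<le> real n" using n by (metis le_trans of_nat_1 of_nat_mono one_le_numeral one_le_power)
      from dyadic_ceiling[OF this] obtain k where k: "real n \<le> 2 ^ k" "2 ^ k \<le> 2 * real n" by blast
      have nk: "n \<le> 2 ^ k" using k(1) by (metis of_nat_le_iff of_nat_numeral of_nat_power)
      then have "(2::nat) ^ k0 \<le> 2 ^ k" using n by (rule le_trans[rotated])
      then have "k0 \<le> k" by simp
      then have "\<bar>psum (\<lambda>i. X i w) n\<bar> \<le> (2 ^ k) powr \<tau>" using nk by (rule k0)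
      also have "\<dots> \<le> (2 * real n) powr \<tau>" using k(2) \<tau>0 by (intro powr_mono2) auto
      finally show ?thesis .
    qed
    have l1: "(\<lambda>n. psum (\<lambda>i. X i w) (Suc n) / real n powr \<gamma>) \<longlonglongrightarrow> 0"
    proof (rule Lim_null_comparison)
      show "\<forall>\<^sub>F n in sequentially. norm (psum (\<lambda>i. X i w) (Suc n) / real n powr \<gamma>) \<le>
          (2 * real (Suc n)) powr \<tau> / real n powr \<gamma>"
        using eventually_ge_at_top[of "2 ^ k0"]
      proof eventually_elim
        case (elim n)
        then show ?case using ps[of "Suc n"] by (simp add: divide_right_mono del: psum_Suc)
      qed
      show "(\<lambda>n. (2 * real (Suc n)) powr \<tau> / real n powr \<gamma>) \<longlonglongrightarrow> 0"
        using \<gamma> \<tau>0 by real_asymp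
    qed
    have null: "(\<lambda>n. 1 / real n powr \<gamma>) \<longlonglongrightarrow> 0" using \<gamma> by real_asymp
    have l2: "(\<lambda>n. X 0 w * (1 / real n powr \<gamma>)) \<longlonglongrightarrow> X 0 w * 0" by (intro tendsto_intros null)
    have l3: "(\<lambda>n. \<rho> * ((\<Sum>k<n. \<phi> (Suc k)) / real n powr \<gamma>)) \<longlonglongrightarrow> \<rho> * (1 / \<gamma>)"
    proof (rule tendsto_mult_left)
      show "(\<lambda>n. (\<Sum>k<n. \<phi> (Suc k)) / real n powr \<gamma>) \<longlonglongrightarrow> 1 / \<gamma>"
        using sum_powr_asymp[OF beta] by (simp add: \<gamma>_def phi)
    qed
    \<comment> \<open>The truncation error vanishes beyond a random site N, so its partial sums
      converge and disappear after division by n powr \<gamma>.\<close>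
    define t where "t k = (1 - chi (Suc k) w) * (log_odds xi (Suc k) w - h (Suc k) (log_odds xi (Suc k) w))" for k
    obtain N where N: "\<And>n. N \<le> n \<Longrightarrow> \<bar>log_odds xi n w\<bar> \<le> lev n"
      using elim(2) by (auto simp: eventually_sequentially not_less)
    have "t sums (\<Sum>k<N. t k)"
      using N by (intro sums_finite) (auto simp: t_def h_def)
    then have "(\<lambda>n. \<Sum>k<n. t k) \<longlonglongrightarrow> (\<Sum>k<N. t k)" by (simp add: sums_def)
    then have l4: "(\<lambda>n. (\<Sum>k<n. t k) * (1 / real n powr \<gamma>)) \<longlonglongrightarrow> (\<Sum>k<N. t k) * 0"
      by (intro tendsto_mult null)
    \<comment> \<open>\<open>psum\<close> counts site 0 whereas the potential starts at site 1;
      hence the index \<open>Suc n\<close> and the subtraction of \<open>X 0 w\<close>.\<close>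
    have eq: "potential (environment w) n = psum (\<lambda>i. X i w) (Suc n) - X 0 w + \<rho> * (\<Sum>k<n. \<phi> (Suc k)) + (\<Sum>k<n. t k)" for n
    proof -
      have "psum (\<lambda>i. X i w) (Suc n) = X 0 w + (\<Sum>k<n. X (Suc k) w)"
        unfolding psum_def by (rule sum.lessThan_Suc_shift)
      moreover have "potential (environment w) n = (\<Sum>k<n. X (Suc k) w + \<rho> * \<phi> (Suc k) + t k)"
        unfolding potential_environment[OF \<open>w \<in> space M\<close>]
        by (rule sum.cong) (simp_all add: X_def t_def \<rho>_def algebra_simps)
      ultimately show ?thesis by (simp add: sum.distrib sum_distrib_left)
    qed
    have "(\<lambda>n. potential (environment w) n / real n powr \<gamma>) =
        (\<lambda>n. psum (\<lambda>i. X i w) (Suc n) / real n powr \<gamma> - X 0 w * (1 / real n powr \<gamma>) +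
          \<rho> * ((\<Sum>k<n. \<phi> (Suc k)) / real n powr \<gamma>) + (\<Sum>k<n. t k) * (1 / real n powr \<gamma>))"
      unfolding eq by (simp add: fun_eq_iff add_divide_distrib diff_divide_distrib)
    also have "\<dots> \<longlonglongrightarrow> 0 - X 0 w * 0 + \<rho> * (1 / \<gamma>) + (\<Sum>k<N. t k) * 0"
      by (intro tendsto_add tendsto_diff l1 l2 l3 l4)
    finally show ?case by (simp add: \<gamma>_def \<rho>_def)
  qed
qed

text \<open>The quenched statement Q is not shown to be measurable in \<omega>. The transfer is
  therefore made for the measurable G together with the range of the entries, and Q follows
  pointwise.\<close>

lemma AE_environment_lawI:
  assumes G: "Measurable.pred (\<Pi>\<^sub>M n\<in>UNIV. borel) G"
    and AE: "AE w in M. G (environment w)"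
    and imp: "\<And>\<omega>. (\<And>n. 0 < \<omega> n \<and> \<omega> n < 1) \<Longrightarrow> G \<omega> \<Longrightarrow> Q \<omega>"
  shows "AE \<omega> in environment_law M \<delta> chi xi. Q \<omega>"
proof -
  let ?P = "\<Pi>\<^sub>M n\<in>(UNIV::nat set). (borel :: real measure)"
  have "Measurable.pred ?P (\<lambda>\<omega>. (\<forall>n. 0 < \<omega> n \<and> \<omega> n < 1) \<and> G \<omega>)"
    using G by measurable
  then have "{\<omega> \<in> space ?P. (\<forall>n. 0 < \<omega> n \<and> \<omega> n < 1) \<and> G \<omega>} \<in> sets ?P" by (simp only: pred_def)
  moreover have "AE w in M. (\<forall>n. 0 < environment w n \<and> environment w n < 1) \<and> G (environment w)"
    using AE AE_space by eventually_elim (use env_prob_range in auto)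
  ultimately have "AE \<omega> in environment_law M \<delta> chi xi. (\<forall>n. 0 < \<omega> n \<and> \<omega> n < 1) \<and> G \<omega>"
    unfolding environment_law_def by (subst AE_distr_iff[OF measurable_environment])
  then show ?thesis by eventually_elim (use imp in auto)
qed

end

lemma measurable_potential [measurable]:
  "(\<lambda>\<omega>. potential \<omega> n) \<in> borel_measurable (\<Pi>\<^sub>M n\<in>UNIV. borel)"
  unfolding potential_def by measurable

text \<open>For a fixed limit, testing the errors 1 / (m + 1) expresses convergence by countable
  operations.\<close>

lemma measurable_pred_LIMSEQ:
  fixes f :: "nat \<Rightarrow> 'a \<Rightarrow> real"
  assumes [measurable]: "\<And>n. f n \<in> borel_measurable N"
  shows "Measurable.pred N (\<lambda>x. (\<lambda>n. f n x) \<longlonglongrightarrow> l)"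
proof -
  have eq: "(\<lambda>n. f n x) \<longlonglongrightarrow> l \<longleftrightarrow> (\<forall>m. \<exists>k. \<forall>n\<ge>k. \<bar>f n x - l\<bar> < inverse (real (Suc m)))" for x
    unfolding LIMSEQ_iff
  proof safe
    fix r :: real assume *: "\<forall>m. \<exists>k. \<forall>n\<ge>k. \<bar>f n x - l\<bar> < inverse (real (Suc m))" and "0 < r"
    from reals_Archimedean[OF this(2)] obtain m where "inverse (real (Suc m)) < r" by blast
    then show "\<exists>no. \<forall>n\<ge>no. norm (f n x - l) < r" using *[rule_format, of m] by force
  qed (simp add: real_norm_def)
  show ?thesis unfolding eq by measurable
qed

theorem theorem2p5:
  fixes M :: "'a measure" and \<delta> \<alpha> \<beta> c' :: real
    and \<phi> :: "nat \<Rightarrow> real" and chi xi :: "nat \<Rightarrow> 'a \<Rightarrow> real"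
  assumes env: "mixed_environment M \<delta> \<phi> chi xi"
    and symmetric: "\<And>x. x \<ge> 0 \<Longrightarrow>
      \<P>(w in M. log_odds xi 0 w \<le> - x) = \<P>(w in M. log_odds xi 0 w \<ge> x)"
    and alpha: "1 < \<alpha>" "\<alpha> < 2"
    and c': "0 < c'"
    and tail: "(\<lambda>r::real. \<P>(w in M. log_odds xi 0 w > r)) \<sim>[at_top] (\<lambda>r. c' * r powr (- \<alpha>))"
    and beta: "0 < \<beta>" "\<beta> < 1"
    and phi: "\<And>n. n \<ge> 1 \<Longrightarrow> \<phi> n = real n powr (- \<beta>)"
  shows
    "(\<beta> < 1 - 1 / \<alpha> \<and> \<delta> < 0 \<longrightarrow>
        (AE \<omega> in environment_law M \<delta> chi xi. AE X in quenched_law \<omega>.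
           limsup (\<lambda>t. ereal (real (X t) / ln (real t) powr (1 / (1 - \<beta>)))) =
             ereal (((1 - \<beta>) / drift_rho \<delta>) powr (1 / (1 - \<beta>))))) \<and>
     (\<beta> > 1 - 1 / \<alpha> \<longrightarrow>
        (\<forall>\<epsilon>>0. AE \<omega> in environment_law M \<delta> chi xi. AE X in quenched_law \<omega>.
           \<forall>\<^sub>\<infinity>t. real (X t) \<le> ln (real t) powr \<alpha> * ln (ln (real t)) powr (2 + \<epsilon>)) \<and>
        (\<exists>c>0. AE \<omega> in environment_law M \<delta> chi xi. AE X in quenched_law \<omega>.
           \<exists>\<^sub>\<infinity>t. real (X t) \<ge> c * ln (real t) powr \<alpha> * ln (ln (ln (real t)))))"
proof -
  interpret mixed_environment M \<delta> \<phi> chi xi by (rule env)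
  interpret stable_environment M \<delta> \<phi> chi xi \<alpha> \<beta> c'
    by unfold_locales (fact symmetric alpha c' tail beta phi)+
  have alpha0: "0 < \<alpha>" using alpha by simp
  show ?thesis
  proof (intro conjI impI allI)
    assume *: "\<beta> < 1 - 1 / \<alpha> \<and> \<delta> < 0"
    then have "1 < (1 - \<delta>) / (1 + \<delta>)" using delta_range by (simp add: field_simps)
    then have \<rho>: "0 < drift_rho \<delta>" by (simp add: drift_rho_def)
    show "AE \<omega> in environment_law M \<delta> chi xi. AE X in quenched_law \<omega>.
        limsup (\<lambda>t. ereal (real (X t) / ln (real t) powr (1 / (1 - \<beta>)))) =
          ereal (((1 - \<beta>) / drift_rho \<delta>) powr (1 / (1 - \<beta>)))"
    proof (rule AE_environment_lawI[OF _ AE_potential_asymp])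
      show "Measurable.pred (\<Pi>\<^sub>M n\<in>UNIV. borel)
          (\<lambda>\<omega>. (\<lambda>n. potential \<omega> n / real n powr (1 - \<beta>)) \<longlonglongrightarrow> drift_rho \<delta> / (1 - \<beta>))"
        by (rule measurable_pred_LIMSEQ) measurable
      fix \<omega> :: "nat \<Rightarrow> real"
      assume "\<And>n. 0 < \<omega> n \<and> \<omega> n < 1"
        "(\<lambda>n. potential \<omega> n / real n powr (1 - \<beta>)) \<longlonglongrightarrow> drift_rho \<delta> / (1 - \<beta>)"
      from walk_limsup[OF this(1) _ this(2)] \<rho> beta
      show "AE X in quenched_law \<omega>.
          limsup (\<lambda>t. ereal (real (X t) / ln (real t) powr (1 / (1 - \<beta>)))) =
            ereal (((1 - \<beta>) / drift_rho \<delta>) powr (1 / (1 - \<beta>)))" by simp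
    qed (use * in simp)
  next
    fix \<epsilon> :: real
    assume \<beta>: "1 - 1 / \<alpha> < \<beta>" and \<epsilon>: "0 < \<epsilon>"
    \<comment> \<open>Any value strictly between 0 and \<epsilon> would serve: the gap absorbs the
      constants in \<open>walk_upper\<close>.\<close>
    define \<eta> where "\<eta> = \<epsilon> / 2"
    have \<eta>: "0 < \<eta>" "\<eta> < \<epsilon>" using \<epsilon> by (simp_all add: \<eta>_def)
    show "AE \<omega> in environment_law M \<delta> chi xi. AE X in quenched_law \<omega>.
        \<forall>\<^sub>\<infinity>t. real (X t) \<le> ln (real t) powr \<alpha> * ln (ln (real t)) powr (2 + \<epsilon>)"
    proof (rule AE_environment_lawI[OF _ AE_potential_exceeds[OF \<beta> \<eta>(1)]])
      show "Measurable.pred (\<Pi>\<^sub>M n\<in>UNIV. borel) (\<lambda>\<omega>. \<forall>\<^sub>F k in sequentially.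
          \<exists>j\<le>2 ^ k. climb \<alpha> \<eta> k \<le> potential \<omega> j)"
        unfolding eventually_sequentially by measurable
    qed (rule walk_upper[OF _ alpha0 \<eta>])
  next
    assume \<beta>: "1 - 1 / \<alpha> < \<beta>"
    \<comment> \<open>K is fixed before \<omega> is drawn, so the constant built from it is the same
      for almost every environment.\<close>
    obtain K where K: "0 < K" "AE w in M. \<exists>\<^sub>\<infinity>j. \<forall>i\<le>2 ^ (j\<^sup>2).
        \<bar>potential (environment w) i\<bar> \<le> K * confinement \<alpha> j"
      using AE_potential_confined[OF \<beta>] by blast
    have "AE \<omega> in environment_law M \<delta> chi xi. AE X in quenched_law \<omega>. \<exists>\<^sub>\<infinity>t.
        real (X t) \<ge> 1 / (3 * (3 * K) powr \<alpha>) * ln (real t) powr \<alpha> * ln (ln (ln (real t)))"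
    proof (rule AE_environment_lawI[OF _ K(2)])
      show "Measurable.pred (\<Pi>\<^sub>M n\<in>UNIV. borel) (\<lambda>\<omega>. \<exists>\<^sub>\<infinity>j. \<forall>i\<le>2 ^ (j\<^sup>2).
          \<bar>potential \<omega> i\<bar> \<le> K * confinement \<alpha> j)"
        unfolding INFM_nat_le by measurable
    qed (rule walk_lower[OF _ alpha0 K(1)])
    moreover have "0 < 1 / (3 * (3 * K) powr \<alpha>)" using K(1) by simp
    ultimately show "\<exists>c>0. AE \<omega> in environment_law M \<delta> chi xi. AE X in quenched_law \<omega>.
        \<exists>\<^sub>\<infinity>t. real (X t) \<ge> c * ln (real t) powr \<alpha> * ln (ln (ln (real t)))" by blast
  qed
qed

end
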